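(* Let $\mathcal{C}$ be an efficient exact category, let $\mathcal{S}$ be a set of objects of $\mathcal{C}$ and put $\mathcal{T}=\mathcal{S}^{\perp_1}$. Then: (1) $\operatorname{Filt}\mathcal{S}$ is a precovering class and $\mathcal{T}$ is a preenveloping class in $\mathcal{C}$. (2) If $\mathcal{S}$ is a generating set of $\mathcal{C}$, then $({}^{\perp_1}\mathcal{T},\mathcal{T})$ is a complete cotorsion pair in $\mathcal{C}$ and ${}^{\perp_1}\mathcal{T}$ consists precisely of the direct summands of $\mathcal{S}$-filtered objects. (3) If $\mathcal{C}$ has enough projectives, then $({}^{\perp_1}\mathcal{T},\mathcal{T})$ is a complete cotorsion pair, and an object $M$ is in ${}^{\perp_1}\mathcal{T}$ if and only if it is a direct summand of an object $E$ appearing in a conflation of the form $0\to P\to E\to X\to 0$ with $P$ projective and $X\in\operatorname{Filt}\mathcal{S}$.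
   Context: Exact categories are in the sense of Quillen: an additive category with a distinguished class of kernel-cokernel pairs, called conflations $0\to X\to Y\to Z\to 0$; the first map is an inflation, the second a deflation. $\operatorname{Ext}^1_{\mathcal{C}}(X,Y)$ denotes the Yoneda Ext (equivalence classes of conflations $0\to Y\to Z\to X\to 0$). For a class $\mathcal{S}$ of objects, $\mathcal{S}^{\perp_1}=\{Y\mid \operatorname{Ext}^1_{\mathcal{C}}(S,Y)=0\ \forall S\in\mathcal{S}\}$ and ${}^{\perp_1}\mathcal{S}=\{X\mid \operatorname{Ext}^1_{\mathcal{C}}(X,S)=0\ \forall S\in\mathcal{S}\}$. An object $P$ is projective if every deflation onto $P$ splits; $\mathcal{C}$ has enough projectives if every object $X$ admits a deflation $P\to X$ with $P$ projective. For an ordinal $\lambda$, a $\lambda$-sequence is a direct system $[(X_\alpha)_{\alpha<\lambda},(i_{\alpha\beta})_{\alpha<\beta<\lambda}]$ such that for each limit ordinal $\gamma<\lambda$ the colimit $\operatorname{colim}_{\alpha<\gamma}X_\alpha$ exists and maps isomorphically to $X_\gamma$. If the colimit of the whole system exists, $X_0\to\operatorname{colim}_{\alpha<\lambda}X_\alpha$ is its composition; it is a transfinite composition of morphisms of $\mathcal{M}$ if all $i_{\alpha,\alpha+1}\in\mathcal{M}$. An object $X$ is small relative to a class of morphisms $\mathcal{M}$ if there is an infinite regular cardinal $\kappa$ such that for all ordinals $\lambda$ of cofinality $\ge\kappa$ and all $\lambda$-sequences $(Y_\alpha)_{\alpha<\lambda}$ whose composition exists and with all $Y_\alpha\to Y_{\alpha+1}$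 in $\mathcal{M}$, the canonical map $\operatorname{colim}_{\alpha<\lambda}\operatorname{Hom}(X,Y_\alpha)\to\operatorname{Hom}(X,\operatorname{colim}_{\alpha<\lambda}Y_\alpha)$ is an isomorphism. For a set $\mathcal{I}$ of inflations, $\operatorname{Coker}(\mathcal{I})$ is the class of objects isomorphic to $\operatorname{Coker}(i)$ for some $i\in\mathcal{I}$. $\mathcal{I}$ is strongly homological if for every inflation $j:A\to B$ whose cokernel $S$ belongs to $\operatorname{Coker}(\mathcal{I})$ there are $i:A'\to B'$ in $\mathcal{I}$ and a commutative diagram with conflations $0\to A'\xrightarrow{i}B'\to S\to 0$ and $0\to A\xrightarrow{j}B\to S\to 0$ as rows, given by morphisms $A'\to A$, $B'\to B$ and the identity of $S$. An exact category is efficient if: (Ax1) arbitrary transfinite compositions of inflations exist and are again inflations; (Ax2) every object is small relative to the class of all inflations; (Ax3) for each set of objects $\mathcal{S}$ there is a strongly homological set of inflations $\mathcal{I}$ such that $\operatorname{Coker}(\mathcal{I})$ is the class of objects isomorphic to objects of $\mathcal{S}$. An object $X$ is $\mathcal{S}$-filtered if $0\to X$ is the composition of a $\lambda$-sequence $(X_\alpha)_{\alpha<\lambda}$ with all $X_\alpha\to X_{\alpha+1}$ inflations with cokernel in $\mathcal{S}$; $\operatorname{Filt}\mathcal{S}$ is the class of all $\mathcal{S}$-filtered objects. An $\mathcal{F}$-precover of $X$ is a morphism $f:F\to X$ with $F\in\mathcal{F}$ through which every $F'\to X$ with $F'\in\mathcal{F}$ factors; $\mathcal{F}$ is precovering if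 each object has an $\mathcal{F}$-precover. Preenveloping is dual. A cotorsion pair is a pair $(\mathcal{X},\mathcal{Y})$ of full subcategories with $\mathcal{X}^{\perp_1}=\mathcal{Y}$ and $\mathcal{X}={}^{\perp_1}\mathcal{Y}$; it is complete if for every object $M$ there are conflations $0\to Y\to X\to M\to 0$ and $0\to M\to Y'\to X'\to 0$ with $X,X'\in\mathcal{X}$, $Y,Y'\in\mathcal{Y}$. A class $\mathcal{G}$ of objects is generating if each object $M$ admits a deflation $G\to M$ with $G$ a set-indexed coproduct of objects of $\mathcal{G}$. *)

theory Defs
  imports "HOL-Algebra.Group"
begin

unbundle cardinal_syntax

section \<open>Size\<close>

text \<open>
  HOL has no distinction between sets and proper classes, so size is measured against a set \<open>U\<close>:
  a collection of objects, of morphisms or of indices (of any HOL type) is a ``set'' in the sense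
  of the mathematical text if it has smaller cardinality than \<open>U\<close>, and a class is an arbitrary HOL
  set. Ordinals are the well-orders with small field. Every small collection has a copy inside \<open>U\<close>,
  so for small well-orders, small cardinals and small index sets it is enough to let \<open>'u\<close>, the
  element type of \<open>U\<close>, be their carrier type.
\<close>

definition small :: "'u set \<Rightarrow> 'a set \<Rightarrow> bool" where
  "small U A \<longleftrightarrow> |A| <o |U|"

text \<open>
  The closure conditions: a small union of small sets is small (regularity of \<open>U\<close>), and every small
  set is dominated by a small infinite regular cardinal. They hold in particular when \<open>U\<close> has
  strongly inaccessible cardinality (the case of a Grothendieck universe, lemma
  \<open>size_universe_inaccessible\<close>), but are also satisfied by types that exist in plain HOL (lemma
  \<open>size_universe_cardSuc\<close>).
\<close>

definition size_universe :: "'u set \<Rightarrow> bool" where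
  "size_universe U \<longleftrightarrow> cinfinite |U| \<and> regularCard |U| \<and>
     (\<forall>A :: 'u set. small U A \<longrightarrow>
        (\<exists>\<kappa> :: 'u rel. Cinfinite \<kappa> \<and> regularCard \<kappa> \<and> small U (Field \<kappa>) \<and> |A| \<le>o \<kappa>))"


section \<open>Categories\<close>

record ('o, 'm) cat_data =
  Obj :: "'o set"
  Arr :: "'m set"
  Dom :: "'m \<Rightarrow> 'o"
  Cod :: "'m \<Rightarrow> 'o"
  Id  :: "'o \<Rightarrow> 'm"
  Cmp :: "'m \<Rightarrow> 'm \<Rightarrow> 'm"  (infixl \<open>\<cdot>\<index>\<close> 70)

text \<open>Composition is written in the order of application: \<open>g \<cdot> f\<close> is \<open>f\<close> followed by \<open>g\<close>.\<close>

definition Hom :: "('o, 'm, 'z) cat_data_scheme \<Rightarrow> 'o \<Rightarrow> 'o \<Rightarrow> 'm set" where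
  "Hom C X Y = {f \<in> Arr C. Dom C f = X \<and> Cod C f = Y}"

locale category =
  fixes C :: "('o, 'm, 'z) cat_data_scheme" (structure)
  assumes Dom_Obj: "f \<in> Arr C \<Longrightarrow> Dom C f \<in> Obj C"
    and Cod_Obj: "f \<in> Arr C \<Longrightarrow> Cod C f \<in> Obj C"
    and Id_Hom: "X \<in> Obj C \<Longrightarrow> Id C X \<in> Hom C X X"
    and Cmp_Hom: "\<lbrakk>f \<in> Hom C X Y; g \<in> Hom C Y Z\<rbrakk> \<Longrightarrow> g \<cdot> f \<in> Hom C X Z"
    and Cmp_Id: "f \<in> Hom C X Y \<Longrightarrow> f \<cdot> Id C X = f"
    and Id_Cmp: "f \<in> Hom C X Y \<Longrightarrow> Id C Y \<cdot> f = f"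
    and Cmp_assoc: "\<lbrakk>f \<in> Hom C W X; g \<in> Hom C X Y; h \<in> Hom C Y Z\<rbrakk>
                      \<Longrightarrow> (h \<cdot> g) \<cdot> f = h \<cdot> (g \<cdot> f)"

definition locally_small :: "'u set \<Rightarrow> ('o, 'm, 'z) cat_data_scheme \<Rightarrow> bool" where
  "locally_small U C \<longleftrightarrow> (\<forall>X \<in> Obj C. \<forall>Y \<in> Obj C. small U (Hom C X Y))"

definition is_iso :: "('o, 'm, 'z) cat_data_scheme \<Rightarrow> 'm \<Rightarrow> bool" where
  "is_iso C f \<longleftrightarrow> f \<in> Arr C \<and>
     (\<exists>g \<in> Hom C (Cod C f) (Dom C f).
        g \<cdot>\<^bsub>C\<^esub> f = Id C (Dom C f) \<and> f \<cdot>\<^bsub>C\<^esub> g = Id C (Cod C f))"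

definition isomorphic :: "('o, 'm, 'z) cat_data_scheme \<Rightarrow> 'o \<Rightarrow> 'o \<Rightarrow> bool" where
  "isomorphic C X Y \<longleftrightarrow> (\<exists>f \<in> Hom C X Y. is_iso C f)"

definition is_zero_object :: "('o, 'm, 'z) cat_data_scheme \<Rightarrow> 'o \<Rightarrow> bool" where
  "is_zero_object C N \<longleftrightarrow> N \<in> Obj C \<and>
     (\<forall>X \<in> Obj C. (\<exists>!f. f \<in> Hom C N X) \<and> (\<exists>!f. f \<in> Hom C X N))"

definition is_coproduct ::
  "('o, 'm, 'z) cat_data_scheme \<Rightarrow> 'j set \<Rightarrow> ('j \<Rightarrow> 'o) \<Rightarrow> 'o \<Rightarrow> ('j \<Rightarrow> 'm) \<Rightarrow> bool" where
  "is_coproduct C J F Q \<iota> \<longleftrightarrow>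
     Q \<in> Obj C \<and> (\<forall>j \<in> J. F j \<in> Obj C \<and> \<iota> j \<in> Hom C (F j) Q) \<and>
     (\<forall>T \<in> Obj C. \<forall>d. (\<forall>j \<in> J. d j \<in> Hom C (F j) T) \<longrightarrow>
        (\<exists>!h. h \<in> Hom C Q T \<and> (\<forall>j \<in> J. h \<cdot>\<^bsub>C\<^esub> \<iota> j = d j)))"

text \<open>
  The squares have \<open>f : A \<rightarrow> A'\<close>, \<open>i : A \<rightarrow> B\<close>, \<open>i' : A' \<rightarrow> B'\<close> and \<open>f' : B \<rightarrow> B'\<close> for the pushout of
  \<open>i\<close> and \<open>f\<close>, and \<open>p : B \<rightarrow> A\<close>, \<open>f : A' \<rightarrow> A\<close>, \<open>p' : B' \<rightarrow> A'\<close> and \<open>f' : B' \<rightarrow> B\<close> for the pullback of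
  \<open>p\<close> and \<open>f\<close>.
\<close>

definition is_pushout :: "('o, 'm, 'z) cat_data_scheme \<Rightarrow> 'm \<Rightarrow> 'm \<Rightarrow> 'm \<Rightarrow> 'm \<Rightarrow> bool" where
  "is_pushout C i f i' f' \<longleftrightarrow>
     {i, f, i', f'} \<subseteq> Arr C \<and> Dom C i = Dom C f \<and>
     Dom C i' = Cod C f \<and> Dom C f' = Cod C i \<and> Cod C i' = Cod C f' \<and>
     i' \<cdot>\<^bsub>C\<^esub> f = f' \<cdot>\<^bsub>C\<^esub> i \<and>
     (\<forall>T \<in> Obj C. \<forall>u \<in> Hom C (Cod C f) T. \<forall>v \<in> Hom C (Cod C i) T.
        u \<cdot>\<^bsub>C\<^esub> f = v \<cdot>\<^bsub>C\<^esub> i \<longrightarrow>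
        (\<exists>!h. h \<in> Hom C (Cod C i') T \<and> h \<cdot>\<^bsub>C\<^esub> i' = u \<and> h \<cdot>\<^bsub>C\<^esub> f' = v))"

definition is_pullback :: "('o, 'm, 'z) cat_data_scheme \<Rightarrow> 'm \<Rightarrow> 'm \<Rightarrow> 'm \<Rightarrow> 'm \<Rightarrow> bool" where
  "is_pullback C p f p' f' \<longleftrightarrow>
     {p, f, p', f'} \<subseteq> Arr C \<and> Cod C p = Cod C f \<and>
     Cod C p' = Dom C f \<and> Cod C f' = Dom C p \<and> Dom C p' = Dom C f' \<and>
     f \<cdot>\<^bsub>C\<^esub> p' = p \<cdot>\<^bsub>C\<^esub> f' \<and>
     (\<forall>T \<in> Obj C. \<forall>u \<in> Hom C T (Dom C f). \<forall>v \<in> Hom C T (Dom C p).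
        f \<cdot>\<^bsub>C\<^esub> u = p \<cdot>\<^bsub>C\<^esub> v \<longrightarrow>
        (\<exists>!h. h \<in> Hom C T (Dom C p') \<and> p' \<cdot>\<^bsub>C\<^esub> h = u \<and> f' \<cdot>\<^bsub>C\<^esub> h = v))"

definition is_precover :: "('o, 'm, 'z) cat_data_scheme \<Rightarrow> 'o set \<Rightarrow> 'o \<Rightarrow> 'm \<Rightarrow> bool" where
  "is_precover C \<F> X f \<longleftrightarrow> f \<in> Arr C \<and> Dom C f \<in> \<F> \<and> Cod C f = X \<and>
     (\<forall>F' \<in> \<F>. \<forall>f' \<in> Hom C F' X. \<exists>g \<in> Hom C F' (Dom C f). f \<cdot>\<^bsub>C\<^esub> g = f')"

definition is_preenvelope :: "('o, 'm, 'z) cat_data_scheme \<Rightarrow> 'o set \<Rightarrow> 'o \<Rightarrow> 'm \<Rightarrow> bool" where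
  "is_preenvelope C \<F> X f \<longleftrightarrow> f \<in> Arr C \<and> Cod C f \<in> \<F> \<and> Dom C f = X \<and>
     (\<forall>F' \<in> \<F>. \<forall>f' \<in> Hom C X F'. \<exists>g \<in> Hom C (Cod C f) F'. g \<cdot>\<^bsub>C\<^esub> f = f')"

definition precovering :: "('o, 'm, 'z) cat_data_scheme \<Rightarrow> 'o set \<Rightarrow> bool" where
  "precovering C \<F> \<longleftrightarrow> \<F> \<subseteq> Obj C \<and> (\<forall>X \<in> Obj C. \<exists>f. is_precover C \<F> X f)"

definition preenveloping :: "('o, 'm, 'z) cat_data_scheme \<Rightarrow> 'o set \<Rightarrow> bool" where
  "preenveloping C \<F> \<longleftrightarrow> \<F> \<subseteq> Obj C \<and> (\<forall>X \<in> Obj C. \<exists>f. is_preenvelope C \<F> X f)"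


section \<open>Transfinite sequences\<close>

text \<open>
  An ordinal \<open>\<lambda>\<close> is given by a reflexive well-order \<open>r\<close>; the ordinals \<open>\<alpha> < \<lambda>\<close> are the elements of
  \<open>Field r\<close>. A system \<open>(X, i)\<close> has its transition maps \<open>i a b\<close> for \<open>a\<close> strictly below \<open>b\<close> only.
\<close>

definition ord_less :: "'u rel \<Rightarrow> 'u \<Rightarrow> 'u \<Rightarrow> bool" where
  "ord_less r a b \<longleftrightarrow> (a, b) \<in> r \<and> a \<noteq> b"

definition is_least :: "'u rel \<Rightarrow> 'u \<Rightarrow> bool" where
  "is_least r z \<longleftrightarrow> z \<in> Field r \<and> underS r z = {}"

definition is_successor :: "'u rel \<Rightarrow> 'u \<Rightarrow> 'u \<Rightarrow> bool" where
  "is_successor r a b \<longleftrightarrow> ord_less r a b \<and> \<not> (\<exists>c. ord_less r a c \<and> ord_less r c b)"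

definition is_limit :: "'u rel \<Rightarrow> 'u \<Rightarrow> bool" where
  "is_limit r g \<longleftrightarrow> g \<in> Field r \<and> \<not> is_least r g \<and> \<not> (\<exists>a. is_successor r a g)"

text \<open>
  Cofinality at least \<open>\<kappa>\<close>. Cofinal subsets are taken in the non-strict sense, so that successor
  ordinals have cofinality 1 and the empty ordinal has cofinality 0 (unlike with
  \<open>BNF_Cardinal_Order_Relation.cofinal\<close>).
\<close>

definition cofinality_ge :: "'u rel \<Rightarrow> 'k rel \<Rightarrow> bool" where
  "cofinality_ge r \<kappa> \<longleftrightarrow>
     (\<forall>A \<subseteq> Field r. (\<forall>a \<in> Field r. \<exists>b \<in> A. (a, b) \<in> r) \<longrightarrow> \<kappa> \<le>o |A| )"

definition direct_system ::
  "('o, 'm, 'z) cat_data_scheme \<Rightarrow> 'u rel \<Rightarrow> ('u \<Rightarrow> 'o) \<Rightarrow> ('u \<Rightarrow> 'u \<Rightarrow> 'm) \<Rightarrow> bool" where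
  "direct_system C r X i \<longleftrightarrow>
     (\<forall>a \<in> Field r. X a \<in> Obj C) \<and>
     (\<forall>a b. ord_less r a b \<longrightarrow> i a b \<in> Hom C (X a) (X b)) \<and>
     (\<forall>a b c. ord_less r a b \<and> ord_less r b c \<longrightarrow> i b c \<cdot>\<^bsub>C\<^esub> i a b = i a c)"

text \<open>Cocones on, and colimits of, the restriction of a system to \<open>A \<subseteq> Field r\<close>.\<close>

definition is_cocone ::
  "('o, 'm, 'z) cat_data_scheme \<Rightarrow> 'u rel \<Rightarrow> 'u set \<Rightarrow> ('u \<Rightarrow> 'o) \<Rightarrow> ('u \<Rightarrow> 'u \<Rightarrow> 'm)
     \<Rightarrow> 'o \<Rightarrow> ('u \<Rightarrow> 'm) \<Rightarrow> bool" where
  "is_cocone C r A X i L c \<longleftrightarrow> L \<in> Obj C \<and> (\<forall>a \<in> A. c a \<in> Hom C (X a) L) \<and>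
     (\<forall>a \<in> A. \<forall>b \<in> A. ord_less r a b \<longrightarrow> c b \<cdot>\<^bsub>C\<^esub> i a b = c a)"

definition is_colimit ::
  "('o, 'm, 'z) cat_data_scheme \<Rightarrow> 'u rel \<Rightarrow> 'u set \<Rightarrow> ('u \<Rightarrow> 'o) \<Rightarrow> ('u \<Rightarrow> 'u \<Rightarrow> 'm)
     \<Rightarrow> 'o \<Rightarrow> ('u \<Rightarrow> 'm) \<Rightarrow> bool" where
  "is_colimit C r A X i L c \<longleftrightarrow> is_cocone C r A X i L c \<and>
     (\<forall>T d. is_cocone C r A X i T d \<longrightarrow>
        (\<exists>!h. h \<in> Hom C L T \<and> (\<forall>a \<in> A. h \<cdot>\<^bsub>C\<^esub> c a = d a)))"

text \<open>
  At a limit \<open>g\<close> the colimit of the earlier terms exists and maps isomorphically to \<open>X g\<close>, i.e.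
  \<open>X g\<close> itself with the transition maps is a colimit.
\<close>

definition transfinite_seq ::
  "'u set \<Rightarrow> ('o, 'm, 'z) cat_data_scheme \<Rightarrow> 'u rel \<Rightarrow> ('u \<Rightarrow> 'o) \<Rightarrow> ('u \<Rightarrow> 'u \<Rightarrow> 'm) \<Rightarrow> bool" where
  "transfinite_seq U C r X i \<longleftrightarrow>
     Well_order r \<and> small U (Field r) \<and> direct_system C r X i \<and>
     (\<forall>g. is_limit r g \<longrightarrow> is_colimit C r (underS r g) X i (X g) (\<lambda>a. i a g))"

definition successor_maps_in :: "'u rel \<Rightarrow> ('u \<Rightarrow> 'u \<Rightarrow> 'm) \<Rightarrow> 'm set \<Rightarrow> bool" where
  "successor_maps_in r i \<M> \<longleftrightarrow> (\<forall>a b. is_successor r a b \<longrightarrow> i a b \<in> \<M>)"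

text \<open>The direct limit of the sets \<open>Hom C X (Y a)\<close>, as a quotient of the disjoint union.\<close>

definition push ::
  "('o, 'm, 'z) cat_data_scheme \<Rightarrow> ('u \<Rightarrow> 'u \<Rightarrow> 'm) \<Rightarrow> 'u \<Rightarrow> 'u \<Rightarrow> 'm \<Rightarrow> 'm" where
  "push C i a b f = (if a = b then f else i a b \<cdot>\<^bsub>C\<^esub> f)"

definition colim_Hom ::
  "('o, 'm, 'z) cat_data_scheme \<Rightarrow> 'u rel \<Rightarrow> 'o \<Rightarrow> ('u \<Rightarrow> 'o) \<Rightarrow> ('u \<Rightarrow> 'u \<Rightarrow> 'm)
     \<Rightarrow> ('u \<times> 'm) set set" where
  "colim_Hom C r X Y i =
     (let D = (SIGMA a : Field r. Hom C X (Y a))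
      in D // {((a, f), (b, g)). (a, f) \<in> D \<and> (b, g) \<in> D \<and>
                  (\<exists>c. (a, c) \<in> r \<and> (b, c) \<in> r \<and> push C i a c f = push C i b c g)})"

text \<open>The class of \<open>(a, f)\<close> is sent to \<open>c a \<cdot> f\<close>, where \<open>c\<close> is a cocone.\<close>

definition colim_Hom_map ::
  "('o, 'm, 'z) cat_data_scheme \<Rightarrow> ('u \<Rightarrow> 'm) \<Rightarrow> ('u \<times> 'm) set \<Rightarrow> 'm" where
  "colim_Hom_map C c K = the_elem ((\<lambda>(a, f). c a \<cdot>\<^bsub>C\<^esub> f) ` K)"

definition small_relative_to ::
  "'u set \<Rightarrow> ('o, 'm, 'z) cat_data_scheme \<Rightarrow> 'm set \<Rightarrow> 'o \<Rightarrow> bool" where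
  "small_relative_to U C \<M> X \<longleftrightarrow>
     (\<exists>\<kappa> :: 'u rel. Cinfinite \<kappa> \<and> regularCard \<kappa> \<and> small U (Field \<kappa>) \<and>
        (\<forall>(r :: 'u rel) Y i L c.
           transfinite_seq U C r Y i \<and> cofinality_ge r \<kappa> \<and> successor_maps_in r i \<M> \<and>
           is_colimit C r (Field r) Y i L c \<longrightarrow>
           bij_betw (colim_Hom_map C c) (colim_Hom C r X Y i) (Hom C X L)))"


section \<open>Additive categories\<close>

record ('o, 'm) additive_data = "('o, 'm) cat_data" +
  Add :: "'m \<Rightarrow> 'm \<Rightarrow> 'm"  (infixl \<open>\<oplus>\<index>\<close> 65)
  Zero :: "'o \<Rightarrow> 'o \<Rightarrow> 'm"

definition Hom_group :: "('o, 'm, 'z) additive_data_scheme \<Rightarrow> 'o \<Rightarrow> 'o \<Rightarrow> 'm monoid" where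
  "Hom_group C X Y = \<lparr>carrier = Hom C X Y, monoid.mult = Add C, one = Zero C X Y\<rparr>"

definition is_biproduct ::
  "('o, 'm, 'z) additive_data_scheme \<Rightarrow> 'o \<Rightarrow> 'o \<Rightarrow> 'o \<Rightarrow> bool" where
  "is_biproduct C A B P \<longleftrightarrow>
     (\<exists>\<iota>\<^sub>1 \<in> Hom C A P. \<exists>\<iota>\<^sub>2 \<in> Hom C B P. \<exists>\<pi>\<^sub>1 \<in> Hom C P A. \<exists>\<pi>\<^sub>2 \<in> Hom C P B.
        \<pi>\<^sub>1 \<cdot>\<^bsub>C\<^esub> \<iota>\<^sub>1 = Id C A \<and> \<pi>\<^sub>2 \<cdot>\<^bsub>C\<^esub> \<iota>\<^sub>2 = Id C B \<and>
        \<pi>\<^sub>2 \<cdot>\<^bsub>C\<^esub> \<iota>\<^sub>1 = Zero C A B \<and> \<pi>\<^sub>1 \<cdot>\<^bsub>C\<^esub> \<iota>\<^sub>2 = Zero C B A \<and>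
        (\<iota>\<^sub>1 \<cdot>\<^bsub>C\<^esub> \<pi>\<^sub>1) \<oplus>\<^bsub>C\<^esub> (\<iota>\<^sub>2 \<cdot>\<^bsub>C\<^esub> \<pi>\<^sub>2) = Id C P)"

definition direct_summand :: "('o, 'm, 'z) additive_data_scheme \<Rightarrow> 'o \<Rightarrow> 'o \<Rightarrow> bool" where
  "direct_summand C M E \<longleftrightarrow>
     M \<in> Obj C \<and> E \<in> Obj C \<and> (\<exists>N \<in> Obj C. is_biproduct C M N E)"

locale additive_category = category C
  for C :: "('o, 'm, 'z) additive_data_scheme" (structure) +
  assumes Hom_comm_group: "\<lbrakk>X \<in> Obj C; Y \<in> Obj C\<rbrakk> \<Longrightarrow> comm_group (Hom_group C X Y)"
    and Cmp_Add: "\<lbrakk>f \<in> Hom C X Y; f' \<in> Hom C X Y; g \<in> Hom C Y Z\<rbrakk>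
                    \<Longrightarrow> g \<cdot> (f \<oplus> f') = (g \<cdot> f) \<oplus> (g \<cdot> f')"
    and Add_Cmp: "\<lbrakk>f \<in> Hom C X Y; g \<in> Hom C Y Z; g' \<in> Hom C Y Z\<rbrakk>
                    \<Longrightarrow> (g \<oplus> g') \<cdot> f = (g \<cdot> f) \<oplus> (g' \<cdot> f)"
    and zero_object_exists: "\<exists>N. is_zero_object C N"
    and biproduct_exists: "\<lbrakk>A \<in> Obj C; B \<in> Obj C\<rbrakk> \<Longrightarrow> \<exists>P \<in> Obj C. is_biproduct C A B P"


section \<open>Exact categories\<close>

record ('o, 'm) exact_data = "('o, 'm) additive_data" +
  Conflations :: "('m \<times> 'm) set"

definition is_kernel :: "('o, 'm, 'z) additive_data_scheme \<Rightarrow> 'm \<Rightarrow> 'm \<Rightarrow> bool" where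
  "is_kernel C i p \<longleftrightarrow> i \<in> Arr C \<and> p \<in> Arr C \<and> Cod C i = Dom C p \<and>
     p \<cdot>\<^bsub>C\<^esub> i = Zero C (Dom C i) (Cod C p) \<and>
     (\<forall>T \<in> Obj C. \<forall>f \<in> Hom C T (Dom C p). p \<cdot>\<^bsub>C\<^esub> f = Zero C T (Cod C p) \<longrightarrow>
        (\<exists>!g. g \<in> Hom C T (Dom C i) \<and> i \<cdot>\<^bsub>C\<^esub> g = f))"

definition is_cokernel :: "('o, 'm, 'z) additive_data_scheme \<Rightarrow> 'm \<Rightarrow> 'm \<Rightarrow> bool" where
  "is_cokernel C p i \<longleftrightarrow> i \<in> Arr C \<and> p \<in> Arr C \<and> Cod C i = Dom C p \<and>
     p \<cdot>\<^bsub>C\<^esub> i = Zero C (Dom C i) (Cod C p) \<and>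
     (\<forall>T \<in> Obj C. \<forall>f \<in> Hom C (Cod C i) T. f \<cdot>\<^bsub>C\<^esub> i = Zero C (Dom C i) T \<longrightarrow>
        (\<exists>!g. g \<in> Hom C (Cod C p) T \<and> g \<cdot>\<^bsub>C\<^esub> p = f))"

definition pair_iso :: "('o, 'm, 'z) cat_data_scheme \<Rightarrow> 'm \<times> 'm \<Rightarrow> 'm \<times> 'm \<Rightarrow> bool" where
  "pair_iso C = (\<lambda>(i, p) (i', p').
     \<exists>a \<in> Hom C (Dom C i) (Dom C i'). \<exists>b \<in> Hom C (Cod C i) (Cod C i').
     \<exists>c \<in> Hom C (Cod C p) (Cod C p').
       is_iso C a \<and> is_iso C b \<and> is_iso C c \<and>
       b \<cdot>\<^bsub>C\<^esub> i = i' \<cdot>\<^bsub>C\<^esub> a \<and> c \<cdot>\<^bsub>C\<^esub> p = p' \<cdot>\<^bsub>C\<^esub> b)"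

definition Inflations :: "('o, 'm, 'z) exact_data_scheme \<Rightarrow> 'm set" where
  "Inflations C = {i. \<exists>p. (i, p) \<in> Conflations C}"

definition Deflations :: "('o, 'm, 'z) exact_data_scheme \<Rightarrow> 'm set" where
  "Deflations C = {p. \<exists>i. (i, p) \<in> Conflations C}"

text \<open>Quillen's axioms in the (self-dual) form given by Keller and Buehler.\<close>

locale exact_category = additive_category C
  for C :: "('o, 'm, 'z) exact_data_scheme" (structure) +
  assumes conflation_kernel: "(i, p) \<in> Conflations C \<Longrightarrow> is_kernel C i p"
    and conflation_cokernel: "(i, p) \<in> Conflations C \<Longrightarrow> is_cokernel C p i"
    and conflation_iso: "\<lbrakk>(i, p) \<in> Conflations C; i' \<in> Arr C; p' \<in> Arr C; Cod C i' = Dom C p';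
                          pair_iso C (i, p) (i', p')\<rbrakk> \<Longrightarrow> (i', p') \<in> Conflations C"
    and Id_inflation: "X \<in> Obj C \<Longrightarrow> Id C X \<in> Inflations C"
    and Id_deflation: "X \<in> Obj C \<Longrightarrow> Id C X \<in> Deflations C"
    and inflation_Cmp: "\<lbrakk>i \<in> Inflations C; j \<in> Inflations C; Cod C i = Dom C j\<rbrakk>
                          \<Longrightarrow> j \<cdot> i \<in> Inflations C"
    and deflation_Cmp: "\<lbrakk>p \<in> Deflations C; q \<in> Deflations C; Cod C p = Dom C q\<rbrakk>
                          \<Longrightarrow> q \<cdot> p \<in> Deflations C"
    and inflation_pushout: "\<lbrakk>i \<in> Inflations C; f \<in> Arr C; Dom C f = Dom C i\<rbrakk>
                          \<Longrightarrow> \<exists>i' f'. is_pushout C i f i' f' \<and> i' \<in> Inflations C"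
    and deflation_pullback: "\<lbrakk>p \<in> Deflations C; f \<in> Arr C; Cod C f = Cod C p\<rbrakk>
                          \<Longrightarrow> \<exists>p' f'. is_pullback C p f p' f' \<and> p' \<in> Deflations C"

text \<open>Conflations \<open>0 \<rightarrow> X \<rightarrow> Y \<rightarrow> Z \<rightarrow> 0\<close>.\<close>

definition conflation ::
  "('o, 'm, 'z) exact_data_scheme \<Rightarrow> 'o \<Rightarrow> 'm \<Rightarrow> 'o \<Rightarrow> 'm \<Rightarrow> 'o \<Rightarrow> bool" where
  "conflation C X i Y p Z \<longleftrightarrow> (i, p) \<in> Conflations C \<and> i \<in> Hom C X Y \<and> p \<in> Hom C Y Z"

definition ex_conflation ::
  "('o, 'm, 'z) exact_data_scheme \<Rightarrow> 'o \<Rightarrow> 'o \<Rightarrow> 'o \<Rightarrow> bool" where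
  "ex_conflation C X Y Z \<longleftrightarrow> (\<exists>i p. conflation C X i Y p Z)"


subsection \<open>Yoneda Ext and cotorsion pairs\<close>

definition extensions :: "('o, 'm, 'z) exact_data_scheme \<Rightarrow> 'o \<Rightarrow> 'o \<Rightarrow> ('m \<times> 'm) set" where
  "extensions C X Y = {(i, p). \<exists>Z. conflation C Y i Z p X}"

definition ext_equiv :: "('o, 'm, 'z) exact_data_scheme \<Rightarrow> 'o \<Rightarrow> 'o \<Rightarrow> ('m \<times> 'm) rel" where
  "ext_equiv C X Y = {((i, p), (i', p')).
     (i, p) \<in> extensions C X Y \<and> (i', p') \<in> extensions C X Y \<and>
     (\<exists>h \<in> Hom C (Cod C i) (Cod C i'). is_iso C h \<and> h \<cdot>\<^bsub>C\<^esub> i = i' \<and> p' \<cdot>\<^bsub>C\<^esub> h = p)}"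

definition Ext1 :: "('o, 'm, 'z) exact_data_scheme \<Rightarrow> 'o \<Rightarrow> 'o \<Rightarrow> ('m \<times> 'm) set set" where
  "Ext1 C X Y = extensions C X Y // ext_equiv C X Y"

text \<open>
  The zero element of \<open>Ext1 C X Y\<close> (for the Baer sum) is the class formed by the split extensions,
  so \<open>Ext1 C X Y\<close> is the zero group iff this class is its only element.
\<close>

definition split_extensions ::
  "('o, 'm, 'z) exact_data_scheme \<Rightarrow> 'o \<Rightarrow> 'o \<Rightarrow> ('m \<times> 'm) set" where
  "split_extensions C X Y =
     {(i, p) \<in> extensions C X Y. \<exists>s \<in> Hom C X (Dom C p). p \<cdot>\<^bsub>C\<^esub> s = Id C X}"

definition Ext1_vanishes :: "('o, 'm, 'z) exact_data_scheme \<Rightarrow> 'o \<Rightarrow> 'o \<Rightarrow> bool" where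
  "Ext1_vanishes C X Y \<longleftrightarrow> Ext1 C X Y = {split_extensions C X Y}"

definition right_perp :: "('o, 'm, 'z) exact_data_scheme \<Rightarrow> 'o set \<Rightarrow> 'o set" where
  "right_perp C \<S> = {Y \<in> Obj C. \<forall>S \<in> \<S>. Ext1_vanishes C S Y}"

definition left_perp :: "('o, 'm, 'z) exact_data_scheme \<Rightarrow> 'o set \<Rightarrow> 'o set" where
  "left_perp C \<S> = {X \<in> Obj C. \<forall>S \<in> \<S>. Ext1_vanishes C X S}"

definition cotorsion_pair :: "('o, 'm, 'z) exact_data_scheme \<Rightarrow> 'o set \<Rightarrow> 'o set \<Rightarrow> bool" where
  "cotorsion_pair C \<X> \<Y> \<longleftrightarrow> \<X> \<subseteq> Obj C \<and> \<Y> \<subseteq> Obj C \<and>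
     right_perp C \<X> = \<Y> \<and> \<X> = left_perp C \<Y>"

definition complete_cotorsion_pair ::
  "('o, 'm, 'z) exact_data_scheme \<Rightarrow> 'o set \<Rightarrow> 'o set \<Rightarrow> bool" where
  "complete_cotorsion_pair C \<X> \<Y> \<longleftrightarrow> cotorsion_pair C \<X> \<Y> \<and>
     (\<forall>M \<in> Obj C. (\<exists>X \<in> \<X>. \<exists>Y \<in> \<Y>. ex_conflation C Y X M) \<and>
                  (\<exists>X' \<in> \<X>. \<exists>Y' \<in> \<Y>. ex_conflation C M Y' X'))"


subsection \<open>Projective objects and generating classes\<close>

definition projective :: "('o, 'm, 'z) exact_data_scheme \<Rightarrow> 'o \<Rightarrow> bool" where
  "projective C P \<longleftrightarrow> P \<in> Obj C \<and>
     (\<forall>p \<in> Deflations C. Cod C p = P \<longrightarrow> (\<exists>s \<in> Hom C P (Dom C p). p \<cdot>\<^bsub>C\<^esub> s = Id C P))"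

definition enough_projectives :: "('o, 'm, 'z) exact_data_scheme \<Rightarrow> bool" where
  "enough_projectives C \<longleftrightarrow>
     (\<forall>X \<in> Obj C. \<exists>p \<in> Deflations C. projective C (Dom C p) \<and> Cod C p = X)"

definition generating :: "'u set \<Rightarrow> ('o, 'm, 'z) exact_data_scheme \<Rightarrow> 'o set \<Rightarrow> bool" where
  "generating U C \<G> \<longleftrightarrow> \<G> \<subseteq> Obj C \<and>
     (\<forall>M \<in> Obj C. \<exists>p \<in> Deflations C. Cod C p = M \<and>
        (\<exists>(J :: 'u set) F \<iota>. small U J \<and> F ` J \<subseteq> \<G> \<and> is_coproduct C J F (Dom C p) \<iota>))"


subsection \<open>Filtrations and efficient exact categories\<close>

text \<open>
  The class of inflations with cokernel in \<open>\<S>\<close>. Cokernels being defined up to isomorphism, this means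
  that some cokernel lies in \<open>\<S>\<close>.
\<close>

definition inflations_with_coker_in ::
  "('o, 'm, 'z) exact_data_scheme \<Rightarrow> 'o set \<Rightarrow> 'm set" where
  "inflations_with_coker_in C \<S> = {i. \<exists>p. (i, p) \<in> Conflations C \<and> Cod C p \<in> \<S>}"

definition Filt :: "'u set \<Rightarrow> ('o, 'm, 'z) exact_data_scheme \<Rightarrow> 'o set \<Rightarrow> 'o set" where
  "Filt U C \<S> = {X. \<exists>(r :: 'u rel) F i c z.
     transfinite_seq U C r F i \<and> is_least r z \<and> is_zero_object C (F z) \<and>
     successor_maps_in r i (inflations_with_coker_in C \<S>) \<and>
     is_colimit C r (Field r) F i X c}"

definition Coker_class :: "('o, 'm, 'z) exact_data_scheme \<Rightarrow> 'm set \<Rightarrow> 'o set" where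
  "Coker_class C I = {X \<in> Obj C. \<exists>i \<in> I. \<exists>p. (i, p) \<in> Conflations C \<and> isomorphic C X (Cod C p)}"

definition strongly_homological :: "('o, 'm, 'z) exact_data_scheme \<Rightarrow> 'm set \<Rightarrow> bool" where
  "strongly_homological C I \<longleftrightarrow> I \<subseteq> Inflations C \<and>
     (\<forall>A j B q S. conflation C A j B q S \<and> S \<in> Coker_class C I \<longrightarrow>
        (\<exists>i \<in> I. \<exists>A' B' p. conflation C A' i B' p S \<and>
           (\<exists>a \<in> Hom C A' A. \<exists>b \<in> Hom C B' B. b \<cdot>\<^bsub>C\<^esub> i = j \<cdot>\<^bsub>C\<^esub> a \<and> q \<cdot>\<^bsub>C\<^esub> b = p)))"

locale efficient_exact_category = exact_category C
  for U :: "'u set" and C :: "('o, 'm, 'z) exact_data_scheme" (structure) +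
  assumes Ax1: "\<lbrakk>transfinite_seq U C r F i; is_least r z; successor_maps_in r i (Inflations C)\<rbrakk>
      \<Longrightarrow> (\<exists>L c. is_colimit C r (Field r) F i L c) \<and>
          (\<forall>L c. is_colimit C r (Field r) F i L c \<longrightarrow> c z \<in> Inflations C)"
    and Ax2: "X \<in> Obj C \<Longrightarrow> small_relative_to U C (Inflations C) X"
    and Ax3: "\<lbrakk>\<S> \<subseteq> Obj C; small U \<S>\<rbrakk>
      \<Longrightarrow> \<exists>I. small U I \<and> strongly_homological C I \<and>
              Coker_class C I = {X \<in> Obj C. \<exists>S \<in> \<S>. isomorphic C X S}"


section \<open>Instances of the size conditions\<close>

lemma small_regular_copy:
  fixes \<rho> :: "'k rel" and U :: "'u set" and A :: "'u set"
  assumes "Cinfinite \<rho>" "regularCard \<rho>" "\<rho> <o |U|" "|A| \<le>o \<rho>"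
  shows "\<exists>\<kappa> :: 'u rel. Cinfinite \<kappa> \<and> regularCard \<kappa> \<and> small U (Field \<kappa>) \<and> |A| \<le>o \<kappa>"
proof -
  have F: "|Field \<rho>| =o \<rho>" using assms(1) card_of_Field_ordIso by metis
  then have "|Field \<rho>| <o |U|" using assms(3) ordIso_ordLess_trans by metis
  then obtain f where f: "inj_on f (Field \<rho>)" "f ` Field \<rho> \<subseteq> U"
    using card_of_ordLeq[of "Field \<rho>" U] ordLess_imp_ordLeq by metis
  let ?B = "f ` Field \<rho>"
  have "|?B| =o |Field \<rho>|"
    using f(1) card_of_ordIso[of "Field \<rho>" ?B] inj_on_imp_bij_betw ordIso_symmetric by metis
  then have iso: "\<rho> =o |?B|" using F ordIso_symmetric ordIso_transitive by metis
  have "Cinfinite |?B|" using iso assms(1) Cinfinite_cong by metis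
  moreover have "regularCard |?B|" using iso assms(1,2) regularCard_ordIso by metis
  moreover have "small U (Field |?B| )"
    unfolding small_def Field_card_of
    using iso assms(3) ordIso_ordLess_trans ordIso_symmetric by metis
  moreover have "|A| \<le>o |?B|" using iso assms(4) ordLeq_ordIso_trans by metis
  ultimately show ?thesis by metis
qed

lemma size_universe_inaccessible:
  fixes U :: "'u set"
  assumes unc: "natLeq <o |U|" and reg: "regularCard |U|"
    and strong: "\<And>A :: 'u set. |A| <o |U| \<Longrightarrow> |Pow A| <o |U|"
  shows "size_universe U"
proof -
  have inf: "infinite U"
    using unc infinite_iff_natLeq_ordLeq ordLess_imp_ordLeq by metis
  then obtain g :: "nat \<Rightarrow> 'u" where g: "inj g" "range g \<subseteq> U"
    using infinite_countable_subset by metis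
  let ?N = "range g"
  have N: "|?N| =o natLeq"
    using g(1) card_of_nat card_of_ordIso[of "UNIV :: nat set" ?N] inj_on_imp_bij_betw
      ordIso_symmetric ordIso_transitive by metis
  have Ninf: "infinite ?N" using g(1) finite_imageD infinite_UNIV_nat by metis
  have "\<exists>\<kappa> :: 'u rel. Cinfinite \<kappa> \<and> regularCard \<kappa> \<and> small U (Field \<kappa>) \<and> |A| \<le>o \<kappa>"
    if A: "small U A" for A :: "'u set"
  proof -
    let ?D = "A \<union> ?N"
    have D: "|?D| <o |U|"
      using card_of_Un_ordLess_infinite[OF inf] A unc N ordIso_ordLess_trans
      unfolding small_def by metis
    have Dinf: "infinite ?D" using Ninf by simp
    have CD: "Cinfinite |?D|" using Dinf unfolding cinfinite_def Field_card_of by (simp add: card_of_card_order_on)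
    have "cardSuc |?D| \<le>o |Pow ?D|"
      by (rule cardSuc_least[OF card_of_Card_order card_of_Card_order card_of_Pow])
    then have "cardSuc |?D| <o |U|" using strong[OF D] ordLeq_ordLess_trans by metis
    moreover have "|A| \<le>o cardSuc |?D|"
      by (rule ordLeq_transitive[OF card_of_mono1 cardSuc_ordLeq[OF card_of_Card_order]]) simp
    ultimately show ?thesis
      using small_regular_copy[OF Cinfinite_cardSuc[OF CD] regularCard_cardSuc[OF CD]] by metis
  qed
  then show ?thesis using inf reg unfolding size_universe_def by (simp add: cinfinite_def Field_card_of)
qed

lemma size_universe_cardSuc:
  fixes U :: "'u set" and k :: "'k rel"
  assumes k: "Cinfinite k" "regularCard k" and U: "|U| =o cardSuc k"
  shows "size_universe U"
proof -
  have sym: "cardSuc k =o |U|" using U ordIso_symmetric by metis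
  have kU: "k <o |U|" using cardSuc_greater k(1) sym ordLess_ordIso_trans by metis
  have "\<exists>\<kappa> :: 'u rel. Cinfinite \<kappa> \<and> regularCard \<kappa> \<and> small U (Field \<kappa>) \<and> |A| \<le>o \<kappa>"
    if "small U A" for A :: "'u set"
  proof -
    have "|A| <o cardSuc k" using that U ordLess_ordIso_trans unfolding small_def by metis
    then have "|A| \<le>o k" using cardSuc_ordLeq_ordLess[OF conjunct2[OF k(1)] card_of_Card_order] by metis
    then show ?thesis using small_regular_copy[OF k kU] by metis
  qed
  moreover have "cinfinite |U|"
    using Cinfinite_cong[OF sym] Cinfinite_cardSuc[OF k(1)] by metis
  moreover have "regularCard |U|"
    using regularCard_ordIso[OF sym] Cinfinite_cardSuc[OF k(1)] regularCard_cardSuc[OF k(1)] by metis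
  ultimately show ?thesis unfolding size_universe_def by metis
qed

end

theory Submission
  imports Defs
begin

text \<open>
  The proof is Quillen's small object argument. Let \<open>I\<close> be a strongly homological set of inflations
  with \<open>Coker(I)\<close> the objects isomorphic to members of \<open>\<S>\<close>. Since a morphism of conflations with
  identity on the cokernels has a pushout as its left square, lifting against \<open>I\<close> means lifting
  against every inflation with cokernel in \<open>\<S>\<close>, hence against every transfinite composition of
  such inflations. So every morphism factors as such a composition followed by a morphism with this
  lifting property. For \<open>0 \<rightarrow> X\<close> the second factor is a precover by \<open>Filt \<S>\<close>; for \<open>M \<rightarrow> 0\<close> the first
  factor has its codomain in \<open>\<T>\<close> and, after dividing out \<open>M\<close>, its cokernel in \<open>Filt \<S>\<close>. Deflations
  with kernel in \<open>\<T>\<close> have the lifting property too, whence \<open>Filt \<S> \<subseteq> \<^sup>\<perp>\<T>\<close>.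

  For a conflation \<open>0 \<rightarrow> K \<rightarrow> G \<rightarrow> M \<rightarrow> 0\<close> and \<open>0 \<rightarrow> K \<rightarrow> B \<rightarrow> Q \<rightarrow> 0\<close> with \<open>B \<in> \<T>\<close>, \<open>Q \<in> Filt \<S>\<close>, the pushout \<open>E\<close>
  of \<open>G\<close> and \<open>B\<close> under \<open>K\<close> sits in conflations \<open>0 \<rightarrow> B \<rightarrow> E \<rightarrow> M \<rightarrow> 0\<close> and \<open>0 \<rightarrow> G \<rightarrow> E \<rightarrow> Q \<rightarrow> 0\<close>. If
  \<open>M \<in> \<^sup>\<perp>\<T>\<close>, the first one splits. The two cases of the theorem are \<open>G\<close> a coproduct of members of
  \<open>\<S>\<close>, where \<open>E\<close> is again \<open>\<S>\<close>-filtered, and \<open>G\<close> projective.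

  All chains that are constructed are indexed by segments of the well-order \<open>|U|\<close>. Pushouts keep the
  index set, so a filtration of \<open>G\<close> is continued by one of \<open>E\<close> by choosing the segments adjacent.
\<close>

section \<open>Categories and additive categories\<close>

text \<open>Infinite coproducts are not among the axioms, so the lifting problems of a stage cannot
  be solved all at once by pushing out a coproduct of members of \<open>I\<close>. They are solved
  one at a time, in an order fixed by a bookkeeping function that names every pair of indices again
  and again. In return, each step is a pushout of a single inflation and keeps its cokernel, so what
  is built is a filtration from the outset.

  The order \<open>|U|\<close> is not small, but by regularity its proper initial segments are,
  which is what \<open>Ax1\<close> asks for at limit stages. The construction therefore runs along a
  whole tail of \<open>|U|\<close> and is cut at a suitable small stage afterwards.

  Long exact sequences are avoided: splitting of extensions, closure under filtrations and
  extensions, and the approximation property are all phrased as existence of lifts, which is stable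
  under pushouts and transfinite compositions. Chains can be joined only at equal objects, so
  several constructions take care to return a prescribed object and not merely an isomorphic copy of
  it.\<close>

context category
begin

lemma Hom_iff: "f \<in> Hom C X Y \<longleftrightarrow> f \<in> Arr C \<and> Dom C f = X \<and> Cod C f = Y"
  by (auto simp: Hom_def)

lemma Arr_in_Hom: "f \<in> Arr C \<Longrightarrow> f \<in> Hom C (Dom C f) (Cod C f)"
  by (simp add: Hom_iff)

lemma Hom_Obj: "f \<in> Hom C X Y \<Longrightarrow> X \<in> Obj C \<and> Y \<in> Obj C"
  using Dom_Obj Cod_Obj by (auto simp: Hom_iff)

lemma Arr_Cmp [simp]:
  "\<lbrakk>f \<in> Arr C; g \<in> Arr C; Cod C f = Dom C g\<rbrakk> \<Longrightarrow> g \<cdot> f \<in> Arr C"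
  using Cmp_Hom[of f "Dom C f" "Cod C f" g "Cod C g"] by (simp add: Hom_iff)

lemma Dom_Cmp [simp]:
  "\<lbrakk>f \<in> Arr C; g \<in> Arr C; Cod C f = Dom C g\<rbrakk> \<Longrightarrow> Dom C (g \<cdot> f) = Dom C f"
  using Cmp_Hom[of f "Dom C f" "Cod C f" g "Cod C g"] by (simp add: Hom_iff)

lemma Cod_Cmp [simp]:
  "\<lbrakk>f \<in> Arr C; g \<in> Arr C; Cod C f = Dom C g\<rbrakk> \<Longrightarrow> Cod C (g \<cdot> f) = Cod C g"
  using Cmp_Hom[of f "Dom C f" "Cod C f" g "Cod C g"] by (simp add: Hom_iff)

lemma Id_Arr [simp]: "X \<in> Obj C \<Longrightarrow> Id C X \<in> Arr C"
  and Dom_Id [simp]: "X \<in> Obj C \<Longrightarrow> Dom C (Id C X) = X"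
  and Cod_Id [simp]: "X \<in> Obj C \<Longrightarrow> Cod C (Id C X) = X"
  using Id_Hom[of X] by (simp_all add: Hom_iff)

lemma Cmp_Id' [simp]: "\<lbrakk>f \<in> Arr C; Dom C f = X\<rbrakk> \<Longrightarrow> f \<cdot> Id C X = f"
  using Cmp_Id[of f X "Cod C f"] by (simp add: Hom_iff)

lemma Id_Cmp' [simp]: "\<lbrakk>f \<in> Arr C; Cod C f = X\<rbrakk> \<Longrightarrow> Id C X \<cdot> f = f"
  using Id_Cmp[of f "Dom C f" X] by (simp add: Hom_iff)

lemma Cmp_assoc' [simp]:
  "\<lbrakk>f \<in> Arr C; g \<in> Arr C; h \<in> Arr C; Cod C f = Dom C g; Cod C g = Dom C h\<rbrakk>
    \<Longrightarrow> (h \<cdot> g) \<cdot> f = h \<cdot> (g \<cdot> f)"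
  using Cmp_assoc[of f "Dom C f" "Cod C f" g "Cod C g" h "Cod C h"] by (simp add: Hom_iff)

text \<open>Composites are normalised by associating to the right, so an equation for
  \<open>g \<cdot> f\<close> has to be applied inside
  \<open>g \<cdot> (f \<cdot> k)\<close>.\<close>

lemma Cmp_rewrite:
  "\<lbrakk>g \<cdot> f = h; f \<in> Arr C; g \<in> Arr C; k \<in> Arr C; Cod C f = Dom C g; Cod C k = Dom C f\<rbrakk>
    \<Longrightarrow> g \<cdot> (f \<cdot> k) = h \<cdot> k"
  by (metis Cmp_assoc')

lemma is_isoI:
  "\<lbrakk>f \<in> Hom C X Y; g \<in> Hom C Y X; g \<cdot> f = Id C X; f \<cdot> g = Id C Y\<rbrakk> \<Longrightarrow> is_iso C f"
  unfolding is_iso_def by (auto simp: Hom_iff)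

lemma is_iso_Id: "X \<in> Obj C \<Longrightarrow> is_iso C (Id C X)"
  by (rule is_isoI[of _ X X "Id C X"]) (simp_all add: Hom_iff)

section \<open>Pushout and pullback squares\<close>

lemma pushoutD:
  assumes "is_pushout C i f i' f'"
  shows "i \<in> Arr C" "f \<in> Arr C" "i' \<in> Arr C" "f' \<in> Arr C" "Dom C f = Dom C i"
    "Dom C i' = Cod C f" "Dom C f' = Cod C i" "Cod C f' = Cod C i'" "i' \<cdot> f = f' \<cdot> i"
  using assms unfolding is_pushout_def by auto

lemma pushout_factor:
  assumes "is_pushout C i f i' f'" "u \<in> Hom C (Cod C f) T" "v \<in> Hom C (Cod C i) T"
    "u \<cdot> f = v \<cdot> i"
  obtains h where "h \<in> Hom C (Cod C i') T" "h \<cdot> i' = u" "h \<cdot> f' = v"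
  using assms Hom_Obj unfolding is_pushout_def by metis

lemma pushout_unique:
  assumes "is_pushout C i f i' f'" "h \<in> Hom C (Cod C i') T" "k \<in> Hom C (Cod C i') T"
    "h \<cdot> i' = k \<cdot> i'" "h \<cdot> f' = k \<cdot> f'"
  shows "h = k"
proof -
  note p = pushoutD[OF assms(1)]
  have T: "T \<in> Obj C" using assms Hom_Obj by blast
  have "h \<cdot> i' \<in> Hom C (Cod C f) T" "h \<cdot> f' \<in> Hom C (Cod C i) T"
    using p assms by (simp_all add: Hom_iff)
  moreover have "(h \<cdot> i') \<cdot> f = (h \<cdot> f') \<cdot> i"
    using p assms by (simp add: Hom_iff)
  ultimately have "\<exists>!x. x \<in> Hom C (Cod C i') T \<and> x \<cdot> i' = h \<cdot> i' \<and> x \<cdot> f' = h \<cdot> f'"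
    using assms(1) T unfolding is_pushout_def by blast
  then show ?thesis using assms by metis
qed

lemma pushoutI:
  assumes "i \<in> Hom C A B" "f \<in> Hom C A A'" "i' \<in> Hom C A' B'" "f' \<in> Hom C B B'"
    "i' \<cdot> f = f' \<cdot> i"
    "\<And>T u v. \<lbrakk>u \<in> Hom C A' T; v \<in> Hom C B T; u \<cdot> f = v \<cdot> i\<rbrakk>
        \<Longrightarrow> \<exists>h. h \<in> Hom C B' T \<and> h \<cdot> i' = u \<and> h \<cdot> f' = v"
    "\<And>T h k. \<lbrakk>h \<in> Hom C B' T; k \<in> Hom C B' T; h \<cdot> i' = k \<cdot> i'; h \<cdot> f' = k \<cdot> f'\<rbrakk> \<Longrightarrow> h = k"
  shows "is_pushout C i f i' f'"
proof -
  have eqs: "Cod C f = A'" "Cod C i = B" "Cod C i' = B'" using assms by (simp_all add: Hom_iff)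
  show ?thesis
    unfolding is_pushout_def eqs
  proof (intro conjI ballI impI)
    fix T u v assume *: "u \<in> Hom C A' T" "v \<in> Hom C B T" "u \<cdot> f = v \<cdot> i"
    then obtain h where "h \<in> Hom C B' T \<and> h \<cdot> i' = u \<and> h \<cdot> f' = v" using assms(6) by blast
    then show "\<exists>!h. h \<in> Hom C B' T \<and> h \<cdot> i' = u \<and> h \<cdot> f' = v"
      using assms(7) by metis
  qed (use assms in \<open>simp_all add: Hom_iff\<close>)
qed

lemma pushout_sym:
  assumes "is_pushout C i f i' f'"
  shows "is_pushout C f i f' i'"
proof (rule pushoutI[of _ "Dom C i" "Cod C f" _ "Cod C i" _ "Cod C i'"])
  fix T u v
  assume "u \<in> Hom C (Cod C i) T" "v \<in> Hom C (Cod C f) T" "u \<cdot> i = v \<cdot> f"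
  then show "\<exists>h. h \<in> Hom C (Cod C i') T \<and> h \<cdot> f' = u \<and> h \<cdot> i' = v"
    using pushout_factor[OF assms, of v T u] by metis
qed (use pushoutD[OF assms] pushout_unique[OF assms] in \<open>auto simp: Hom_iff\<close>)

lemma pushout_Id: "f \<in> Hom C A A' \<Longrightarrow> is_pushout C (Id C A) f (Id C A') f"
  using Hom_Obj[of f A A'] by (intro pushoutI[of _ A A _ A' _ A']) (auto simp: Hom_iff)

lemma pullbackD:
  assumes "is_pullback C p f p' f'"
  shows "p \<in> Arr C" "f \<in> Arr C" "p' \<in> Arr C" "f' \<in> Arr C" "Cod C f = Cod C p"
    "Cod C p' = Dom C f" "Cod C f' = Dom C p" "Dom C f' = Dom C p'" "f \<cdot> p' = p \<cdot> f'"
  using assms unfolding is_pullback_def by auto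

lemma pullback_factor:
  assumes "is_pullback C p f p' f'" "u \<in> Hom C T (Dom C f)" "v \<in> Hom C T (Dom C p)"
    "f \<cdot> u = p \<cdot> v"
  obtains h where "h \<in> Hom C T (Dom C p')" "p' \<cdot> h = u" "f' \<cdot> h = v"
  using assms Hom_Obj unfolding is_pullback_def by metis

lemma pullback_unique:
  assumes "is_pullback C p f p' f'" "h \<in> Hom C T (Dom C p')" "k \<in> Hom C T (Dom C p')"
    "p' \<cdot> h = p' \<cdot> k" "f' \<cdot> h = f' \<cdot> k"
  shows "h = k"
proof -
  note p = pullbackD[OF assms(1)]
  have T: "T \<in> Obj C" using assms Hom_Obj by blast
  have "p' \<cdot> h \<in> Hom C T (Dom C f)" "f' \<cdot> h \<in> Hom C T (Dom C p)"
    using p assms by (simp_all add: Hom_iff)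
  moreover have "f \<cdot> (p' \<cdot> h) = p \<cdot> (f' \<cdot> h)"
    using p assms by (metis Cmp_assoc' Hom_iff)
  ultimately have "\<exists>!x. x \<in> Hom C T (Dom C p') \<and> p' \<cdot> x = p' \<cdot> h \<and> f' \<cdot> x = f' \<cdot> h"
    using assms(1) T unfolding is_pullback_def by blast
  then show ?thesis using assms by metis
qed

end


text \<open>The record stores addition and zero only; the inverse comes from the Hom group, whose
  carrier is read off \<open>f\<close>. Hence the laws below ask for parallel arguments.\<close>

definition Diff :: "('o, 'm, 'z) additive_data_scheme \<Rightarrow> 'm \<Rightarrow> 'm \<Rightarrow> 'm" where
  "Diff C f g = f \<oplus>\<^bsub>C\<^esub> inv\<^bsub>Hom_group C (Dom C f) (Cod C f)\<^esub> g"

section \<open>Arithmetic in the Hom groups\<close>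

context additive_category
begin

lemma Zero_Arr [simp]: "\<lbrakk>X \<in> Obj C; Y \<in> Obj C\<rbrakk> \<Longrightarrow> Zero C X Y \<in> Arr C"
  and Dom_Zero [simp]: "\<lbrakk>X \<in> Obj C; Y \<in> Obj C\<rbrakk> \<Longrightarrow> Dom C (Zero C X Y) = X"
  and Cod_Zero [simp]: "\<lbrakk>X \<in> Obj C; Y \<in> Obj C\<rbrakk> \<Longrightarrow> Cod C (Zero C X Y) = Y"
proof -
  assume *: "X \<in> Obj C" "Y \<in> Obj C"
  interpret G: comm_group "Hom_group C X Y" by (rule Hom_comm_group[OF *])
  have "Zero C X Y \<in> Hom C X Y" using G.one_closed by (simp add: Hom_group_def)
  then show "Zero C X Y \<in> Arr C" "Dom C (Zero C X Y) = X" "Cod C (Zero C X Y) = Y"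
    by (simp_all add: Hom_iff)
qed

lemma Add_Arr [simp]: "\<lbrakk>f \<in> Arr C; g \<in> Arr C; Dom C f = Dom C g; Cod C f = Cod C g\<rbrakk> \<Longrightarrow> f \<oplus> g \<in> Arr C"
  and Dom_Add [simp]: "\<lbrakk>f \<in> Arr C; g \<in> Arr C; Dom C f = Dom C g; Cod C f = Cod C g\<rbrakk> \<Longrightarrow> Dom C (f \<oplus> g) = Dom C f"
  and Cod_Add [simp]: "\<lbrakk>f \<in> Arr C; g \<in> Arr C; Dom C f = Dom C g; Cod C f = Cod C g\<rbrakk> \<Longrightarrow> Cod C (f \<oplus> g) = Cod C f"
proof -
  assume *: "f \<in> Arr C" "g \<in> Arr C" "Dom C f = Dom C g" "Cod C f = Cod C g"
  interpret G: comm_group "Hom_group C (Dom C f) (Cod C f)"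
    by (rule Hom_comm_group) (use * Dom_Obj Cod_Obj in auto)
  have "f \<oplus> g \<in> Hom C (Dom C f) (Cod C f)"
    using G.m_closed[of f g] * by (simp add: Hom_group_def Hom_iff)
  then show "f \<oplus> g \<in> Arr C" "Dom C (f \<oplus> g) = Dom C f" "Cod C (f \<oplus> g) = Cod C f"
    by (simp_all add: Hom_iff)
qed

lemma Add_Zero [simp]: "\<lbrakk>f \<in> Arr C; Dom C f = X; Cod C f = Y\<rbrakk> \<Longrightarrow> f \<oplus> Zero C X Y = f"
  and Zero_Add [simp]: "\<lbrakk>f \<in> Arr C; Dom C f = X; Cod C f = Y\<rbrakk> \<Longrightarrow> Zero C X Y \<oplus> f = f"
proof -
  assume *: "f \<in> Arr C" "Dom C f = X" "Cod C f = Y"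
  interpret G: comm_group "Hom_group C X Y"
    by (rule Hom_comm_group) (use * Dom_Obj Cod_Obj in auto)
  show "f \<oplus> Zero C X Y = f" "Zero C X Y \<oplus> f = f"
    using G.r_one[of f] G.l_one[of f] * by (simp_all add: Hom_group_def Hom_iff)
qed

lemma Cmp_Add' [simp]:
  "\<lbrakk>f \<in> Arr C; f' \<in> Arr C; g \<in> Arr C; Dom C f = Dom C f'; Cod C f = Dom C g; Cod C f' = Dom C g\<rbrakk>
    \<Longrightarrow> g \<cdot> (f \<oplus> f') = (g \<cdot> f) \<oplus> (g \<cdot> f')"
  using Cmp_Add[of f "Dom C f" "Cod C f" f' g "Cod C g"] by (simp add: Hom_iff)

lemma Add_Cmp' [simp]:
  "\<lbrakk>f \<in> Arr C; g \<in> Arr C; g' \<in> Arr C; Cod C g = Cod C g'; Cod C f = Dom C g; Cod C f = Dom C g'\<rbrakk>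
    \<Longrightarrow> (g \<oplus> g') \<cdot> f = (g \<cdot> f) \<oplus> (g' \<cdot> f)"
  using Add_Cmp[of f "Dom C f" "Cod C f" g "Cod C g" g'] by (simp add: Hom_iff)

text \<open>Serves to show that composites with zero maps vanish: bilinearity gives
  \<open>x \<oplus> x = x\<close> for such a composite.\<close>

lemma add_idem_zero:
  assumes "f \<in> Arr C" "f \<oplus> f = f"
  shows "f = Zero C (Dom C f) (Cod C f)"
proof -
  interpret G: comm_group "Hom_group C (Dom C f) (Cod C f)"
    by (rule Hom_comm_group) (use assms Dom_Obj Cod_Obj in auto)
  show ?thesis using G.l_cancel_one[of f f] assms by (simp add: Hom_group_def Hom_iff)
qed

lemma Cmp_Zero [simp]:
  assumes "g \<in> Arr C" "Dom C g = Y" "X \<in> Obj C"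
  shows "g \<cdot> Zero C X Y = Zero C X (Cod C g)"
proof -
  have Y: "Y \<in> Obj C" using assms Dom_Obj by auto
  have "(g \<cdot> Zero C X Y) \<oplus> (g \<cdot> Zero C X Y) = g \<cdot> (Zero C X Y \<oplus> Zero C X Y)"
    by (rule Cmp_Add'[symmetric]) (use assms Y in simp_all)
  also have "\<dots> = g \<cdot> Zero C X Y" using assms Y by (simp del: Cmp_Add')
  finally show ?thesis using add_idem_zero[of "g \<cdot> Zero C X Y"] assms Y by simp
qed

lemma Zero_Cmp [simp]:
  assumes "g \<in> Arr C" "Cod C g = X" "Y \<in> Obj C"
  shows "Zero C X Y \<cdot> g = Zero C (Dom C g) Y"
proof -
  have X: "X \<in> Obj C" using assms Cod_Obj by auto
  have "(Zero C X Y \<cdot> g) \<oplus> (Zero C X Y \<cdot> g) = (Zero C X Y \<oplus> Zero C X Y) \<cdot> g"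
    by (rule Add_Cmp'[symmetric]) (use assms X in simp_all)
  also have "\<dots> = Zero C X Y \<cdot> g" using assms X by (simp del: Add_Cmp')
  finally show ?thesis using add_idem_zero[of "Zero C X Y \<cdot> g"] assms X by simp
qed

lemma Diff_Arr [simp]: "\<lbrakk>f \<in> Arr C; g \<in> Arr C; Dom C f = Dom C g; Cod C f = Cod C g\<rbrakk> \<Longrightarrow> Diff C f g \<in> Arr C"
  and Dom_Diff [simp]: "\<lbrakk>f \<in> Arr C; g \<in> Arr C; Dom C f = Dom C g; Cod C f = Cod C g\<rbrakk> \<Longrightarrow> Dom C (Diff C f g) = Dom C f"
  and Cod_Diff [simp]: "\<lbrakk>f \<in> Arr C; g \<in> Arr C; Dom C f = Dom C g; Cod C f = Cod C g\<rbrakk> \<Longrightarrow> Cod C (Diff C f g) = Cod C f"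
  and Diff_Add: "\<lbrakk>f \<in> Arr C; g \<in> Arr C; Dom C f = Dom C g; Cod C f = Cod C g\<rbrakk> \<Longrightarrow> Diff C f g \<oplus> g = f"
proof -
  assume *: "f \<in> Arr C" "g \<in> Arr C" "Dom C f = Dom C g" "Cod C f = Cod C g"
  interpret G: comm_group "Hom_group C (Dom C f) (Cod C f)"
    by (rule Hom_comm_group) (use * Dom_Obj Cod_Obj in auto)
  have g: "g \<in> carrier (Hom_group C (Dom C f) (Cod C f))"
    and f: "f \<in> carrier (Hom_group C (Dom C f) (Cod C f))"
    using * by (simp_all add: Hom_group_def Hom_iff)
  have *: "Diff C f g = f \<otimes>\<^bsub>Hom_group C (Dom C f) (Cod C f)\<^esub> inv\<^bsub>Hom_group C (Dom C f) (Cod C f)\<^esub> g"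
    by (simp add: Diff_def Hom_group_def)
  then have "Diff C f g \<in> carrier (Hom_group C (Dom C f) (Cod C f))" using f g by simp
  then show "Diff C f g \<in> Arr C" "Dom C (Diff C f g) = Dom C f" "Cod C (Diff C f g) = Cod C f"
    by (simp_all add: Hom_group_def Hom_iff)
  have "Diff C f g \<otimes>\<^bsub>Hom_group C (Dom C f) (Cod C f)\<^esub> g = f"
    unfolding * using f g by (simp add: G.m_assoc)
  then show "Diff C f g \<oplus> g = f" by (simp add: Hom_group_def)
qed

lemma Add_right_cancel:
  assumes "f \<oplus> g = f' \<oplus> g" "f \<in> Hom C X Y" "f' \<in> Hom C X Y" "g \<in> Hom C X Y"
  shows "f = f'"
proof -
  interpret G: comm_group "Hom_group C X Y"
    by (rule Hom_comm_group) (use assms Hom_Obj in auto)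
  show ?thesis using G.right_cancel[of g f f'] assms by (simp add: Hom_group_def)
qed

lemma Add_commute:
  assumes "f \<in> Hom C X Y" "g \<in> Hom C X Y"
  shows "f \<oplus> g = g \<oplus> f"
proof -
  interpret G: comm_group "Hom_group C X Y"
    by (rule Hom_comm_group) (use assms Hom_Obj in auto)
  show ?thesis using G.m_comm[of f g] assms by (simp add: Hom_group_def)
qed

lemma DiffI: "\<lbrakk>h \<oplus> g = f; f \<in> Arr C; g \<in> Arr C; h \<in> Arr C; Dom C f = Dom C g; Cod C f = Cod C g;
    Dom C h = Dom C g; Cod C h = Cod C g\<rbrakk> \<Longrightarrow> Diff C f g = h"
  by (rule Add_right_cancel[of _ g _ "Dom C g" "Cod C g"]) (simp_all add: Hom_iff Diff_Add)

lemma Diff_self [simp]: "f \<in> Arr C \<Longrightarrow> Diff C f f = Zero C (Dom C f) (Cod C f)"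
  by (rule DiffI) (simp_all add: Dom_Obj Cod_Obj)

lemma Diff_Zero [simp]: "\<lbrakk>f \<in> Arr C; Dom C f = X; Cod C f = Y\<rbrakk> \<Longrightarrow> Diff C f (Zero C X Y) = f"
  using Dom_Obj Cod_Obj by (intro DiffI) auto

lemma Diff_eq_Zero:
  "\<lbrakk>Diff C f g = Zero C X Y; f \<in> Hom C X Y; g \<in> Hom C X Y\<rbrakk> \<Longrightarrow> f = g"
  using Diff_Add[of f g] by (simp add: Hom_iff)

lemma Cmp_Diff [simp]:
  assumes "f \<in> Arr C" "f' \<in> Arr C" "g \<in> Arr C" "Dom C f = Dom C f'" "Cod C f = Dom C g" "Cod C f' = Dom C g"
  shows "g \<cdot> Diff C f f' = Diff C (g \<cdot> f) (g \<cdot> f')"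
proof (rule sym, rule DiffI)
  have "g \<cdot> (Diff C f f' \<oplus> f') = g \<cdot> f" using assms by (metis Diff_Add)
  then show "(g \<cdot> Diff C f f') \<oplus> (g \<cdot> f') = g \<cdot> f" using assms by simp
qed (use assms in simp_all)

lemma Diff_Cmp [simp]:
  assumes "f \<in> Arr C" "g \<in> Arr C" "g' \<in> Arr C" "Cod C g = Cod C g'" "Cod C f = Dom C g" "Cod C f = Dom C g'"
  shows "Diff C g g' \<cdot> f = Diff C (g \<cdot> f) (g' \<cdot> f)"
proof (rule sym, rule DiffI)
  have "(Diff C g g' \<oplus> g') \<cdot> f = g \<cdot> f" using assms by (metis Diff_Add)
  then show "(Diff C g g' \<cdot> f) \<oplus> (g' \<cdot> f) = g \<cdot> f" using assms by simp
qed (use assms in simp_all)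

section \<open>Zero objects, kernels and cokernels\<close>

lemma zero_object_Obj: "is_zero_object C N \<Longrightarrow> N \<in> Obj C"
  by (simp add: is_zero_object_def)

lemma zero_object_from:
  "\<lbrakk>is_zero_object C N; f \<in> Hom C N X; g \<in> Hom C N X\<rbrakk> \<Longrightarrow> f = g"
  unfolding is_zero_object_def using Hom_Obj by blast

lemma zero_object_to:
  "\<lbrakk>is_zero_object C N; f \<in> Hom C X N; g \<in> Hom C X N\<rbrakk> \<Longrightarrow> f = g"
  unfolding is_zero_object_def using Hom_Obj by blast

lemma zero_objectI:
  assumes "N \<in> Obj C" "Id C N = Zero C N N"
  shows "is_zero_object C N"
  unfolding is_zero_object_def
proof (intro conjI ballI)
  fix X assume X: "X \<in> Obj C"
  show "\<exists>!f. f \<in> Hom C N X"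
  proof (rule ex1I[of _ "Zero C N X"])
    show "Zero C N X \<in> Hom C N X" using assms X by (simp add: Hom_iff)
    show "f = Zero C N X" if "f \<in> Hom C N X" for f
    proof -
      have "f = f \<cdot> Zero C N N" using that assms by (metis Cmp_Id)
      then show ?thesis using that assms by (simp add: Hom_iff)
    qed
  qed
  show "\<exists>!f. f \<in> Hom C X N"
  proof (rule ex1I[of _ "Zero C X N"])
    show "Zero C X N \<in> Hom C X N" using assms X by (simp add: Hom_iff)
    show "f = Zero C X N" if "f \<in> Hom C X N" for f
    proof -
      have "f = Zero C N N \<cdot> f" using that assms by (metis Id_Cmp)
      then show ?thesis using that assms by (simp add: Hom_iff)
    qed
  qed
qed (rule assms)

lemma cokernelD:
  assumes "is_cokernel C p i"
  shows "i \<in> Arr C" "p \<in> Arr C" "Cod C i = Dom C p" "p \<cdot> i = Zero C (Dom C i) (Cod C p)"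
  using assms unfolding is_cokernel_def by auto

lemma cokernel_factor:
  assumes "is_cokernel C p i" "f \<in> Hom C (Dom C p) T" "f \<cdot> i = Zero C (Dom C i) T"
  obtains g where "g \<in> Hom C (Cod C p) T" "g \<cdot> p = f"
  using assms Hom_Obj unfolding is_cokernel_def by metis

lemma cokernel_epi:
  assumes "is_cokernel C p i" "f \<in> Hom C (Cod C p) T" "g \<in> Hom C (Cod C p) T" "f \<cdot> p = g \<cdot> p"
  shows "f = g"
proof -
  note c = cokernelD[OF assms(1)]
  have T: "T \<in> Obj C" using assms Hom_Obj by blast
  have "f \<cdot> p \<in> Hom C (Cod C i) T" "(f \<cdot> p) \<cdot> i = Zero C (Dom C i) T"
    using c assms Dom_Obj[of i] by (simp_all add: Hom_iff)
  then have "\<exists>!x. x \<in> Hom C (Cod C p) T \<and> x \<cdot> p = f \<cdot> p"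
    using assms(1) T unfolding is_cokernel_def by blast
  then show ?thesis using assms by metis
qed

lemma kernelD:
  assumes "is_kernel C i p"
  shows "i \<in> Arr C" "p \<in> Arr C" "Cod C i = Dom C p" "p \<cdot> i = Zero C (Dom C i) (Cod C p)"
  using assms unfolding is_kernel_def by auto

lemma kernel_factor:
  assumes "is_kernel C i p" "f \<in> Hom C T (Dom C p)" "p \<cdot> f = Zero C T (Cod C p)"
  obtains g where "g \<in> Hom C T (Dom C i)" "i \<cdot> g = f"
  using assms Hom_Obj unfolding is_kernel_def by metis

lemma kernel_mono:
  assumes "is_kernel C i p" "f \<in> Hom C T (Dom C i)" "g \<in> Hom C T (Dom C i)" "i \<cdot> f = i \<cdot> g"
  shows "f = g"
proof -
  note c = kernelD[OF assms(1)]
  have T: "T \<in> Obj C" using assms Hom_Obj by blast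
  have "p \<cdot> (i \<cdot> f) = (p \<cdot> i) \<cdot> f" using c assms by (metis Cmp_assoc' Hom_iff)
  then have "i \<cdot> f \<in> Hom C T (Dom C p)" "p \<cdot> (i \<cdot> f) = Zero C T (Cod C p)"
    using c assms Cod_Obj[of p] by (simp_all add: Hom_iff)
  then have "\<exists>!x. x \<in> Hom C T (Dom C i) \<and> i \<cdot> x = i \<cdot> f"
    using assms(1) T unfolding is_kernel_def by blast
  then show ?thesis using assms by metis
qed

lemma cokernelI:
  assumes "p \<in> Hom C B S" "i \<in> Hom C A B" "p \<cdot> i = Zero C A S"
    "\<And>T f. \<lbrakk>f \<in> Hom C B T; f \<cdot> i = Zero C A T\<rbrakk> \<Longrightarrow> \<exists>g. g \<in> Hom C S T \<and> g \<cdot> p = f"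
    "\<And>T f g. \<lbrakk>f \<in> Hom C S T; g \<in> Hom C S T; f \<cdot> p = g \<cdot> p\<rbrakk> \<Longrightarrow> f = g"
  shows "is_cokernel C p i"
proof -
  have eqs: "Cod C p = S" "Dom C p = B" "Dom C i = A" "Cod C i = B" using assms by (simp_all add: Hom_iff)
  show ?thesis unfolding is_cokernel_def eqs
  proof (intro conjI ballI impI)
    fix T f assume "f \<in> Hom C B T" "f \<cdot> i = Zero C A T"
    then obtain g where "g \<in> Hom C S T \<and> g \<cdot> p = f" using assms(4) by blast
    then show "\<exists>!g. g \<in> Hom C S T \<and> g \<cdot> p = f" using assms(5) by metis
  qed (use assms in \<open>simp_all add: Hom_iff\<close>)
qed

lemma kernelI:
  assumes "i \<in> Hom C A B" "p \<in> Hom C B S" "p \<cdot> i = Zero C A S"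
    "\<And>T f. \<lbrakk>f \<in> Hom C T B; p \<cdot> f = Zero C T S\<rbrakk> \<Longrightarrow> \<exists>g. g \<in> Hom C T A \<and> i \<cdot> g = f"
    "\<And>T f g. \<lbrakk>f \<in> Hom C T A; g \<in> Hom C T A; i \<cdot> f = i \<cdot> g\<rbrakk> \<Longrightarrow> f = g"
  shows "is_kernel C i p"
proof -
  have eqs: "Cod C p = S" "Dom C p = B" "Dom C i = A" "Cod C i = B" using assms by (simp_all add: Hom_iff)
  show ?thesis unfolding is_kernel_def eqs
  proof (intro conjI ballI impI)
    fix T f assume "f \<in> Hom C T B" "p \<cdot> f = Zero C T S"
    then obtain g where "g \<in> Hom C T A \<and> i \<cdot> g = f" using assms(4) by blast
    then show "\<exists>!g. g \<in> Hom C T A \<and> i \<cdot> g = f" using assms(5) by metis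
  qed (use assms in \<open>simp_all add: Hom_iff\<close>)
qed

lemma cokernel_unique:
  assumes "is_cokernel C p i" "is_cokernel C p' i"
  obtains h where "h \<in> Hom C (Cod C p) (Cod C p')" "is_iso C h" "h \<cdot> p = p'"
proof -
  note c = cokernelD[OF assms(1)] and c' = cokernelD[OF assms(2)]
  obtain h where h: "h \<in> Hom C (Cod C p) (Cod C p')" "h \<cdot> p = p'"
    using cokernel_factor[OF assms(1), of p' "Cod C p'"] c c' by (auto simp: Hom_iff)
  obtain k where k: "k \<in> Hom C (Cod C p') (Cod C p)" "k \<cdot> p' = p"
    using cokernel_factor[OF assms(2), of p "Cod C p"] c c' by (auto simp: Hom_iff)
  have "k \<cdot> h = Id C (Cod C p)"
    by (rule cokernel_epi[OF assms(1), of _ "Cod C p"])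
      (use h k c c' Cod_Obj in \<open>auto simp: Hom_iff\<close>)
  moreover have "h \<cdot> k = Id C (Cod C p')"
    by (rule cokernel_epi[OF assms(2), of _ "Cod C p'"])
      (use h k c c' Cod_Obj in \<open>auto simp: Hom_iff\<close>)
  ultimately show ?thesis using that h k is_isoI by metis
qed

lemma kernel_unique:
  assumes "is_kernel C i p" "is_kernel C i' p"
  obtains h where "h \<in> Hom C (Dom C i) (Dom C i')" "is_iso C h" "i' \<cdot> h = i"
proof -
  note c = kernelD[OF assms(1)] and c' = kernelD[OF assms(2)]
  obtain h where h: "h \<in> Hom C (Dom C i) (Dom C i')" "i' \<cdot> h = i"
    using kernel_factor[OF assms(2), of i "Dom C i"] c c' by (auto simp: Hom_iff)
  obtain k where k: "k \<in> Hom C (Dom C i') (Dom C i)" "i \<cdot> k = i'"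
    using kernel_factor[OF assms(1), of i' "Dom C i'"] c c' by (auto simp: Hom_iff)
  have "k \<cdot> h = Id C (Dom C i)"
  proof (rule kernel_mono[OF assms(1), of _ "Dom C i"])
    have "i \<cdot> (k \<cdot> h) = (i \<cdot> k) \<cdot> h" using h k c by (metis Cmp_assoc' Hom_iff)
    then show "i \<cdot> (k \<cdot> h) = i \<cdot> Id C (Dom C i)" using h k c by simp
  qed (use h k c c' Dom_Obj in \<open>auto simp: Hom_iff\<close>)
  moreover have "h \<cdot> k = Id C (Dom C i')"
  proof (rule kernel_mono[OF assms(2), of _ "Dom C i'"])
    have "i' \<cdot> (h \<cdot> k) = (i' \<cdot> h) \<cdot> k" using h k c' by (metis Cmp_assoc' Hom_iff)
    then show "i' \<cdot> (h \<cdot> k) = i' \<cdot> Id C (Dom C i')" using h k c' by simp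
  qed (use h k c c' Dom_Obj in \<open>auto simp: Hom_iff\<close>)
  ultimately show ?thesis using that h k is_isoI by metis
qed

end

section \<open>Exact categories\<close>

definition lifts :: "('o, 'm, 'z) cat_data_scheme \<Rightarrow> 'm \<Rightarrow> 'm \<Rightarrow> bool" where
  "lifts C j q \<longleftrightarrow> (\<forall>u \<in> Hom C (Dom C j) (Dom C q). \<forall>v \<in> Hom C (Cod C j) (Cod C q).
     q \<cdot>\<^bsub>C\<^esub> u = v \<cdot>\<^bsub>C\<^esub> j \<longrightarrow>
     (\<exists>l \<in> Hom C (Cod C j) (Dom C q). l \<cdot>\<^bsub>C\<^esub> j = u \<and> q \<cdot>\<^bsub>C\<^esub> l = v))"

context exact_category
begin

lemma conflationD:
  assumes "conflation C A i B p S"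
  shows "(i, p) \<in> Conflations C" "i \<in> Hom C A B" "p \<in> Hom C B S" "is_kernel C i p"
    "is_cokernel C p i" "p \<cdot> i = Zero C A S" "A \<in> Obj C" "B \<in> Obj C" "S \<in> Obj C"
  using assms conflation_kernel conflation_cokernel kernelD(4)[of i p] Hom_Obj[of i A B] Hom_Obj[of p B S]
  unfolding conflation_def by (auto simp: Hom_iff)

lemma conflationI: "(i, p) \<in> Conflations C \<Longrightarrow> conflation C (Dom C i) i (Cod C i) p (Cod C p)"
  using kernelD[OF conflation_kernel, of i p] unfolding conflation_def by (simp add: Hom_iff)

lemma Inflations_Arr: "i \<in> Inflations C \<Longrightarrow> i \<in> Arr C"
  and Deflations_Arr: "p \<in> Deflations C \<Longrightarrow> p \<in> Arr C"
  using kernelD[OF conflation_kernel] unfolding Inflations_def Deflations_def by auto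

lemma inflation_conflation:
  assumes "i \<in> Inflations C" "i \<in> Hom C A B"
  obtains p S where "conflation C A i B p S"
  using assms conflationI unfolding Inflations_def Hom_iff by blast

lemma deflation_conflation:
  assumes "p \<in> Deflations C" "p \<in> Hom C B S"
  obtains i A where "conflation C A i B p S"
proof -
  obtain i where i: "(i, p) \<in> Conflations C" using assms unfolding Deflations_def by auto
  have "Cod C i = B" using kernelD[OF conflation_kernel[OF i]] assms by (simp add: Hom_iff)
  then show ?thesis using that conflationI[OF i] assms by (simp add: Hom_iff)
qed

lemma conflation_deflation: "conflation C A i B p S \<Longrightarrow> p \<in> Deflations C"
  unfolding conflation_def Deflations_def by auto

lemma conflation_inflation: "conflation C A i B p S \<Longrightarrow> i \<in> Inflations C"
  unfolding conflation_def Inflations_def by auto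

lemma conflation_factor_kernel:
  assumes "conflation C A i B p S" "f \<in> Hom C T B" "p \<cdot> f = Zero C T S"
  obtains g where "g \<in> Hom C T A" "i \<cdot> g = f"
  using kernel_factor[OF conflationD(4)[OF assms(1)], of f T] conflationD(2,3)[OF assms(1)] assms(2,3)
  by (auto simp: Hom_iff)

lemma conflation_mono:
  assumes "conflation C A i B p S" "f \<in> Hom C T A" "g \<in> Hom C T A" "i \<cdot> f = i \<cdot> g"
  shows "f = g"
  using kernel_mono[OF conflationD(4)[OF assms(1)], of f T g] conflationD(2)[OF assms(1)] assms(2-4)
  by (auto simp: Hom_iff)

lemma conflation_factor_cokernel:
  assumes "conflation C A i B p S" "f \<in> Hom C B T" "f \<cdot> i = Zero C A T"
  obtains g where "g \<in> Hom C S T" "g \<cdot> p = f"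
  using cokernel_factor[OF conflationD(5)[OF assms(1)], of f T] conflationD(2,3)[OF assms(1)] assms(2,3)
  by (auto simp: Hom_iff)

lemma conflation_epi:
  assumes "conflation C A i B p S" "f \<in> Hom C S T" "g \<in> Hom C S T" "f \<cdot> p = g \<cdot> p"
  shows "f = g"
  using cokernel_epi[OF conflationD(5)[OF assms(1)], of f T g] conflationD(3)[OF assms(1)] assms(2-4)
  by (auto simp: Hom_iff)

section \<open>Conflations under isomorphisms, pushouts and pullbacks\<close>

lemma pair_isoI:
  assumes "a \<in> Hom C (Dom C i) (Dom C i')" "b \<in> Hom C (Cod C i) (Cod C i')"
    "c \<in> Hom C (Cod C p) (Cod C p')" "is_iso C a" "is_iso C b" "is_iso C c"
    "b \<cdot> i = i' \<cdot> a" "c \<cdot> p = p' \<cdot> b"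
  shows "pair_iso C (i, p) (i', p')"
  using assms unfolding pair_iso_def by auto

lemma conflation_change_cokernel:
  assumes "conflation C A i B p S" "is_cokernel C p' i"
  shows "conflation C A i B p' (Cod C p')"
proof -
  note c = conflationD[OF assms(1)] and c' = cokernelD[OF assms(2)]
  obtain h where h: "h \<in> Hom C (Cod C p) (Cod C p')" "is_iso C h" "h \<cdot> p = p'"
    by (rule cokernel_unique[OF c(5) assms(2)])
  have "pair_iso C (i, p) (i, p')"
    by (rule pair_isoI[of "Id C A" _ _ "Id C B" h])
      (use c c' h is_iso_Id in \<open>auto simp: Hom_iff\<close>)
  then have "(i, p') \<in> Conflations C" using conflation_iso[of i p i p'] c c' by (auto simp: Hom_iff)
  then show ?thesis using c c' unfolding conflation_def by (simp add: Hom_iff)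
qed

lemma conflation_change_kernel:
  assumes "conflation C A i B p S" "is_kernel C i' p"
  shows "conflation C (Dom C i') i' B p S"
proof -
  note c = conflationD[OF assms(1)] and c' = kernelD[OF assms(2)]
  obtain h where h: "h \<in> Hom C (Dom C i) (Dom C i')" "is_iso C h" "i' \<cdot> h = i"
    by (rule kernel_unique[OF c(4) assms(2)])
  have "pair_iso C (i, p) (i', p)"
    by (rule pair_isoI[of h _ _ "Id C B" "Id C S"])
      (use c c' h is_iso_Id in \<open>auto simp: Hom_iff\<close>)
  then have "(i', p) \<in> Conflations C" using conflation_iso[of i p i' p] c c' by (auto simp: Hom_iff)
  then show ?thesis using c c' unfolding conflation_def by (simp add: Hom_iff)
qed

text \<open>Besides comparing pushouts, this carries a conflation from a coproduct over to the
  filtered object isomorphic to it.\<close>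

lemma conflation_iso_middle:
  assumes "conflation C A i B p S" "h \<in> Hom C B B'" "k \<in> Hom C B' B" "k \<cdot> h = Id C B" "h \<cdot> k = Id C B'"
  shows "conflation C A (h \<cdot> i) B' (p \<cdot> k) S"
proof -
  note c = conflationD[OF assms(1)]
  have "k \<cdot> (h \<cdot> i) = Id C B \<cdot> i" using assms c by (metis Cmp_assoc' Hom_iff)
  moreover have "(p \<cdot> k) \<cdot> h = p"
    using assms(2-4) c by (simp add: Hom_iff)
  ultimately have "pair_iso C (i, p) (h \<cdot> i, p \<cdot> k)"
    by (intro pair_isoI[of "Id C A" _ _ h "Id C S"])
      (use c assms is_iso_Id is_isoI[OF assms(2,3,4,5)] in \<open>auto simp: Hom_iff\<close>)
  then have "(h \<cdot> i, p \<cdot> k) \<in> Conflations C"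
    using conflation_iso[of i p "h \<cdot> i" "p \<cdot> k"] c assms by (auto simp: Hom_iff)
  then show ?thesis using c assms unfolding conflation_def by (simp add: Hom_iff)
qed

lemma conflation_iso_right:
  assumes "conflation C A i B p S" "h \<in> Hom C S S'" "is_iso C h"
  shows "conflation C A i B (h \<cdot> p) S'"
proof -
  note c = conflationD[OF assms(1)]
  have "pair_iso C (i, p) (i, h \<cdot> p)"
    by (rule pair_isoI[of "Id C A" _ _ "Id C B" h])
      (use c assms is_iso_Id in \<open>auto simp: Hom_iff\<close>)
  then have "(i, h \<cdot> p) \<in> Conflations C"
    using conflation_iso[of i p "i" "h \<cdot> p"] c assms by (auto simp: Hom_iff)
  then show ?thesis using c assms unfolding conflation_def by (simp add: Hom_iff)
qed

text \<open>The axiom provides one pushout whose arm is an inflation; the given pushout is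
  isomorphic to it, so \<open>i'\<close> has some cokernel. The map induced by 0 and
  \<open>p\<close> is another cokernel of \<open>i'\<close>, so that the third term is
  \<open>S\<close> itself and not a copy.\<close>

lemma pushout_conflation:
  assumes po: "is_pushout C i f i' f'" and "conflation C A i B p S"
  obtains p' where "conflation C (Cod C f) i' (Cod C i') p' S" "p' \<cdot> f' = p"
proof -
  note c = conflationD[OF assms(2)] and d = pushoutD[OF po]
  have dc: "Dom C i = A" "Cod C i = B" "Dom C p = B" "Cod C p = S" "i \<in> Arr C" "p \<in> Arr C"
    using c by (simp_all add: Hom_iff)
  obtain j g where po': "is_pushout C i f j g" and j: "j \<in> Inflations C"
    using inflation_pushout[OF conflation_inflation[OF assms(2)], of f] d by auto
  note d' = pushoutD[OF po']
  obtain q S' where q: "conflation C (Cod C f) j (Cod C j) q S'"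
    by (rule inflation_conflation[OF j, of "Cod C f" "Cod C j"]) (use d' in \<open>simp_all add: Hom_iff\<close>)
  obtain h where h: "h \<in> Hom C (Cod C j) (Cod C i')" "h \<cdot> j = i'" "h \<cdot> g = f'"
    using pushout_factor[OF po', of i' "Cod C i'" f'] d dc by (auto simp: Hom_iff)
  obtain k where k: "k \<in> Hom C (Cod C i') (Cod C j)" "k \<cdot> i' = j" "k \<cdot> f' = g"
    using pushout_factor[OF po, of j "Cod C j" g] d' dc by (auto simp: Hom_iff)
  have "k \<cdot> h = Id C (Cod C j)"
    by (rule pushout_unique[OF po'])
      (use h k d d' Cod_Obj in \<open>auto simp: Hom_iff\<close>)
  moreover have "h \<cdot> k = Id C (Cod C i')"
    by (rule pushout_unique[OF po])
      (use h k d d' Cod_Obj in \<open>auto simp: Hom_iff\<close>)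
  ultimately have i': "conflation C (Cod C f) i' (Cod C i') (q \<cdot> k) S'"
    using conflation_iso_middle[OF q h(1) k(1)] h by simp
  have A': "Cod C f \<in> Obj C" using d Cod_Obj by simp
  obtain p' where p': "p' \<in> Hom C (Cod C i') S" "p' \<cdot> i' = Zero C (Cod C f) S" "p' \<cdot> f' = p"
    using pushout_factor[OF po, of "Zero C (Cod C f) S" S p] c d A' dc by (auto simp: Hom_iff)
  have "is_cokernel C p' i'"
  proof (rule cokernelI[OF p'(1) _ p'(2)])
    show "i' \<in> Hom C (Cod C f) (Cod C i')" using d by (simp add: Hom_iff)
    fix T u assume u: "u \<in> Hom C (Cod C i') T" "u \<cdot> i' = Zero C (Cod C f) T"
    have T: "T \<in> Obj C" using u Hom_Obj by blast
    have "(u \<cdot> f') \<cdot> i = (u \<cdot> i') \<cdot> f" using u(1) d by (simp add: Hom_iff)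
    then have u0: "(u \<cdot> f') \<cdot> i = Zero C A T" using u d T dc A' by (simp add: Hom_iff)
    have "u \<cdot> f' \<in> Hom C B T" using u d dc by (simp add: Hom_iff)
    then obtain v where v: "v \<in> Hom C S T" "v \<cdot> p = u \<cdot> f'"
      by (rule conflation_factor_cokernel[OF assms(2) _ u0])
    have "v \<cdot> p' = u"
      by (rule pushout_unique[OF po, of _ T]) (use u v p' d A' T c in \<open>auto simp: Hom_iff\<close>)
    then show "\<exists>v. v \<in> Hom C S T \<and> v \<cdot> p' = u" using v by blast
  next
    fix T u v assume u: "u \<in> Hom C S T" "v \<in> Hom C S T" "u \<cdot> p' = v \<cdot> p'"
    have "u \<cdot> p = (u \<cdot> p') \<cdot> f'" using u(1) p' d by (simp add: Hom_iff)
    also have "\<dots> = v \<cdot> p" using u p' d by (simp add: Hom_iff)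
    finally show "u = v" by (rule conflation_epi[OF assms(2) u(1,2)])
  qed
  then have "conflation C (Cod C f) i' (Cod C i') p' S"
    using conflation_change_cokernel[OF i', of p'] p' by (auto simp: Hom_iff)
  then show ?thesis using that p' by blast
qed

text \<open>The map into the pullback induced by 0 and \<open>i\<close> is again a kernel of
  \<open>p'\<close>, so the conflation keeps the very object \<open>A\<close>.\<close>

lemma pullback_conflation:
  assumes "conflation C A i B p S" "f \<in> Hom C S' S"
  obtains B' i' p' f' where "conflation C A i' B' p' S'" "is_pullback C p f p' f'"
    "f' \<in> Hom C B' B" "f' \<cdot> i' = i" "p \<cdot> f' = f \<cdot> p'"
proof -
  note c = conflationD[OF assms(1)]
  obtain p' f' where pb: "is_pullback C p f p' f'" and p'D: "p' \<in> Deflations C"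
    using deflation_pullback[OF conflation_deflation[OF assms(1)], of f] assms c by (auto simp: Hom_iff)
  note d = pullbackD[OF pb]
  have S': "S' \<in> Obj C" using assms Hom_Obj by blast
  have dc: "Dom C f = S'" "Cod C f = S" "f \<in> Arr C" using assms by (simp_all add: Hom_iff)
  obtain k K where k: "conflation C K k (Dom C p') p' S'"
    by (rule deflation_conflation[OF p'D, of "Dom C p'" S']) (use d dc in \<open>simp_all add: Hom_iff\<close>)
  obtain i' where i': "i' \<in> Hom C A (Dom C p')" "p' \<cdot> i' = Zero C A S'" "f' \<cdot> i' = i"
    using pullback_factor[OF pb, of "Zero C A S'" A i] c S' dc by (auto simp: Hom_iff)
  have "is_kernel C i' p'"
  proof (rule kernelI[OF i'(1) _ i'(2)])
    show "p' \<in> Hom C (Dom C p') S'" using d dc by (simp add: Hom_iff)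
    fix T x assume x: "x \<in> Hom C T (Dom C p')" "p' \<cdot> x = Zero C T S'"
    have T: "T \<in> Obj C" using x Hom_Obj by blast
    have "p \<cdot> (f' \<cdot> x) = f \<cdot> (p' \<cdot> x)" using x(1) d by (metis Cmp_assoc' Hom_iff)
    then have x0: "p \<cdot> (f' \<cdot> x) = Zero C T S" using x dc T c by simp
    have "f' \<cdot> x \<in> Hom C T B" using x d c by (simp add: Hom_iff)
    then obtain y where y: "y \<in> Hom C T A" "i \<cdot> y = f' \<cdot> x"
      by (rule conflation_factor_kernel[OF assms(1) _ x0])
    have "i' \<cdot> y = x"
      by (rule pullback_unique[OF pb, of _ T])
        (use x y i' d S' c Cmp_rewrite[OF i'(2), of y] Cmp_rewrite[OF i'(3), of y] in \<open>auto simp: Hom_iff\<close>)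
    then show "\<exists>y. y \<in> Hom C T A \<and> i' \<cdot> y = x" using y by blast
  next
    fix T x y assume x: "x \<in> Hom C T A" "y \<in> Hom C T A" "i' \<cdot> x = i' \<cdot> y"
    have "i \<cdot> x = f' \<cdot> (i' \<cdot> x)" "i \<cdot> y = f' \<cdot> (i' \<cdot> y)"
      using x(1,2) i' d by (metis Cmp_assoc' Hom_iff)+
    then have "i \<cdot> x = i \<cdot> y" using x by simp
    then show "x = y" by (rule conflation_mono[OF assms(1) x(1,2)])
  qed
  then have "conflation C A i' (Dom C p') p' S'"
    using conflation_change_kernel[OF k, of i'] i'(1) by (auto simp: Hom_iff)
  then show ?thesis using that[OF _ pb] i' d c by (simp add: Hom_iff)
qed

text \<open>The kernel \<open>k\<close> of an identity satisfies
  \<open>k = Id C X \<cdot> k = 0\<close> and is mono, so its source is a zero object. Pushing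
  \<open>k\<close> out adjoins a direct summand, which is how biproducts and coproducts enter the
  exact structure.\<close>

lemma zero_conflation:
  assumes "X \<in> Obj C"
  obtains Z k where "is_zero_object C Z" "conflation C Z k X (Id C X) X"
proof -
  obtain k Z where k: "conflation C Z k X (Id C X) X"
    by (rule deflation_conflation[OF Id_deflation[OF assms], of X X]) (use assms in \<open>simp_all add: Hom_iff\<close>)
  note c = conflationD[OF k]
  have k0: "k = Zero C Z X" using c by (simp add: Hom_iff)
  have "Id C Z = Zero C Z Z"
    by (rule conflation_mono[OF k, of _ Z]) (use c(2,7,8) k0 in \<open>simp_all add: Hom_iff\<close>)
  then have "is_zero_object C Z" by (rule zero_objectI[OF c(7)])
  then show ?thesis using that k by blast
qed

text \<open>A biproduct is the pushout of its two summands under a zero object, so \<open>i1\<close>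
  is a pushout of the inflation \<open>k\<close>.\<close>

lemma conflation_biproduct:
  assumes h: "i1 \<in> Hom C A P" "i2 \<in> Hom C B P" "p1 \<in> Hom C P A" "p2 \<in> Hom C P B"
    and e: "p1 \<cdot> i1 = Id C A" "p2 \<cdot> i2 = Id C B" "p2 \<cdot> i1 = Zero C A B" "p1 \<cdot> i2 = Zero C B A"
      "(i1 \<cdot> p1) \<oplus> (i2 \<cdot> p2) = Id C P"
  shows "conflation C A i1 P p2 B"
proof -
  have o: "A \<in> Obj C" "B \<in> Obj C" "P \<in> Obj C" using h Hom_Obj by blast+
  obtain Z k where Z: "is_zero_object C Z" and k: "conflation C Z k B (Id C B) B"
    by (rule zero_conflation[OF o(2)])
  note c = conflationD[OF k]
  have k0: "k = Zero C Z B" using c by (simp add: Hom_iff)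
  have po: "is_pushout C k (Zero C Z A) i1 i2"
  proof (rule pushoutI)
    show "i1 \<cdot> Zero C Z A = i2 \<cdot> k" using h o c k0 by (simp add: Hom_iff)
    fix T u v assume *: "u \<in> Hom C A T" "v \<in> Hom C B T"
    let ?h = "(u \<cdot> p1) \<oplus> (v \<cdot> p2)"
    have T: "T \<in> Obj C" using * Hom_Obj by blast
    have "?h \<in> Hom C P T" "?h \<cdot> i1 = u" "?h \<cdot> i2 = v"
      using h e * o T by (simp_all add: Hom_iff)
    then show "\<exists>h. h \<in> Hom C P T \<and> h \<cdot> i1 = u \<and> h \<cdot> i2 = v" by blast
  next
    fix T u v assume uv: "u \<in> Hom C P T" "v \<in> Hom C P T" "u \<cdot> i1 = v \<cdot> i1" "u \<cdot> i2 = v \<cdot> i2"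
    have *: "x = ((x \<cdot> i1) \<cdot> p1) \<oplus> ((x \<cdot> i2) \<cdot> p2)" if "x \<in> Hom C P T" for x
    proof -
      have "x = x \<cdot> ((i1 \<cdot> p1) \<oplus> (i2 \<cdot> p2))" using e that by (simp add: Hom_iff)
      then show ?thesis using h that by (simp add: Hom_iff)
    qed
    show "u = v"
      by (rule trans[OF *[OF uv(1), unfolded uv(3,4)] *[OF uv(2), symmetric]])
  qed (use h c(2,7) o in \<open>simp_all add: Hom_iff\<close>)
  obtain q where "conflation C (Cod C (Zero C Z A)) i1 (Cod C i1) q B" "q \<cdot> i2 = Id C B"
    by (rule pushout_conflation[OF po k])
  then have q: "conflation C A i1 P q B" "q \<cdot> i2 = Id C B" using h c(7) o by (simp_all add: Hom_iff)
  note cq = conflationD[OF q(1)]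
  \<comment> \<open>The cokernel found by pushing out kills \<open>i1\<close> and is the identity on
    \<open>i2\<close>; the decomposition of \<open>Id C P\<close> shows that this determines it to
    be \<open>p2\<close>.\<close>
  have "q = q \<cdot> ((i1 \<cdot> p1) \<oplus> (i2 \<cdot> p2))" using e cq by (simp add: Hom_iff)
  also have "\<dots> = ((q \<cdot> i1) \<cdot> p1) \<oplus> ((q \<cdot> i2) \<cdot> p2)"
    using h cq(2,3) by (simp add: Hom_iff)
  also have "\<dots> = p2" unfolding cq(6) q(2) using h o by (simp add: Hom_iff)
  finally show ?thesis using q by simp
qed

text \<open>
  The pullback of the two deflations to \<open>S\<close> projects to \<open>Q\<close>; correcting this projection by a map into
  the kernel \<open>A\<close> makes it factor over \<open>B\<close>, and the factor is the inverse of \<open>h\<close>.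
\<close>

lemma conflation_map_iso:
  assumes "conflation C A i Q p S" "conflation C A j B q S" "h \<in> Hom C Q B" "h \<cdot> i = j" "q \<cdot> h = p"
  obtains k where "k \<in> Hom C B Q" "k \<cdot> h = Id C Q" "h \<cdot> k = Id C B"
proof -
  note c = conflationD[OF assms(1)] and d = conflationD[OF assms(2)]
  have ar: "i \<in> Arr C" "p \<in> Arr C" "j \<in> Arr C" "q \<in> Arr C" "h \<in> Arr C"
    "Dom C i = A" "Cod C i = Q" "Dom C p = Q" "Cod C p = S" "Dom C j = A" "Cod C j = B"
    "Dom C q = B" "Cod C q = S" "Dom C h = Q" "Cod C h = B"
    using c d assms by (simp_all add: Hom_iff)
  obtain R i' pB pQ where R: "conflation C A i' R pB B" "is_pullback C p q pB pQ"
    "pQ \<in> Hom C R Q" "pQ \<cdot> i' = i" "p \<cdot> pQ = q \<cdot> pB"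
    by (rule pullback_conflation[OF assms(1) d(3)])
  note r = conflationD[OF R(1)]
  have ar': "i' \<in> Arr C" "pB \<in> Arr C" "pQ \<in> Arr C" "Dom C i' = A" "Cod C i' = R" "Dom C pB = R"
    "Cod C pB = B" "Dom C pQ = R" "Cod C pQ = Q" using r R by (simp_all add: Hom_iff)
  note qh = Cmp_rewrite[OF assms(5)] and hi = Cmp_rewrite[OF assms(4)] and pQi = Cmp_rewrite[OF R(4)]
  have "q \<cdot> Diff C (h \<cdot> pQ) pB = Zero C R S"
    using ar ar' R(5) by (simp add: qh)
  then obtain \<rho> where \<rho>: "\<rho> \<in> Hom C R A" "j \<cdot> \<rho> = Diff C (h \<cdot> pQ) pB"
    using conflation_factor_kernel[OF assms(2), of "Diff C (h \<cdot> pQ) pB" R] ar ar' by (auto simp: Hom_iff)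
  have \<rho>a: "\<rho> \<in> Arr C" "Dom C \<rho> = R" "Cod C \<rho> = A" using \<rho> by (simp_all add: Hom_iff)
  have "j \<cdot> (\<rho> \<cdot> i') = Diff C (h \<cdot> pQ) pB \<cdot> i'" using \<rho>a ar ar' by (simp add: Cmp_rewrite[OF \<rho>(2)] del: Diff_Cmp)
  also have "\<dots> = j" using ar ar' R(4) assms(4) r(6) c(7) d(7,8) by simp
  finally have \<rho>i: "\<rho> \<cdot> i' = Id C A"
    by - (rule conflation_mono[OF assms(2)], use \<rho>a ar ar' c in \<open>auto simp: Hom_iff\<close>)
  let ?w = "Diff C pQ (i \<cdot> \<rho>)"
  have "?w \<cdot> i' = Zero C A Q" using ar ar' \<rho>a \<rho>i R(4) by simp
  then obtain k where k: "k \<in> Hom C B Q" "k \<cdot> pB = ?w"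
    using conflation_factor_cokernel[OF R(1), of ?w Q] ar ar' \<rho>a by (auto simp: Hom_iff)
  have ka: "k \<in> Arr C" "Dom C k = B" "Cod C k = Q" using k by (simp_all add: Hom_iff)
  have "h \<cdot> (k \<cdot> pB) = Diff C (h \<cdot> pQ) (j \<cdot> \<rho>)"
    using ar ar' \<rho>a by (simp add: k(2) hi)
  also have "\<dots> = pB"
    unfolding \<rho>(2)
  proof (rule DiffI)
    show "pB \<oplus> Diff C (h \<cdot> pQ) pB = h \<cdot> pQ"
      using Diff_Add[of "h \<cdot> pQ" pB] Add_commute[of pB R B "Diff C (h \<cdot> pQ) pB"] ar ar' by (simp add: Hom_iff)
  qed (use ar ar' in simp_all)
  finally have hk: "h \<cdot> k = Id C B"
    by - (rule conflation_epi[OF R(1)], use ka ar ar' d in \<open>auto simp: Hom_iff\<close>)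
  \<comment> \<open>So far \<open>k\<close> is a right inverse. Since
    \<open>h \<cdot> (k \<cdot> h) = h\<close>, the other identity follows once \<open>h\<close> is
    known to have zero kernel.\<close>
  have mono: "x = Zero C T Q" if x: "x \<in> Hom C T Q" "h \<cdot> x = Zero C T B" for x T
  proof -
    have T: "T \<in> Obj C" using x Hom_Obj by blast
    have "p \<cdot> x = q \<cdot> (h \<cdot> x)" using x(1) ar qh by (simp add: Hom_iff)
    then obtain y where y: "y \<in> Hom C T A" "i \<cdot> y = x"
      using conflation_factor_kernel[OF assms(1) x(1)] x ar T by auto
    then have "j \<cdot> y = j \<cdot> Zero C T A" using x(2) hi[of y] ar T c(7) by (simp add: Hom_iff)
    then have "y = Zero C T A"
      by - (rule conflation_mono[OF assms(2)], use y T c in \<open>auto simp: Hom_iff\<close>)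
    then show ?thesis using y ar T c by simp
  qed
  have "Diff C (k \<cdot> h) (Id C Q) = Zero C Q Q"
    by (rule mono) (use ka ar c Cmp_rewrite[OF hk] d in \<open>auto simp: Hom_iff\<close>)
  then have "k \<cdot> h = Id C Q"
    by (rule Diff_eq_Zero) (use ka ar c in \<open>auto simp: Hom_iff\<close>)
  then show ?thesis using that k hk by blast
qed

text \<open>The true pushout of \<open>i\<close> along \<open>a\<close> lies in a conflation from
  \<open>A\<close> to \<open>S\<close>. Its comparison map to \<open>B\<close> is the identity on
  both outer terms, hence invertible by \<open>conflation_map_iso\<close>, and the pushout property
  is transported along it.\<close>

lemma conflation_map_pushout:
  assumes "conflation C A' i B' p S" "conflation C A j B q S" "a \<in> Hom C A' A" "b \<in> Hom C B' B"
    "b \<cdot> i = j \<cdot> a" "q \<cdot> b = p"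
  shows "is_pushout C i a j b"
proof -
  note c = conflationD[OF assms(1)] and d = conflationD[OF assms(2)]
  obtain i' f' where po: "is_pushout C i a i' f'"
    using inflation_pushout[OF conflation_inflation[OF assms(1)], of a] assms c by (auto simp: Hom_iff)
  note e = pushoutD[OF po]
  have ar: "i \<in> Arr C" "p \<in> Arr C" "j \<in> Arr C" "q \<in> Arr C" "a \<in> Arr C" "b \<in> Arr C"
    "Dom C i = A'" "Cod C i = B'" "Dom C p = B'" "Cod C p = S" "Dom C j = A" "Cod C j = B"
    "Dom C q = B" "Cod C q = S" "Dom C a = A'" "Cod C a = A" "Dom C b = B'" "Cod C b = B"
    using c d assms by (simp_all add: Hom_iff)
  obtain p' where p': "conflation C A i' (Cod C i') p' S" "p' \<cdot> f' = p"
    using pushout_conflation[OF po assms(1)] ar by auto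
  note c' = conflationD[OF p'(1)]
  obtain h where h: "h \<in> Hom C (Cod C i') B" "h \<cdot> i' = j" "h \<cdot> f' = b"
    using pushout_factor[OF po, of j B b] ar assms(5) by (auto simp: Hom_iff)
  have "q \<cdot> h = p'"
    by (rule pushout_unique[OF po, of _ S])
      (use h ar e c' p' assms(6) d(6) in \<open>auto simp: Hom_iff\<close>)
  then obtain k where k: "k \<in> Hom C B (Cod C i')" "k \<cdot> h = Id C (Cod C i')" "h \<cdot> k = Id C B"
    using conflation_map_iso[OF p'(1) assms(2) h(1,2)] by metis
  have kj: "k \<cdot> j = i'" and kb: "k \<cdot> b = f'"
    using Cmp_rewrite[OF k(2), of i'] Cmp_rewrite[OF k(2), of f'] h k(1) e by (simp_all add: Hom_iff)
  show ?thesis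
  proof (rule pushoutI)
    show "j \<cdot> a = b \<cdot> i" using assms(5) by simp
    fix T u v assume *: "u \<in> Hom C A T" "v \<in> Hom C B' T" "u \<cdot> a = v \<cdot> i"
    then obtain x where x: "x \<in> Hom C (Cod C i') T" "x \<cdot> i' = u" "x \<cdot> f' = v"
      using pushout_factor[OF po, of u T v] ar by auto
    have "x \<cdot> k \<in> Hom C B T" "(x \<cdot> k) \<cdot> j = u" "(x \<cdot> k) \<cdot> b = v"
      using x k(1) ar kj kb by (simp_all add: Hom_iff)
    then show "\<exists>h. h \<in> Hom C B T \<and> h \<cdot> j = u \<and> h \<cdot> b = v" by blast
  next
    fix T x y assume *: "x \<in> Hom C B T" "y \<in> Hom C B T" "x \<cdot> j = y \<cdot> j" "x \<cdot> b = y \<cdot> b"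
    have "x \<cdot> h = y \<cdot> h"
      by (rule pushout_unique[OF po, of _ T]) (use * h ar e in \<open>auto simp: Hom_iff\<close>)
    then have "(x \<cdot> h) \<cdot> k = (y \<cdot> h) \<cdot> k" by simp
    then show "x = y" using k h(1) * by (simp add: Hom_iff)
  qed (use ar in \<open>simp_all add: Hom_iff\<close>)
qed

section \<open>Split conflations and the vanishing of Ext\<close>

lemma section_splitting:
  assumes "conflation C A i B p S" "s \<in> Hom C S B" "p \<cdot> s = Id C S"
  obtains r where "r \<in> Hom C B A" "r \<cdot> i = Id C A" "r \<cdot> s = Zero C S A" "(i \<cdot> r) \<oplus> (s \<cdot> p) = Id C B"
proof -
  note c = conflationD[OF assms(1)]
  have ar: "i \<in> Arr C" "p \<in> Arr C" "s \<in> Arr C"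
    "Dom C i = A" "Cod C i = B" "Dom C p = B" "Cod C p = S" "Dom C s = S" "Cod C s = B"
    using c assms by (simp_all add: Hom_iff)
  let ?d = "Diff C (Id C B) (s \<cdot> p)"
  note ps = Cmp_rewrite[OF assms(3)]
  have "p \<cdot> ?d = Zero C B S" using ar c by (simp add: ps)
  then obtain r where r: "r \<in> Hom C B A" "i \<cdot> r = ?d"
    using conflation_factor_kernel[OF assms(1), of ?d B] ar c by (auto simp: Hom_iff)
  have ra: "r \<in> Arr C" "Dom C r = B" "Cod C r = A" using r by (simp_all add: Hom_iff)
  note ir = Cmp_rewrite[OF r(2)]
  have "r \<cdot> i = Id C A"
    by (rule conflation_mono[OF assms(1)]) (use ra ar c ir in \<open>auto simp: Hom_iff\<close>)
  moreover have "r \<cdot> s = Zero C S A"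
    by (rule conflation_mono[OF assms(1)]) (use ra ar c ir assms(3) in \<open>auto simp: Hom_iff\<close>)
  moreover have "(i \<cdot> r) \<oplus> (s \<cdot> p) = Id C B"
    unfolding r(2) by (rule Diff_Add) (use ar c in auto)
  ultimately show ?thesis using that r by blast
qed

lemma retraction_section:
  assumes "conflation C A i B p S" "r \<in> Hom C B A" "r \<cdot> i = Id C A"
  obtains s where "s \<in> Hom C S B" "p \<cdot> s = Id C S" "r \<cdot> s = Zero C S A" "s \<cdot> p = Diff C (Id C B) (i \<cdot> r)"
proof -
  note c = conflationD[OF assms(1)]
  have ar: "i \<in> Arr C" "p \<in> Arr C" "r \<in> Arr C"
    "Dom C i = A" "Cod C i = B" "Dom C p = B" "Cod C p = S" "Dom C r = B" "Cod C r = A"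
    using c assms by (simp_all add: Hom_iff)
  let ?d = "Diff C (Id C B) (i \<cdot> r)"
  have "?d \<cdot> i = Zero C A B" using ar c assms(3) by simp
  then obtain s where s: "s \<in> Hom C S B" "s \<cdot> p = ?d"
    using conflation_factor_cokernel[OF assms(1), of ?d B] ar c by (auto simp: Hom_iff)
  have sa: "s \<in> Arr C" "Dom C s = S" "Cod C s = B" using s by (simp_all add: Hom_iff)
  have "p \<cdot> s = Id C S"
    by (rule conflation_epi[OF assms(1)])
      (use sa ar c s Cmp_rewrite[OF c(6)] in \<open>auto simp: Hom_iff\<close>)
  moreover have "r \<cdot> s = Zero C S A"
    by (rule conflation_epi[OF assms(1)])
      (use sa ar c s Cmp_rewrite[OF assms(3)] in \<open>auto simp: Hom_iff\<close>)
  ultimately show ?thesis using that s by blast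
qed

lemma section_direct_summand:
  assumes "conflation C A i B p S" "s \<in> Hom C S B" "p \<cdot> s = Id C S"
  shows "direct_summand C S B"
proof -
  note c = conflationD[OF assms(1)]
  obtain r where r: "r \<in> Hom C B A" "r \<cdot> i = Id C A" "r \<cdot> s = Zero C S A" "(i \<cdot> r) \<oplus> (s \<cdot> p) = Id C B"
    by (rule section_splitting[OF assms])
  have "(s \<cdot> p) \<oplus> (i \<cdot> r) = Id C B"
    using r(4) Add_commute[of "s \<cdot> p" B B "i \<cdot> r"] c assms r by (simp add: Hom_iff)
  then have "is_biproduct C S A B"
    unfolding is_biproduct_def using r assms c by blast
  then show ?thesis unfolding direct_summand_def using c by blast
qed

text \<open>Each middle term is the biproduct of \<open>Y\<close> and \<open>X\<close> through its
  own splitting; \<open>i' \<cdot> r \<oplus> s' \<cdot> p\<close> matches the two decompositions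
  and is invertible by \<open>conflation_map_iso\<close>.\<close>

lemma split_extensions_equiv:
  assumes "(i, p) \<in> split_extensions C X Y" "(i', p') \<in> split_extensions C X Y"
  shows "((i, p), (i', p')) \<in> ext_equiv C X Y"
proof -
  obtain Z s where Z: "conflation C Y i Z p X" "s \<in> Hom C X Z" "p \<cdot> s = Id C X"
    using assms unfolding split_extensions_def extensions_def conflation_def
    by (fastforce simp: Hom_iff)
  obtain Z' s' where Z': "conflation C Y i' Z' p' X" "s' \<in> Hom C X Z'" "p' \<cdot> s' = Id C X"
    using assms unfolding split_extensions_def extensions_def conflation_def
    by (fastforce simp: Hom_iff)
  note c = conflationD[OF Z(1)] and c' = conflationD[OF Z'(1)]
  obtain r where r: "r \<in> Hom C Z Y" "r \<cdot> i = Id C Y" "r \<cdot> s = Zero C X Y" "(i \<cdot> r) \<oplus> (s \<cdot> p) = Id C Z"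
    by (rule section_splitting[OF Z])
  have ar: "i \<in> Arr C" "p \<in> Arr C" "s \<in> Arr C" "r \<in> Arr C" "i' \<in> Arr C" "p' \<in> Arr C" "s' \<in> Arr C"
    "Dom C i = Y" "Cod C i = Z" "Dom C p = Z" "Cod C p = X" "Dom C s = X" "Cod C s = Z" "Dom C r = Z" "Cod C r = Y"
    "Dom C i' = Y" "Cod C i' = Z'" "Dom C p' = Z'" "Cod C p' = X" "Dom C s' = X" "Cod C s' = Z'"
    using c c' Z Z' r by (simp_all add: Hom_iff)
  let ?h = "(i' \<cdot> r) \<oplus> (s' \<cdot> p)"
  have h: "?h \<in> Hom C Z Z'" using ar by (simp add: Hom_iff)
  have hi: "?h \<cdot> i = i'" using ar r c c' by simp
  have ph: "p' \<cdot> ?h = p"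
    using ar c c' Cmp_rewrite[OF c'(6)] Cmp_rewrite[OF Z'(3)] by simp
  obtain k where k: "k \<in> Hom C Z' Z" "k \<cdot> ?h = Id C Z" "?h \<cdot> k = Id C Z'"
    by (rule conflation_map_iso[OF Z(1) Z'(1) h hi ph])
  have "is_iso C ?h" using is_isoI[OF h k] .
  then show ?thesis
    unfolding ext_equiv_def extensions_def using Z(1) Z'(1) h hi ph ar by auto
qed

lemma ext_equiv_refl:
  assumes "e \<in> extensions C X Y"
  shows "(e, e) \<in> ext_equiv C X Y"
proof -
  obtain i p Z where e: "e = (i, p)" "conflation C Y i Z p X"
    using assms unfolding extensions_def by auto
  note c = conflationD[OF e(2)]
  have "Id C Z \<in> Hom C (Cod C i) (Cod C i)" "Id C Z \<cdot> i = i" "p \<cdot> Id C Z = p"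
    using c(2,3,8) by (simp_all add: Hom_iff)
  then show ?thesis
    using assms is_iso_Id[OF c(8)] unfolding e(1) ext_equiv_def by blast
qed

lemma ext_equiv_split:
  assumes "(e, e') \<in> ext_equiv C X Y" "e \<in> split_extensions C X Y"
  shows "e' \<in> split_extensions C X Y"
proof -
  obtain i p i' p' h where *: "e = (i, p)" "e' = (i', p')" "e' \<in> extensions C X Y"
    "h \<in> Hom C (Cod C i) (Cod C i')" "p' \<cdot> h = p" "e \<in> extensions C X Y"
    using assms(1) unfolding ext_equiv_def by auto
  obtain s where s: "s \<in> Hom C X (Dom C p)" "p \<cdot> s = Id C X"
    using assms * unfolding split_extensions_def by auto
  have t: "Dom C p = Cod C i" "Dom C p' = Cod C i'" "p' \<in> Arr C"
    using * unfolding extensions_def conflation_def by (auto simp: Hom_iff)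
  have "h \<cdot> s \<in> Hom C X (Dom C p')" using s * t by (simp add: Hom_iff)
  moreover have "p' \<cdot> (h \<cdot> s) = Id C X"
    using s * t Cmp_rewrite[OF *(5)] by (simp add: Hom_iff)
  ultimately show ?thesis unfolding split_extensions_def using * by auto
qed

text \<open>The working form of vanishing, free of equivalence classes. It rests on the split
  extensions being exactly one class: any two are equivalent, and anything equivalent to a split
  extension splits.\<close>

lemma Ext1_vanishes_iff:
  assumes "X \<in> Obj C" "Y \<in> Obj C"
  shows "Ext1_vanishes C X Y \<longleftrightarrow> (\<forall>i Z p. conflation C Y i Z p X \<longrightarrow> (\<exists>s \<in> Hom C X Z. p \<cdot> s = Id C X))"
proof
  assume v: "Ext1_vanishes C X Y"
  show "\<forall>i Z p. conflation C Y i Z p X \<longrightarrow> (\<exists>s \<in> Hom C X Z. p \<cdot> s = Id C X)"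
  proof (intro allI impI)
    fix i Z p assume c: "conflation C Y i Z p X"
    then have e: "(i, p) \<in> extensions C X Y" unfolding extensions_def by auto
    then have "ext_equiv C X Y `` {(i, p)} \<in> Ext1 C X Y" unfolding Ext1_def by (rule quotientI)
    then have "(i, p) \<in> split_extensions C X Y"
      using v ext_equiv_refl[OF e] unfolding Ext1_vanishes_def by auto
    then show "\<exists>s \<in> Hom C X Z. p \<cdot> s = Id C X"
      using c unfolding split_extensions_def conflation_def by (auto simp: Hom_iff)
  qed
next
  assume "\<forall>i Z p. conflation C Y i Z p X \<longrightarrow> (\<exists>s \<in> Hom C X Z. p \<cdot> s = Id C X)"
  then have eq: "extensions C X Y = split_extensions C X Y"
    unfolding split_extensions_def extensions_def conflation_def by (fastforce simp: Hom_iff)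
  have cl: "ext_equiv C X Y `` {e} = split_extensions C X Y" if "e \<in> split_extensions C X Y" for e
    using that split_extensions_equiv ext_equiv_split[of e _ X Y] by (cases e) auto
  \<comment> \<open>The set of classes has to be a singleton and not empty, so one extension must be
    exhibited; the biproduct supplies it.\<close>
  obtain P i1 i2 p1 p2 where P: "i1 \<in> Hom C Y P" "i2 \<in> Hom C X P" "p1 \<in> Hom C P Y" "p2 \<in> Hom C P X"
     "p1 \<cdot> i1 = Id C Y" "p2 \<cdot> i2 = Id C X" "p2 \<cdot> i1 = Zero C Y X" "p1 \<cdot> i2 = Zero C X Y"
      "(i1 \<cdot> p1) \<oplus> (i2 \<cdot> p2) = Id C P"
    using biproduct_exists[OF assms(2,1)] unfolding is_biproduct_def by blast
  have "(i1, p2) \<in> extensions C X Y"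
    unfolding extensions_def using conflation_biproduct[OF P] by auto
  then show "Ext1_vanishes C X Y"
    unfolding Ext1_vanishes_def Ext1_def quotient_def eq using cl by auto
qed

text \<open>Push the conflation out along \<open>f\<close>. The result is an extension of
  \<open>S\<close> by \<open>T\<close>, so it splits, and its retraction composed with
  \<open>f'\<close> is the extension of \<open>f\<close>.\<close>

lemma Ext1_vanishes_extend:
  assumes "conflation C A j B c S" "Ext1_vanishes C S T" "f \<in> Hom C A T"
  obtains g where "g \<in> Hom C B T" "g \<cdot> j = f"
proof -
  note d = conflationD[OF assms(1)]
  have T: "T \<in> Obj C" using assms Hom_Obj by blast
  obtain j' f' where po: "is_pushout C j f j' f'"
    using inflation_pushout[OF conflation_inflation[OF assms(1)], of f] assms d by (auto simp: Hom_iff)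
  note e = pushoutD[OF po]
  obtain p' where p': "conflation C T j' (Cod C j') p' S"
    using pushout_conflation[OF po assms(1)] assms by (auto simp: Hom_iff)
  obtain s where s: "s \<in> Hom C S (Cod C j')" "p' \<cdot> s = Id C S"
    using assms(2) p' unfolding Ext1_vanishes_iff[OF d(9) T] by blast
  obtain r where r: "r \<in> Hom C (Cod C j') T" "r \<cdot> j' = Id C T"
    by (rule section_splitting[OF p' s]) (use that in blast)
  have "(r \<cdot> f') \<cdot> j = (r \<cdot> j') \<cdot> f" using e r(1) by (simp add: Hom_iff)
  then have "(r \<cdot> f') \<cdot> j = f" using r assms by (simp add: Hom_iff)
  moreover have "r \<cdot> f' \<in> Hom C B T" using r e d by (simp add: Hom_iff)
  ultimately show ?thesis using that by blast
qed

text \<open>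
  After pulling \<open>q\<close> back to \<open>B\<close>, the lift \<open>a\<close> of \<open>j\<close> splits the preimage \<open>K\<close> of \<open>A\<close> as \<open>T \<oplus> A\<close>. The
  projection \<open>\<phi>\<close> to \<open>T\<close> extends along \<open>K \<rightarrow> ZB\<close>, whose cokernel is \<open>S\<close>, and the extension is a
  retraction that vanishes on \<open>a\<close>; the section belonging to it extends \<open>a\<close>.
\<close>

lemma conflation_lifts:
  assumes j: "conflation C A j B c S" and q: "conflation C T t Z q X" and v: "Ext1_vanishes C S T"
  shows "lifts C j q"
  unfolding lifts_def
proof (intro ballI impI)
  fix u v
  assume "u \<in> Hom C (Dom C j) (Dom C q)" "v \<in> Hom C (Cod C j) (Cod C q)" and quvj: "q \<cdot> u = v \<cdot> j"
  note cj = conflationD[OF j] and cq = conflationD[OF q]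
  then have u: "u \<in> Hom C A Z" and v: "v \<in> Hom C B X"
    using \<open>u \<in> Hom C (Dom C j) (Dom C q)\<close> \<open>v \<in> Hom C (Cod C j) (Cod C q)\<close> by (simp_all add: Hom_iff)
  have ar: "j \<in> Arr C" "c \<in> Arr C" "t \<in> Arr C" "q \<in> Arr C" "u \<in> Arr C" "v \<in> Arr C"
    "Dom C j = A" "Cod C j = B" "Dom C c = B" "Cod C c = S" "Dom C t = T" "Cod C t = Z" "Dom C q = Z" "Cod C q = X"
    "Dom C u = A" "Cod C u = Z" "Dom C v = B" "Cod C v = X"
    using cj cq u v by (simp_all add: Hom_iff)
  note ob = cj(7-9) cq(7-9)
  obtain ZB t' q' v' where ZB: "conflation C T t' ZB q' B" and pb: "is_pullback C q v q' v'"
    and v': "v' \<in> Hom C ZB Z" "v' \<cdot> t' = t" "q \<cdot> v' = v \<cdot> q'"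
    by (rule pullback_conflation[OF q v])
  note cZ = conflationD[OF ZB]
  have ar2: "t' \<in> Arr C" "q' \<in> Arr C" "v' \<in> Arr C" "Dom C t' = T" "Cod C t' = ZB" "Dom C q' = ZB" "Cod C q' = B"
    "Dom C v' = ZB" "Cod C v' = Z"
    using cZ v' by (simp_all add: Hom_iff)
  obtain a where a: "a \<in> Hom C A ZB" "q' \<cdot> a = j" "v' \<cdot> a = u"
    using pullback_factor[OF pb, of j A u] ar ar2 quvj by (auto simp: Hom_iff)
  \<comment> \<open>The preimage of \<open>A\<close> is realised as the kernel of
    \<open>c \<cdot> q'\<close>, which exists because deflations compose. This makes its inclusion
    \<open>k\<close> an inflation with cokernel \<open>S\<close>, along which maps to
    \<open>T\<close> extend.\<close>
  have "c \<cdot> q' \<in> Deflations C"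
    using deflation_Cmp[OF conflation_deflation[OF ZB] conflation_deflation[OF j]] ar ar2 by simp
  then obtain k K where k: "conflation C K k ZB (c \<cdot> q') S"
    by (rule deflation_conflation[of "c \<cdot> q'" ZB S]) (use ar ar2 in \<open>simp_all add: Hom_iff\<close>)
  note ck = conflationD[OF k]
  have ar3: "a \<in> Arr C" "Dom C a = A" "Cod C a = ZB" "k \<in> Arr C" "Dom C k = K" "Cod C k = ZB"
    using a ck by (simp_all add: Hom_iff)
  note obk = ck(7,8)
  have "c \<cdot> (q' \<cdot> k) = Zero C K S" using ck(6) ar ar2 ar3 by simp
  then obtain e where e: "e \<in> Hom C K A" "j \<cdot> e = q' \<cdot> k"
    using conflation_factor_kernel[OF j, of "q' \<cdot> k" K] ar ar2 ar3 by (auto simp: Hom_iff)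
  have "(c \<cdot> q') \<cdot> a = Zero C A S" using ar ar2 ar3 a cj(6) by simp
  then obtain a' where a': "a' \<in> Hom C A K" "k \<cdot> a' = a"
    using conflation_factor_kernel[OF k a(1)] by auto
  have "(c \<cdot> q') \<cdot> t' = Zero C T S" using ar ar2 cZ(6) ob by simp
  then obtain t'' where t'': "t'' \<in> Hom C T K" "k \<cdot> t'' = t'"
    using conflation_factor_kernel[OF k cZ(2)] by auto
  have ar4: "e \<in> Arr C" "Dom C e = K" "Cod C e = A" "a' \<in> Arr C" "Dom C a' = A" "Cod C a' = K"
    "t'' \<in> Arr C" "Dom C t'' = T" "Cod C t'' = K"
    using e a' t'' by (simp_all add: Hom_iff)
  note rw = Cmp_rewrite[OF a(2)] Cmp_rewrite[OF e(2)] Cmp_rewrite[OF a'(2)] Cmp_rewrite[OF t''(2)]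
  note A = ar ar2 ar3 ar4 ob obk
  \<comment> \<open>\<open>e\<close> sends \<open>K\<close> to \<open>A\<close> and \<open>a\<close>
    brings it back. What is lost on the way is killed by \<open>q'\<close>, hence lies in
    \<open>T\<close>; this is the projection \<open>\<phi>\<close>.\<close>
  let ?D = "Diff C k (a \<cdot> e)"
  have "q' \<cdot> ?D = Zero C K B" using A by (simp add: rw e(2))
  then obtain \<phi> where \<phi>: "\<phi> \<in> Hom C K T" "t' \<cdot> \<phi> = ?D"
    using conflation_factor_kernel[OF ZB, of ?D K] A by (auto simp: Hom_iff)
  have \<phi>a: "\<phi> \<in> Arr C" "Dom C \<phi> = K" "Cod C \<phi> = T" using \<phi> by (simp_all add: Hom_iff)
  have et: "e \<cdot> t'' = Zero C T A"
    by (rule conflation_mono[OF j]) (use A cZ(6) t'' in \<open>auto simp: Hom_iff rw\<close>)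
  have ea: "e \<cdot> a' = Id C A"
    by (rule conflation_mono[OF j]) (use A a a' in \<open>auto simp: Hom_iff rw\<close>)
  have \<phi>t: "\<phi> \<cdot> t'' = Id C T"
    by (rule conflation_mono[OF ZB]) (use A \<phi>a t'' in \<open>auto simp: Hom_iff Cmp_rewrite[OF \<phi>(2)] et\<close>)
  have \<phi>a': "\<phi> \<cdot> a' = Zero C A T"
    by (rule conflation_mono[OF ZB]) (use A \<phi>a a' in \<open>auto simp: Hom_iff Cmp_rewrite[OF \<phi>(2)] ea\<close>)
  obtain r where r: "r \<in> Hom C ZB T" "r \<cdot> k = \<phi>"
    by (rule Ext1_vanishes_extend[OF k \<open>Ext1_vanishes C S T\<close> \<phi>(1)])
  have ra: "r \<in> Arr C" "Dom C r = ZB" "Cod C r = T" using r by (simp_all add: Hom_iff)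
  have rt: "r \<cdot> t' = Id C T" using Cmp_rewrite[OF r(2), of t''] A ra t''(2) \<phi>t by simp
  have rA: "r \<cdot> a = Zero C A T" using Cmp_rewrite[OF r(2), of a'] A ra a'(2) \<phi>a' by simp
  obtain s where s: "s \<in> Hom C B ZB" "q' \<cdot> s = Id C B" "s \<cdot> q' = Diff C (Id C ZB) (t' \<cdot> r)"
    by (rule retraction_section[OF ZB r(1) rt]) (use that in blast)
  have sa: "s \<in> Arr C" "Dom C s = B" "Cod C s = ZB" using s by (simp_all add: Hom_iff)
  have "s \<cdot> j = (s \<cdot> q') \<cdot> a" using sa A a by simp
  also have "\<dots> = a" unfolding s(3) using A ra rA by simp
  finally have "s \<cdot> j = a" .
  then have "(v' \<cdot> s) \<cdot> j = u" using A sa a by simp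
  moreover have "q \<cdot> (v' \<cdot> s) = v" using A sa s(2) Cmp_rewrite[OF v'(3), of s] by simp
  moreover have "v' \<cdot> s \<in> Hom C B Z" using A sa by (simp add: Hom_iff)
  ultimately show "\<exists>l \<in> Hom C (Cod C j) (Dom C q). l \<cdot> j = u \<and> q \<cdot> l = v" using ar by auto
qed

end

section \<open>Well-orders\<close>

lemma Well_orderD:
  assumes "Well_order r"
  shows "(a, b) \<in> r \<Longrightarrow> a \<in> Field r" "(a, b) \<in> r \<Longrightarrow> b \<in> Field r"
    "a \<in> Field r \<Longrightarrow> (a, a) \<in> r" "(a, b) \<in> r \<Longrightarrow> (b, c) \<in> r \<Longrightarrow> (a, c) \<in> r"
    "(a, b) \<in> r \<Longrightarrow> (b, a) \<in> r \<Longrightarrow> a = b"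
    "a \<in> Field r \<Longrightarrow> b \<in> Field r \<Longrightarrow> (a, b) \<in> r \<or> (b, a) \<in> r"
proof -
  have r: "refl_on (Field r) r" "trans r" "antisym r" "total_on (Field r) r"
    using assms unfolding well_order_on_def linear_order_on_def partial_order_on_def preorder_on_def by auto
  show "(a, b) \<in> r \<Longrightarrow> a \<in> Field r" "(a, b) \<in> r \<Longrightarrow> b \<in> Field r"
    by (simp_all add: FieldI1 FieldI2)
  show re: "a \<in> Field r \<Longrightarrow> (a, a) \<in> r" for a using r(1) by (rule refl_onD)
  show "(a, b) \<in> r \<Longrightarrow> (b, c) \<in> r \<Longrightarrow> (a, c) \<in> r" using r(2) by (rule transD)
  show "(a, b) \<in> r \<Longrightarrow> (b, a) \<in> r \<Longrightarrow> a = b" using r(3) by (rule antisymD)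
  show "a \<in> Field r \<Longrightarrow> b \<in> Field r \<Longrightarrow> (a, b) \<in> r \<or> (b, a) \<in> r"
    using r(4) re unfolding total_on_def by (cases "a = b") auto
qed

lemma Well_order_wf: "Well_order r \<Longrightarrow> wf (r - Relation.Id)"
  by (simp add: well_order_on_def)

lemma ord_less_trans: "Well_order r \<Longrightarrow> ord_less r a b \<Longrightarrow> ord_less r b c \<Longrightarrow> ord_less r a c"
  unfolding ord_less_def using Well_orderD(4,5) by metis

lemma ord_less_le_trans: "Well_order r \<Longrightarrow> ord_less r a b \<Longrightarrow> (b, c) \<in> r \<Longrightarrow> ord_less r a c"
  unfolding ord_less_def using Well_orderD(4,5) by metis

lemma ord_le_less_trans: "Well_order r \<Longrightarrow> (a, b) \<in> r \<Longrightarrow> ord_less r b c \<Longrightarrow> ord_less r a c"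
  unfolding ord_less_def using Well_orderD(4,5) by metis

lemma ord_less_Field: "ord_less r a b \<Longrightarrow> a \<in> Field r \<and> b \<in> Field r"
  unfolding ord_less_def by (auto simp: FieldI1 FieldI2)

lemma ord_not_le: "Well_order r \<Longrightarrow> a \<in> Field r \<Longrightarrow> b \<in> Field r \<Longrightarrow> (a, b) \<notin> r \<longleftrightarrow> ord_less r b a"
  unfolding ord_less_def using Well_orderD by metis

lemma underS_iff: "a \<in> underS r b \<longleftrightarrow> ord_less r a b"
  unfolding underS_def ord_less_def by auto

lemma is_leastD: "Well_order r \<Longrightarrow> is_least r z \<Longrightarrow> a \<in> Field r \<Longrightarrow> (z, a) \<in> r"
  unfolding is_least_def using underS_iff[of a r z] ord_not_le[of r z a] by auto

lemma is_leastI: "Well_order r \<Longrightarrow> z \<in> Field r \<Longrightarrow> (\<And>a. a \<in> Field r \<Longrightarrow> (z, a) \<in> r) \<Longrightarrow> is_least r z"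
  unfolding is_least_def using Well_orderD(5)[of r] underS_iff[of _ r z]
  by (auto simp: ord_less_def FieldI1)

lemma is_least_unique: "Well_order r \<Longrightarrow> is_least r z \<Longrightarrow> is_least r y \<Longrightarrow> z = y"
  using is_leastD[of r] Well_orderD(5)[of r] unfolding is_least_def by blast

lemma least_successor_limit:
  "a \<in> Field r \<Longrightarrow> is_least r a \<or> (\<exists>b. is_successor r b a) \<or> is_limit r a"
  unfolding is_limit_def by blast

lemma is_successor_less: "is_successor r a b \<Longrightarrow> ord_less r a b"
  unfolding is_successor_def by simp

lemma is_successor_le: "Well_order r \<Longrightarrow> is_successor r a b \<Longrightarrow> ord_less r c b \<Longrightarrow> (c, a) \<in> r"
  unfolding is_successor_def using ord_not_le[of r c a] ord_less_Field by metis

lemma is_successor_unique: "Well_order r \<Longrightarrow> is_successor r a b \<Longrightarrow> is_successor r a' b \<Longrightarrow> a = a'"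
  using is_successor_le is_successor_less Well_orderD(5) by metis

lemma successor_exists:
  assumes "Well_order r" "ord_less r a b"
  obtains c where "is_successor r a c" "(c, b) \<in> r"
proof -
  let ?A = "{c. ord_less r a c}"
  have b: "b \<in> ?A" using assms(2) by simp
  obtain c where c: "c \<in> ?A" "\<And>y. (y, c) \<in> r - Relation.Id \<Longrightarrow> y \<notin> ?A"
    by (rule wfE_min[OF Well_order_wf[OF assms(1)] b]) blast
  have "is_successor r a c" using c unfolding is_successor_def ord_less_def by auto
  moreover have "(c, b) \<in> r"
    using c(2)[of b] b c(1) ord_not_le[OF assms(1), of c b] ord_less_Field[of r a] unfolding ord_less_def by auto
  ultimately show ?thesis using that by blast
qed

lemma is_limit_successor:
  assumes "Well_order r" "is_limit r g" "ord_less r a g"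
  obtains b where "is_successor r a b" "ord_less r b g"
  using successor_exists[OF assms(1,3)] assms(2) unfolding is_limit_def ord_less_def by metis

text \<open>Convexity guarantees that successors in \<open>Restr r A\<close> are successors in
  \<open>r\<close>; a subset with gaps would create new ones.\<close>

definition convex_in :: "'u rel \<Rightarrow> 'u set \<Rightarrow> bool" where
  "convex_in r A \<longleftrightarrow> A \<subseteq> Field r \<and> (\<forall>a \<in> A. \<forall>c \<in> A. \<forall>b. (a, b) \<in> r \<and> (b, c) \<in> r \<longrightarrow> b \<in> A)"

lemma Field_Restr':
  assumes "Well_order r" "A \<subseteq> Field r"
  shows "Field (Restr r A) = A"
proof -
  have "a \<in> Field (Restr r A)" if "a \<in> A" for a
    using Well_orderD(3)[OF assms(1), of a] assms(2) that by (intro FieldI1[of a a]) blast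
  then show ?thesis by (auto simp: Field_def)
qed

lemma ord_less_Restr: "ord_less (Restr r A) a b \<longleftrightarrow> a \<in> A \<and> b \<in> A \<and> ord_less r a b"
  unfolding ord_less_def by auto

lemma underS_Restr: "g \<in> A \<Longrightarrow> underS (Restr r A) g = underS r g \<inter> A"
  unfolding underS_def by auto

lemma is_least_Restr:
  assumes "Well_order r" "A \<subseteq> Field r"
  shows "is_least (Restr r A) z \<longleftrightarrow> z \<in> A \<and> (\<forall>a \<in> A. (z, a) \<in> r)"
  using is_leastD[OF Well_order_Restr[OF assms(1)], of A z]
    is_leastI[OF Well_order_Restr[OF assms(1)], of z A]
  unfolding Field_Restr'[OF assms] by (auto simp: is_least_def Field_Restr'[OF assms])

lemma is_successor_Restr:
  assumes "Well_order r" "convex_in r A"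
  shows "is_successor (Restr r A) a b \<longleftrightarrow> a \<in> A \<and> b \<in> A \<and> is_successor r a b"
  using assms(2) unfolding is_successor_def ord_less_Restr convex_in_def ord_less_def by blast

text \<open>A limit of \<open>r\<close> that is the first element of \<open>A\<close> turns into the
  least element of the restriction; the last conjunct excludes it.\<close>

lemma is_limit_Restr:
  assumes "Well_order r" "convex_in r A"
  shows "is_limit (Restr r A) g \<longleftrightarrow> g \<in> A \<and> is_limit r g \<and> (\<exists>a \<in> A. ord_less r a g)"
proof
  have A: "A \<subseteq> Field r" using assms(2) unfolding convex_in_def by simp
  note F = Field_Restr'[OF assms(1) A] and s = is_successor_Restr[OF assms]
  {
    assume l: "is_limit (Restr r A) g"
    then have g: "g \<in> A" "\<not> is_least (Restr r A) g" "\<not> (\<exists>a \<in> A. is_successor r a g)"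
      unfolding is_limit_def s F by auto
    then obtain a where a: "a \<in> A" "ord_less r a g"
      unfolding is_least_Restr[OF assms(1) A] using ord_not_le[OF assms(1)] A by blast
    have "\<not> is_successor r b g" for b
    proof
      assume b: "is_successor r b g"
      have "b \<in> A"
        using is_successor_le[OF assms(1) b a(2)] is_successor_less[OF b] a(1) g(1) assms(2)
        unfolding convex_in_def ord_less_def by blast
      then show False using g b by blast
    qed
    moreover have "\<not> is_least r g" using a(2) unfolding is_least_def using underS_iff[of a r g] by auto
    ultimately show "g \<in> A \<and> is_limit r g \<and> (\<exists>a \<in> A. ord_less r a g)"
      using a g A unfolding is_limit_def by blast
  next
    assume "g \<in> A \<and> is_limit r g \<and> (\<exists>a \<in> A. ord_less r a g)"
    then obtain a where *: "g \<in> A" "is_limit r g" "a \<in> A" "ord_less r a g" by blast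
    have "\<not> is_least (Restr r A) g"
      unfolding is_least_Restr[OF assms(1) A] using * Well_orderD(5)[OF assms(1)] unfolding ord_less_def by blast
    then show "is_limit (Restr r A) g" using * unfolding is_limit_def s F by blast
  }
qed

section \<open>Direct systems and lifting properties\<close>

text \<open>Systems carry no meaningful value \<open>i a a\<close>, so the identities have to be supplied.\<close>

definition tr :: "('o, 'm, 'z) cat_data_scheme \<Rightarrow> ('u \<Rightarrow> 'o) \<Rightarrow> ('u \<Rightarrow> 'u \<Rightarrow> 'm) \<Rightarrow> 'u \<Rightarrow> 'u \<Rightarrow> 'm" where
  "tr C X i a b = (if a = b then Id C (X a) else i a b)"

text \<open>The smallness of the index set is split off from \<open>transfinite_seq\<close>, because
  the constructions run along tails of \<open>|U|\<close>, which are not small.\<close>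

definition chain :: "('o, 'm, 'z) cat_data_scheme \<Rightarrow> 'u rel \<Rightarrow> ('u \<Rightarrow> 'o) \<Rightarrow> ('u \<Rightarrow> 'u \<Rightarrow> 'm) \<Rightarrow> bool" where
  "chain C r X i \<longleftrightarrow> Well_order r \<and> direct_system C r X i \<and>
     (\<forall>g. is_limit r g \<longrightarrow> is_colimit C r (underS r g) X i (X g) (\<lambda>a. i a g))"

lemma transfinite_seq_iff: "transfinite_seq U C r X i \<longleftrightarrow> chain C r X i \<and> small U (Field r)"
  unfolding transfinite_seq_def chain_def by auto

lemma is_cocone_Restr:
  "B \<subseteq> A \<Longrightarrow> is_cocone C (Restr r A) B X i L c \<longleftrightarrow> is_cocone C r B X i L c"
  unfolding is_cocone_def ord_less_Restr by blast

lemma is_colimit_Restr: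
  "B \<subseteq> A \<Longrightarrow> is_colimit C (Restr r A) B X i L c \<longleftrightarrow> is_colimit C r B X i L c"
  unfolding is_colimit_def by (simp add: is_cocone_Restr)

lemma is_cocone_cong:
  assumes "\<And>a. a \<in> A \<Longrightarrow> X a = X' a" "\<And>a b. a \<in> A \<Longrightarrow> b \<in> A \<Longrightarrow> ord_less r a b \<Longrightarrow> i a b = i' a b"
    "\<And>a. a \<in> A \<Longrightarrow> c a = c' a"
  shows "is_cocone C r A X i L c \<longleftrightarrow> is_cocone C r A X' i' L c'"
  unfolding is_cocone_def
  by (intro conj_cong ball_cong imp_cong refl) (simp_all add: assms)

lemma is_colimit_cong:
  assumes "\<And>a. a \<in> A \<Longrightarrow> X a = X' a" "\<And>a b. a \<in> A \<Longrightarrow> b \<in> A \<Longrightarrow> ord_less r a b \<Longrightarrow> i a b = i' a b"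
    "\<And>a. a \<in> A \<Longrightarrow> c a = c' a"
  shows "is_colimit C r A X i L c \<longleftrightarrow> is_colimit C r A X' i' L c'"
proof -
  have "is_cocone C r A X i L c \<longleftrightarrow> is_cocone C r A X' i' L c'"
    by (rule is_cocone_cong) (use assms in auto)
  moreover have "is_cocone C r A X i T d \<longleftrightarrow> is_cocone C r A X' i' T d" for T d
    by (rule is_cocone_cong) (use assms in auto)
  moreover have "(\<forall>a \<in> A. h \<cdot>\<^bsub>C\<^esub> c a = d a) \<longleftrightarrow> (\<forall>a \<in> A. h \<cdot>\<^bsub>C\<^esub> c' a = d a)" for h d
    using assms(3) by auto
  ultimately show ?thesis unfolding is_colimit_def by simp
qed

section \<open>Cocones, colimits and restriction of chains\<close>

context category
begin

lemma direct_systemD: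
  assumes "direct_system C r X i"
  shows "a \<in> Field r \<Longrightarrow> X a \<in> Obj C" "ord_less r a b \<Longrightarrow> i a b \<in> Hom C (X a) (X b)"
    "ord_less r a b \<Longrightarrow> ord_less r b c \<Longrightarrow> i b c \<cdot> i a b = i a c"
  using assms unfolding direct_system_def by auto

lemma tr_Hom: "direct_system C r X i \<Longrightarrow> (a, b) \<in> r \<Longrightarrow> tr C X i a b \<in> Hom C (X a) (X b)"
  using direct_systemD[of r X i] unfolding tr_def ord_less_def by (auto simp: Id_Hom FieldI1)

lemma tr_tr:
  assumes "direct_system C r X i" "(a, b) \<in> r" "(b, c) \<in> r" "antisym r"
  shows "tr C X i b c \<cdot> tr C X i a b = tr C X i a c"
proof (cases "a = b \<or> b = c")
  case True
  then show ?thesis using tr_Hom[OF assms(1,2)] tr_Hom[OF assms(1,3)] by (auto simp: tr_def Hom_iff Dom_Obj Cod_Obj)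
next
  case False
  moreover have "a \<noteq> c" using False assms unfolding antisym_def by blast
  ultimately show ?thesis using direct_systemD(3)[OF assms(1), of a b c] assms unfolding tr_def ord_less_def by auto
qed

lemma Well_order_antisym: "Well_order r \<Longrightarrow> antisym r"
  unfolding well_order_on_def linear_order_on_def partial_order_on_def by simp

lemma chainD:
  assumes "chain C r X i"
  shows "Well_order r" "direct_system C r X i"
    "is_limit r g \<Longrightarrow> is_colimit C r (underS r g) X i (X g) (\<lambda>a. i a g)"
    "a \<in> Field r \<Longrightarrow> X a \<in> Obj C" "ord_less r a b \<Longrightarrow> i a b \<in> Hom C (X a) (X b)"
    "ord_less r a b \<Longrightarrow> ord_less r b c \<Longrightarrow> i b c \<cdot> i a b = i a c"
    "(a, b) \<in> r \<Longrightarrow> tr C X i a b \<in> Hom C (X a) (X b)"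
    "(a, b) \<in> r \<Longrightarrow> (b, c) \<in> r \<Longrightarrow> tr C X i b c \<cdot> tr C X i a b = tr C X i a c"
  using assms direct_systemD[of r X i] tr_Hom[of r X i] tr_tr[of r X i] Well_order_antisym[of r]
  unfolding chain_def by auto

lemma coconeD:
  assumes "is_cocone C r A X i L c"
  shows "L \<in> Obj C" "a \<in> A \<Longrightarrow> c a \<in> Hom C (X a) L"
    "a \<in> A \<Longrightarrow> b \<in> A \<Longrightarrow> ord_less r a b \<Longrightarrow> c b \<cdot> i a b = c a"
  using assms unfolding is_cocone_def by auto

lemma cocone_tr:
  assumes "is_cocone C r A X i L c" "a \<in> A" "b \<in> A" "(a, b) \<in> r"
  shows "c b \<cdot> tr C X i a b = c a"
  using coconeD[OF assms(1)] assms(2-4) unfolding tr_def ord_less_def by (auto simp: Hom_iff)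

lemma colimit_cocone: "is_colimit C r A X i L c \<Longrightarrow> is_cocone C r A X i L c"
  unfolding is_colimit_def by simp

lemma colimit_factor:
  assumes "is_colimit C r A X i L c" "is_cocone C r A X i T d"
  obtains h where "h \<in> Hom C L T" "\<And>a. a \<in> A \<Longrightarrow> h \<cdot> c a = d a"
  using assms unfolding is_colimit_def by metis

lemma cocone_Cmp:
  assumes "is_cocone C r A X i L c" "h \<in> Hom C L T" "direct_system C r X i"
  shows "is_cocone C r A X i T (\<lambda>a. h \<cdot> c a)"
  unfolding is_cocone_def
proof (intro conjI ballI impI)
  show "T \<in> Obj C" using assms Hom_Obj by blast
  show "h \<cdot> c a \<in> Hom C (X a) T" if "a \<in> A" for a
    using coconeD(2)[OF assms(1) that] assms(2) by (simp add: Hom_iff)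
  show "(h \<cdot> c b) \<cdot> i a b = h \<cdot> c a" if "a \<in> A" "b \<in> A" "ord_less r a b" for a b
    using coconeD(2)[OF assms(1) that(1)] coconeD(2)[OF assms(1) that(2)] coconeD(3)[OF assms(1) that]
      direct_systemD(2)[OF assms(3) that(3)] assms(2) by (simp add: Hom_iff)
qed

lemma colimit_unique:
  assumes "is_colimit C r A X i L c" "direct_system C r X i" "h \<in> Hom C L T" "k \<in> Hom C L T"
    "\<And>a. a \<in> A \<Longrightarrow> h \<cdot> c a = k \<cdot> c a"
  shows "h = k"
proof -
  have "is_cocone C r A X i T (\<lambda>a. h \<cdot> c a)"
    by (rule cocone_Cmp[OF colimit_cocone[OF assms(1)] assms(3,2)])
  then have "\<exists>!x. x \<in> Hom C L T \<and> (\<forall>a \<in> A. x \<cdot> c a = h \<cdot> c a)"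
    using assms(1) unfolding is_colimit_def by blast
  then show ?thesis using assms by metis
qed

lemma colimitI:
  assumes "is_cocone C r A X i L c"
    "\<And>T d. is_cocone C r A X i T d \<Longrightarrow> \<exists>h. h \<in> Hom C L T \<and> (\<forall>a \<in> A. h \<cdot> c a = d a)"
    "\<And>T h k. \<lbrakk>h \<in> Hom C L T; k \<in> Hom C L T; \<And>a. a \<in> A \<Longrightarrow> h \<cdot> c a = k \<cdot> c a\<rbrakk> \<Longrightarrow> h = k"
  shows "is_colimit C r A X i L c"
  unfolding is_colimit_def
proof (intro conjI allI impI)
  fix T d assume "is_cocone C r A X i T d"
  then obtain h where "h \<in> Hom C L T \<and> (\<forall>a \<in> A. h \<cdot> c a = d a)" using assms(2) by blast
  then show "\<exists>!h. h \<in> Hom C L T \<and> (\<forall>a \<in> A. h \<cdot> c a = d a)" using assms(3) by metis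
qed (rule assms(1))

lemma cocone_subset: "is_cocone C r A X i L c \<Longrightarrow> B \<subseteq> A \<Longrightarrow> is_cocone C r B X i L c"
  unfolding is_cocone_def by blast

text \<open>Cocones on \<open>B\<close> and on \<open>A\<close> correspond to each other: a cocone
  on \<open>B\<close> is continued to \<open>a\<close> by moving on to a later index in
  \<open>B\<close>, and a map out of \<open>L\<close> is determined by its values on
  \<open>B\<close>.\<close>

lemma colimit_cofinal:
  assumes wo: "Well_order r" and ds: "direct_system C r X i" and A: "A \<subseteq> Field r"
    and c: "is_cocone C r A X i L c" and B: "B \<subseteq> A" "\<And>a. a \<in> A \<Longrightarrow> \<exists>b \<in> B. (a, b) \<in> r"
  shows "is_colimit C r B X i L c \<longleftrightarrow> is_colimit C r A X i L c"
proof
  assume l: "is_colimit C r B X i L c"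
  show "is_colimit C r A X i L c"
  proof (rule colimitI[OF c])
    fix T d assume d: "is_cocone C r A X i T d"
    obtain h where h: "h \<in> Hom C L T" "\<And>a. a \<in> B \<Longrightarrow> h \<cdot> c a = d a"
      by (rule colimit_factor[OF l cocone_subset[OF d B(1)]]) blast
    have "h \<cdot> c a = d a" if a: "a \<in> A" for a
    proof -
      obtain b where b: "b \<in> B" "(a, b) \<in> r" using B(2) a by blast
      have bA: "b \<in> A" using b B by blast
      have "h \<cdot> c a = h \<cdot> (c b \<cdot> tr C X i a b)" using cocone_tr[OF c a bA b(2)] by simp
      also have "\<dots> = (h \<cdot> c b) \<cdot> tr C X i a b"
        using h(1) coconeD(2)[OF c bA] tr_Hom[OF ds b(2)] by (simp add: Hom_iff)
      also have "\<dots> = d a" using h(2)[OF b(1)] cocone_tr[OF d a bA b(2)] by simp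
      finally show ?thesis .
    qed
    then show "\<exists>h. h \<in> Hom C L T \<and> (\<forall>a \<in> A. h \<cdot> c a = d a)" using h by blast
  next
    fix T h k assume "h \<in> Hom C L T" "k \<in> Hom C L T" "\<And>a. a \<in> A \<Longrightarrow> h \<cdot> c a = k \<cdot> c a"
    then show "h = k" using colimit_unique[OF l ds] B(1) by blast
  qed
next
  assume l: "is_colimit C r A X i L c"
  show "is_colimit C r B X i L c"
  proof (rule colimitI[OF cocone_subset[OF c B(1)]])
    fix T d assume d: "is_cocone C r B X i T d"
    define \<beta> where "\<beta> a = (SOME b. b \<in> B \<and> (a, b) \<in> r)" for a
    have \<beta>: "\<beta> a \<in> B" "(a, \<beta> a) \<in> r" if "a \<in> A" for a
      using someI_ex[of "\<lambda>b. b \<in> B \<and> (a, b) \<in> r"] B(2)[OF that] unfolding \<beta>_def by blast+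
    \<comment> \<open>The chosen bound \<open>\<beta> a\<close> does not matter: two bounds are
      comparable, and the cocone equation for \<open>d\<close> links their values.\<close>
    define e where "e a = d (\<beta> a) \<cdot> tr C X i a (\<beta> a)" for a
    have e: "e a = d b \<cdot> tr C X i a b" if "a \<in> A" "b \<in> B" "(a, b) \<in> r" for a b
    proof -
      have *: "d b' \<cdot> tr C X i a b' = d b \<cdot> tr C X i a b"
        if "a \<in> A" "b \<in> B" "(a, b) \<in> r" "b' \<in> B" "(b, b') \<in> r" for b b'
      proof -
        have "d b' \<cdot> tr C X i a b' = d b' \<cdot> (tr C X i b b' \<cdot> tr C X i a b)"
          using tr_tr[OF ds that(3,5) Well_order_antisym[OF wo]] by simp
        also have "\<dots> = (d b' \<cdot> tr C X i b b') \<cdot> tr C X i a b"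
          using coconeD(2)[OF d that(4)] tr_Hom[OF ds that(3)] tr_Hom[OF ds that(5)] by (simp add: Hom_iff)
        also have "\<dots> = d b \<cdot> tr C X i a b" using cocone_tr[OF d that(2,4,5)] by simp
        finally show ?thesis .
      qed
      have "(b, \<beta> a) \<in> r \<or> (\<beta> a, b) \<in> r" using Well_orderD(6)[OF wo] A B that \<beta>[OF that(1)] by blast
      then show ?thesis unfolding e_def using *[of b "\<beta> a"] *[of "\<beta> a" b] that \<beta>[OF that(1)] by auto
    qed
    have "is_cocone C r A X i T e"
      unfolding is_cocone_def
    proof (intro conjI ballI impI)
      show "T \<in> Obj C" by (rule coconeD(1)[OF d])
      show eH: "e a \<in> Hom C (X a) T" if "a \<in> A" for a
        using coconeD(2)[OF d \<beta>(1)[OF that]] tr_Hom[OF ds \<beta>(2)[OF that]] unfolding e_def by (simp add: Hom_iff)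
      show "e b \<cdot> i a b = e a" if ab: "a \<in> A" "b \<in> A" "ord_less r a b" for a b
      proof -
        have abr: "(a, b) \<in> r" and tri: "tr C X i a b = i a b" using ab(3) unfolding ord_less_def tr_def by auto
        have "e a = d (\<beta> b) \<cdot> tr C X i a (\<beta> b)"
          using e[OF ab(1) \<beta>(1)[OF ab(2)]] Well_orderD(4)[OF wo abr \<beta>(2)[OF ab(2)]] by simp
        also have "\<dots> = d (\<beta> b) \<cdot> (tr C X i b (\<beta> b) \<cdot> tr C X i a b)"
          using tr_tr[OF ds abr \<beta>(2)[OF ab(2)] Well_order_antisym[OF wo]] by simp
        also have "\<dots> = e b \<cdot> i a b"
          using coconeD(2)[OF d \<beta>(1)[OF ab(2)]] tr_Hom[OF ds abr] tr_Hom[OF ds \<beta>(2)[OF ab(2)]] tri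
          unfolding e_def by (simp add: Hom_iff)
        finally show ?thesis by simp
      qed
    qed
    then obtain h where h: "h \<in> Hom C L T" "\<And>a. a \<in> A \<Longrightarrow> h \<cdot> c a = e a"
      using colimit_factor[OF l] by metis
    have "h \<cdot> c b = d b" if b: "b \<in> B" for b
    proof -
      have bA: "b \<in> A" and bb: "(b, b) \<in> r" using b B A Well_orderD(3)[OF wo] by auto
      show ?thesis
        using h(2)[OF bA] e[OF bA b bb] coconeD(2)[OF d b] unfolding tr_def by (simp add: Hom_iff)
    qed
    then show "\<exists>h. h \<in> Hom C L T \<and> (\<forall>a \<in> B. h \<cdot> c a = d a)" using h by blast
  next
    fix T h k assume hk: "h \<in> Hom C L T" "k \<in> Hom C L T" "\<And>a. a \<in> B \<Longrightarrow> h \<cdot> c a = k \<cdot> c a"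
    show "h = k"
    proof (rule colimit_unique[OF l ds hk(1,2)])
      fix a assume a: "a \<in> A"
      obtain b where b: "b \<in> B" "(a, b) \<in> r" using B(2) a by blast
      have bA: "b \<in> A" using b B by blast
      have "x \<cdot> c a = (x \<cdot> c b) \<cdot> tr C X i a b" if "x \<in> Hom C L T" for x
        using that cocone_tr[OF c a bA b(2)] coconeD(2)[OF c bA] tr_Hom[OF ds b(2)] by (simp add: Hom_iff)
      then show "h \<cdot> c a = k \<cdot> c a" using hk b by metis
    qed
  qed
qed

text \<open>On an index set with a last element, the last term is the colimit. This turns statements
  about compositions into statements about transition maps, with \<open>tr\<close> supplying the
  identity at \<open>m\<close>.\<close>

lemma colimit_at_max:
  assumes wo: "Well_order r" and ds: "direct_system C r X i" and A: "A \<subseteq> Field r"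
    and m: "m \<in> A" "\<And>a. a \<in> A \<Longrightarrow> (a, m) \<in> r"
  shows "is_colimit C r A X i (X m) (\<lambda>a. tr C X i a m)"
proof (rule colimitI)
  have Xm: "X m \<in> Obj C" using direct_systemD(1)[OF ds] m A by blast
  have trm: "tr C X i m m = Id C (X m)" by (simp add: tr_def)
  show "is_cocone C r A X i (X m) (\<lambda>a. tr C X i a m)"
    unfolding is_cocone_def
  proof (intro conjI ballI impI)
    show "tr C X i b m \<cdot> i a b = tr C X i a m" if "a \<in> A" "b \<in> A" "ord_less r a b" for a b
      using tr_tr[OF ds, of a b m] that m(2) Well_order_antisym[OF wo]
      unfolding ord_less_def by (auto simp: tr_def[of C X i a b])
  qed (use Xm tr_Hom[OF ds] m in auto)
  show "\<exists>h. h \<in> Hom C (X m) T \<and> (\<forall>a \<in> A. h \<cdot> tr C X i a m = d a)" if "is_cocone C r A X i T d" for T d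
    using coconeD(2)[OF that m(1)] cocone_tr[OF that _ m(1)] m(2) by blast
  show "h = k" if "h \<in> Hom C (X m) T" "k \<in> Hom C (X m) T"
    "\<And>a. a \<in> A \<Longrightarrow> h \<cdot> tr C X i a m = k \<cdot> tr C X i a m" for T h k
    using that(1,2) that(3)[OF m(1)] trm by (simp add: Hom_iff)
qed

text \<open>Earlier indices may disappear, but by convexity those that remain are cofinal below
  every remaining limit, so the colimit there is unchanged.\<close>

lemma chain_Restr:
  assumes ch: "chain C r X i" and cv: "convex_in r A"
  shows "chain C (Restr r A) X i"
proof -
  note c = chainD[OF ch]
  have A: "A \<subseteq> Field r" using cv unfolding convex_in_def by simp
  have ds: "direct_system C (Restr r A) X i"
    using c(4-6) A unfolding direct_system_def ord_less_Restr Field_Restr'[OF c(1) A] by blast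
  moreover have "is_colimit C (Restr r A) (underS (Restr r A) g) X i (X g) (\<lambda>a. i a g)"
    if lim: "is_limit (Restr r A) g" for g
  proof -
    obtain a where g: "g \<in> A" "is_limit r g" "a \<in> A" "ord_less r a g"
      using lim is_limit_Restr[OF c(1) cv, of g] by blast
    have sub: "underS r g \<subseteq> Field r" using ord_less_Field underS_iff by (metis subsetI)
    have cof: "\<exists>b \<in> underS r g \<inter> A. (x, b) \<in> r" if x: "x \<in> underS r g" for x
    proof (cases "(x, a) \<in> r")
      case True then show ?thesis using g unfolding underS_iff[symmetric] by blast
    next
      case False
      then have "(a, x) \<in> r" using Well_orderD(6)[OF c(1)] x sub g A by blast
      then have "x \<in> A" using x g cv unfolding convex_in_def underS_def by blast
      then show ?thesis using x sub Well_orderD(3)[OF c(1)] by blast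
    qed
    have "is_colimit C r (underS r g \<inter> A) X i (X g) (\<lambda>a. i a g)"
      using colimit_cofinal[OF c(1,2) sub colimit_cocone[OF c(3)[OF g(2)]], of "underS r g \<inter> A"]
        cof c(3)[OF g(2)] by blast
    then show ?thesis unfolding underS_Restr[OF g(1)] by (simp add: is_colimit_Restr)
  qed
  ultimately show ?thesis unfolding chain_def using Well_order_Restr[OF c(1)] by blast
qed

section \<open>Lifting along transfinite compositions\<close>

lemma liftsE:
  assumes "lifts C j q" "j \<in> Hom C A B" "q \<in> Hom C Z W" "u \<in> Hom C A Z" "v \<in> Hom C B W" "q \<cdot> u = v \<cdot> j"
  obtains l where "l \<in> Hom C B Z" "l \<cdot> j = u" "q \<cdot> l = v"
proof -
  have "Dom C j = A" "Cod C j = B" "Dom C q = Z" "Cod C q = W" using assms by (simp_all add: Hom_iff)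
  then show ?thesis using that assms(1,4-6) unfolding lifts_def by auto
qed

lemma liftsI:
  assumes "j \<in> Hom C A B" "q \<in> Hom C Z W"
    "\<And>u v. \<lbrakk>u \<in> Hom C A Z; v \<in> Hom C B W; q \<cdot> u = v \<cdot> j\<rbrakk> \<Longrightarrow> \<exists>l. l \<in> Hom C B Z \<and> l \<cdot> j = u \<and> q \<cdot> l = v"
  shows "lifts C j q"
proof -
  have "Dom C j = A" "Cod C j = B" "Dom C q = Z" "Cod C q = W" using assms(1,2) by (simp_all add: Hom_iff)
  then show ?thesis using assms(3) unfolding lifts_def by auto
qed

text \<open>The lift is assembled as a cocone of partial lifts: a successor step solves one lifting
  problem whose left edge is the partial lift so far, and a limit step is the universal property of
  the colimit.\<close>

lemma chain_lifts:
  assumes ch: "chain C r X i" and z: "is_least r z" and L: "is_colimit C r (Field r) X i L c"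
    and s: "\<And>a b. is_successor r a b \<Longrightarrow> lifts C (i a b) q" and q: "q \<in> Hom C Z W"
  shows "lifts C (c z) q"
proof -
  note d = chainD[OF ch] and wo = chainD(1)[OF ch]
  note co = coconeD[OF colimit_cocone[OF L]]
  have zF: "z \<in> Field r" using z unfolding is_least_def by simp
  show ?thesis
  proof (rule liftsI[OF co(2)[OF zF] q])
    fix u v assume u: "u \<in> Hom C (X z) Z" and v: "v \<in> Hom C L W" and quv: "q \<cdot> u = v \<cdot> c z"
    \<comment> \<open>Compatibility with all earlier stages is part of the invariant, since at a
      limit the earlier lifts must form a cocone. Outside \<open>Field r\<close> any value is
      accepted, because the choice ranges over the whole type.\<close>
    define P where "P l a x \<longleftrightarrow> (a \<in> Field r \<longrightarrow> x \<in> Hom C (X a) Z \<and> q \<cdot> x = v \<cdot> c a \<and>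
      (a = z \<longrightarrow> x = u) \<and> (\<forall>b. ord_less r b a \<longrightarrow> x \<cdot> i b a = l b))" for l a x
    have "\<exists>l. \<forall>a. P l a (l a)"
    proof (rule dependent_wf_choice[OF Well_order_wf[OF wo]])
      show "P l a x = P l' a x" if "\<And>y. (y, a) \<in> r - Relation.Id \<Longrightarrow> l y = l' y" for l l' a x
        using that unfolding P_def ord_less_def by auto
      fix a l assume IH: "\<And>y. (y, a) \<in> r - Relation.Id \<Longrightarrow> P l y (l y)"
      show "\<exists>x. P l a x"
      proof (cases "a \<in> Field r")
        case aF: True
        have IH': "l b \<in> Hom C (X b) Z" "q \<cdot> l b = v \<cdot> c b" "ord_less r b' b \<Longrightarrow> l b \<cdot> i b' b = l b'"
          if "ord_less r b a" for b b'
          using IH[of b] that ord_less_Field[OF that] unfolding P_def ord_less_def by auto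
        have vc: "v \<cdot> c b = (v \<cdot> c a) \<cdot> i b a" if "ord_less r b a" for b
          using co(2)[OF aF] co(3)[OF _ aF that] d(5)[OF that] v ord_less_Field[OF that] by (simp add: Hom_iff)
        consider "is_least r a" | b where "is_successor r b a" | "is_limit r a"
          using least_successor_limit[OF aF] by blast
        then show ?thesis
        proof cases
          case 1
          have "a = z" by (rule is_least_unique[OF wo 1 z])
          moreover have "\<And>b. \<not> ord_less r b a" using 1 unfolding is_least_def underS_def ord_less_def by blast
          ultimately have "P l a u" unfolding P_def using u quv by auto
          then show ?thesis ..
        next
          case 2
          note b = is_successor_less[OF 2]
          obtain x where x: "x \<in> Hom C (X a) Z" "x \<cdot> i b a = l b" "q \<cdot> x = v \<cdot> c a"
            by (rule liftsE[OF s[OF 2] d(5)[OF b] q IH'(1)[OF b], of "v \<cdot> c a"])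
              (use co(2)[OF aF] v IH'(2)[OF b] vc[OF b] in \<open>auto simp: Hom_iff\<close>)
          have "x \<cdot> i b' a = l b'" if b': "ord_less r b' a" for b'
          proof (cases "b' = b")
            case False
            then have bb: "ord_less r b' b" using is_successor_le[OF wo 2 b'] unfolding ord_less_def by simp
            have "x \<cdot> i b' a = (x \<cdot> i b a) \<cdot> i b' b"
              using x(1) d(5)[OF b] d(5)[OF bb] d(6)[OF bb b] by (simp add: Hom_iff)
            then show ?thesis using x(2) IH'(3)[OF b bb] by simp
          qed (use x in simp)
          moreover have "a \<noteq> z" using b z unfolding is_least_def underS_def ord_less_def by blast
          ultimately have "P l a x" unfolding P_def using x by auto
          then show ?thesis ..
        next
          case 3
          have coc: "is_cocone C r (underS r a) X i Z l"
            unfolding is_cocone_def using IH' q Hom_Obj[OF q] by (auto simp: underS_iff)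
          obtain x where x: "x \<in> Hom C (X a) Z" "\<And>b. b \<in> underS r a \<Longrightarrow> x \<cdot> i b a = l b"
            by (rule colimit_factor[OF d(3)[OF 3] coc]) blast
          \<comment> \<open>The lower triangle at a limit holds because it holds at all earlier
            stages and maps out of the colimit are determined there.\<close>
          have "q \<cdot> x = v \<cdot> c a"
          proof (rule colimit_unique[OF d(3)[OF 3] d(2), of _ W])
            fix b assume b: "b \<in> underS r a"
            then have b': "ord_less r b a" by (simp add: underS_iff)
            have "(q \<cdot> x) \<cdot> i b a = q \<cdot> l b" using x(2)[OF b] x(1) q d(5)[OF b'] by (simp add: Hom_iff)
            then show "(q \<cdot> x) \<cdot> i b a = (v \<cdot> c a) \<cdot> i b a" using IH'(2)[OF b'] vc[OF b'] by simp
          qed (use x q v co(2)[OF aF] in \<open>simp_all add: Hom_iff\<close>)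
          moreover have "a \<noteq> z" using 3 z unfolding is_limit_def by blast
          ultimately have "P l a x" unfolding P_def using x by (auto simp: underS_iff)
          then show ?thesis ..
        qed
      qed (simp add: P_def)
    qed
    then obtain l where l: "\<And>a. P l a (l a)" by blast
    have "is_cocone C r (Field r) X i Z l"
      unfolding is_cocone_def using l Hom_Obj[OF q] unfolding P_def by blast
    then obtain h where h: "h \<in> Hom C L Z" "\<And>a. a \<in> Field r \<Longrightarrow> h \<cdot> c a = l a"
      using colimit_factor[OF L] by metis
    have "h \<cdot> c z = u" using h(2)[OF zF] l[of z] zF unfolding P_def by simp
    moreover have "q \<cdot> h = v"
    proof (rule colimit_unique[OF L d(2), of _ W])
      fix a assume a: "a \<in> Field r"
      have "(q \<cdot> h) \<cdot> c a = q \<cdot> l a" using h q co(2)[OF a] a by (simp add: Hom_iff)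
      then show "(q \<cdot> h) \<cdot> c a = v \<cdot> c a" using l[of a] a unfolding P_def by simp
    qed (use h q v in \<open>simp_all add: Hom_iff\<close>)
    ultimately show "\<exists>h. h \<in> Hom C L Z \<and> h \<cdot> c z = u \<and> q \<cdot> h = v" using h by blast
  qed
qed

end

section \<open>Construction of chains\<close>

lemma small_subset: "small U A \<Longrightarrow> B \<subseteq> A \<Longrightarrow> small U B"
  unfolding small_def using card_of_mono1 ordLeq_ordLess_trans by blast

lemma small_image: "small U A \<Longrightarrow> small U (f ` A)"
  unfolding small_def using card_of_image ordLeq_ordLess_trans by blast

lemma size_universe_infinite: "size_universe U \<Longrightarrow> infinite U"
  unfolding size_universe_def cinfinite_def by (simp add: Field_card_of)

lemma small_Un: "size_universe U \<Longrightarrow> small U A \<Longrightarrow> small U B \<Longrightarrow> small U (A \<union> B)"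
  unfolding small_def using card_of_Un_ordLess_infinite size_universe_infinite by blast

lemma small_finite: "size_universe U \<Longrightarrow> finite A \<Longrightarrow> small U A"
  unfolding small_def
  by (rule finite_ordLess_infinite) (simp_all add: card_of_well_order_on Field_card_of size_universe_infinite)

locale sized_efficient = efficient_exact_category U C
  for U :: "'u set" and C :: "('o, 'm, 'z) exact_data_scheme" (structure) +
  assumes size: "size_universe U" and locally_small: "locally_small U C"

text \<open>
  A chain over an object \<open>N\<close> is built by recursion on the index. The data \<open>g a\<close> added at stage \<open>a\<close> are the
  object, all the transition maps into it, and its map to \<open>N\<close>.
\<close>

abbreviation row_obj :: "('u \<Rightarrow> 'o \<times> ('u \<Rightarrow> 'm) \<times> 'm) \<Rightarrow> 'u \<Rightarrow> 'o" where
  "row_obj g a \<equiv> fst (g a)"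

abbreviation row_map :: "('u \<Rightarrow> 'o \<times> ('u \<Rightarrow> 'm) \<times> 'm) \<Rightarrow> 'u \<Rightarrow> 'u \<Rightarrow> 'm" where
  "row_map g a b \<equiv> fst (snd (g b)) a"

abbreviation row_arr :: "('u \<Rightarrow> 'o \<times> ('u \<Rightarrow> 'm) \<times> 'm) \<Rightarrow> 'u \<Rightarrow> 'm" where
  "row_arr g a \<equiv> snd (snd (g a))"

context category
begin

text \<open>The cancellation half of the pasting law for pushouts. It exhibits the successor maps of
  a pushed out chain as pushouts of the original successor maps.\<close>

lemma pushout_cancel:
  assumes po1: "is_pushout C i f i1 f1" and po2: "is_pushout C (j \<cdot> i) f i2 f2"
    and j: "j \<in> Arr C" "Dom C j = Cod C i" and e: "e \<in> Hom C (Cod C i1) (Cod C i2)" "e \<cdot> i1 = i2" "e \<cdot> f1 = f2 \<cdot> j"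
  shows "is_pushout C j f1 e f2"
proof -
  note d1 = pushoutD[OF po1] and d2 = pushoutD[OF po2]
  have dj: "Dom C (j \<cdot> i) = Dom C i" "Cod C (j \<cdot> i) = Cod C j" using j d1 by simp_all
  show ?thesis
  proof (rule pushoutI[of _ "Cod C i" "Cod C j" _ "Cod C i1" _ "Cod C i2"])
    show "e \<cdot> f1 = f2 \<cdot> j" by (rule e(3))
    fix T u v assume *: "u \<in> Hom C (Cod C i1) T" "v \<in> Hom C (Cod C j) T" "u \<cdot> f1 = v \<cdot> j"
    have "(u \<cdot> i1) \<cdot> f = (u \<cdot> f1) \<cdot> i" using *(1) d1 by (simp add: Hom_iff)
    also have "\<dots> = v \<cdot> (j \<cdot> i)" unfolding *(3) using *(2) j d1 by (simp add: Hom_iff)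
    finally have "(u \<cdot> i1) \<cdot> f = v \<cdot> (j \<cdot> i)" .
    moreover have "u \<cdot> i1 \<in> Hom C (Cod C f) T" "v \<in> Hom C (Cod C (j \<cdot> i)) T"
      using * d1 dj by (simp_all add: Hom_iff)
    ultimately obtain h where h: "h \<in> Hom C (Cod C i2) T" "h \<cdot> i2 = u \<cdot> i1" "h \<cdot> f2 = v"
      using pushout_factor[OF po2] by metis
    have "h \<cdot> e = u"
    proof (rule pushout_unique[OF po1, of _ T])
      show "(h \<cdot> e) \<cdot> i1 = u \<cdot> i1" using h e d1 by (simp add: Hom_iff)
      have "(h \<cdot> e) \<cdot> f1 = (h \<cdot> f2) \<cdot> j" using h(1) e d1 d2 j dj by (simp add: Hom_iff)
      then show "(h \<cdot> e) \<cdot> f1 = u \<cdot> f1" using h *(3) by simp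
    qed (use h e * in \<open>simp_all add: Hom_iff\<close>)
    then show "\<exists>h. h \<in> Hom C (Cod C i2) T \<and> h \<cdot> e = u \<and> h \<cdot> f2 = v" using h by blast
  next
    fix T h k assume *: "h \<in> Hom C (Cod C i2) T" "k \<in> Hom C (Cod C i2) T" "h \<cdot> e = k \<cdot> e" "h \<cdot> f2 = k \<cdot> f2"
    show "h = k"
    proof (rule pushout_unique[OF po2 *(1,2) _ *(4)])
      have "h \<cdot> i2 = (h \<cdot> e) \<cdot> i1" "k \<cdot> i2 = (k \<cdot> e) \<cdot> i1" using *(1,2) e d1 by (simp_all add: Hom_iff)
      then show "h \<cdot> i2 = k \<cdot> i2" using *(3) by simp
    qed
  qed (use d1 d2 j dj e in \<open>simp_all add: Hom_iff\<close>)
qed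

end

section \<open>Joining two chains at a common object\<close>

lemma interval_convex:
  assumes "Well_order r"
  shows "convex_in r {c. (a, c) \<in> r \<and> (c, b) \<in> r}"
  unfolding convex_in_def using Well_orderD(1,2,4)[OF assms] by blast

context category
begin

text \<open>Colimits survive the gluing: at a limit up to \<open>m\<close> all earlier indices
  belong to the first chain, and at a limit beyond \<open>m\<close> the indices from
  \<open>m\<close> on are cofinal. A successor pair never straddles \<open>m\<close>, so both ends
  of each successor map lie in one of the two chains.\<close>

lemma chain_glue:
  assumes wo: "Well_order r" and zm: "(z, m) \<in> r" and mn: "(m, n) \<in> r"
    and X: "chain C (Restr r {c. (z, c) \<in> r \<and> (c, m) \<in> r}) X i"
    and Y: "chain C (Restr r {c. (m, c) \<in> r \<and> (c, n) \<in> r}) Y j"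
    and XY: "X m = Y m"
    and XM: "successor_maps_in (Restr r {c. (z, c) \<in> r \<and> (c, m) \<in> r}) i M"
    and YM: "successor_maps_in (Restr r {c. (m, c) \<in> r \<and> (c, n) \<in> r}) j M"
  obtains W k where "chain C (Restr r {c. (z, c) \<in> r \<and> (c, n) \<in> r}) W k" "W z = X z" "W n = Y n"
    "successor_maps_in (Restr r {c. (z, c) \<in> r \<and> (c, n) \<in> r}) k M"
proof -
  let ?A = "{c. (z, c) \<in> r \<and> (c, m) \<in> r}" and ?B = "{c. (m, c) \<in> r \<and> (c, n) \<in> r}"
  let ?D = "{c. (z, c) \<in> r \<and> (c, n) \<in> r}"
  note w = Well_orderD[OF wo]
  define W where "W a = (if (a, m) \<in> r then X a else Y a)" for a
  \<comment> \<open>A map across \<open>m\<close> passes through the common object;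
    \<open>tr\<close> covers \<open>a = m\<close>, where the first factor is an identity.\<close>
  define k where "k a b = (if (b, m) \<in> r then i a b else if (a, m) \<in> r then j m b \<cdot> tr C X i a m else j a b)" for a b
  have cvA: "convex_in r ?A" and cvB: "convex_in r ?B" and cvD: "convex_in r ?D"
    by (rule interval_convex[OF wo])+
  have sA: "?A \<subseteq> Field r" and sB: "?B \<subseteq> Field r" and sD: "?D \<subseteq> Field r"
    using w(1) by auto
  have D: "?D = ?A \<union> ?B"
  proof (intro equalityI subsetI)
    fix c assume c: "c \<in> ?D"
    then show "c \<in> ?A \<union> ?B" using w(6)[OF w(1)[OF mn] w(1), of c n] by auto
  next
    fix c assume "c \<in> ?A \<union> ?B"
    then show "c \<in> ?D" using w(4)[OF zm, of c] w(4)[OF _ mn, of c] by auto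
  qed
  have AD: "?A \<subseteq> ?D" and BD: "?B \<subseteq> ?D" unfolding D by (rule Un_upper1, rule Un_upper2)
  have DB: "c \<in> ?B" if "c \<in> ?D" "c \<notin> ?A" for c
  proof -
    have "c \<in> ?A \<union> ?B" using that(1) unfolding D .
    then show ?thesis by (rule UnE) (use that(2) in simp_all)
  qed
  have mA: "m \<in> ?A" and mB: "m \<in> ?B" using zm mn w(3)[OF w(1)[OF mn]] by simp_all
  note x = chainD[OF X] and y = chainD[OF Y]
  have FA: "Field (Restr r ?A) = ?A" by (rule Field_Restr'[OF wo sA])
  have FB: "Field (Restr r ?B) = ?B" by (rule Field_Restr'[OF wo sB])
  have FD: "Field (Restr r ?D) = ?D" by (rule Field_Restr'[OF wo sD])
  have iA: "i a b \<in> Hom C (X a) (X b)" if "a \<in> ?A" "b \<in> ?A" "ord_less r a b" for a b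
    using x(5)[unfolded ord_less_Restr] that by blast
  have jB: "j a b \<in> Hom C (Y a) (Y b)" if "a \<in> ?B" "b \<in> ?B" "ord_less r a b" for a b
    using y(5)[unfolded ord_less_Restr] that by blast
  have iiA: "i b c \<cdot> i a b = i a c" if "a \<in> ?A" "b \<in> ?A" "c \<in> ?A" "ord_less r a b" "ord_less r b c" for a b c
    using x(6)[unfolded ord_less_Restr] that by blast
  have jjB: "j b c \<cdot> j a b = j a c" if "a \<in> ?B" "b \<in> ?B" "c \<in> ?B" "ord_less r a b" "ord_less r b c" for a b c
    using y(6)[unfolded ord_less_Restr] that by blast
  have XO: "X a \<in> Obj C" if "a \<in> ?A" for a using x(4)[unfolded FA] that by blast
  have YO: "Y a \<in> Obj C" if "a \<in> ?B" for a using y(4)[unfolded FB] that by blast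
  have trA: "tr C X i a m \<in> Hom C (X a) (X m)" if "a \<in> ?A" for a
    using x(7)[of a m] that mA by blast
  have WA: "W a = X a" if "a \<in> ?A" for a using that unfolding W_def by simp
  have WB: "W a = Y a" if "a \<in> ?B" for a
    using that w(5)[of a m] XY unfolding W_def by auto
  have kA: "k a b = i a b" if "b \<in> ?A" for a b using that unfolding k_def by simp
  have notA: "(b, m) \<notin> r" if "a \<in> ?B" "ord_less r a b" for a b
    using that w(4,5) unfolding ord_less_def by blast
  have kB: "k a b = j a b" if "a \<in> ?B" "b \<in> ?B" "ord_less r a b" for a b
  proof (cases "a = m")
    case True
    then show ?thesis using that jB[OF that] XY notA[OF that(1,3)] w(3) sB
      unfolding k_def tr_def by (auto simp: Hom_iff)
  next
    case False
    then have "(a, m) \<notin> r" using that w(5) by auto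
    then show ?thesis using notA[OF that(1,3)] unfolding k_def by simp
  qed
  have kAB: "k a b = j m b \<cdot> tr C X i a m" if "a \<in> ?A" "b \<in> ?B" "b \<noteq> m" for a b
    using that w(5)[of b m] unfolding k_def by auto
  have lt: "ord_less r m b" if "b \<in> ?B" "b \<noteq> m" for b using that unfolding ord_less_def by auto
  have kHom: "k a b \<in> Hom C (W a) (W b)" if "a \<in> ?D" "b \<in> ?D" "ord_less r a b" for a b
  proof (cases "b \<in> ?A")
    case True
    then have "a \<in> ?A" using that w(4) unfolding ord_less_def by blast
    then show ?thesis using iA[OF _ True that(3)] WA kA[OF True] True by simp
  next
    case False
    then have b: "b \<in> ?B" "b \<noteq> m" using DB[OF that(2)] mA by blast+
    show ?thesis
    proof (cases "a \<in> ?A")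
      case True
      then show ?thesis
        using kAB[OF True b] trA[OF True] jB[OF mB b(1) lt[OF b]] WA[OF True] WB[OF b(1)] XY by (simp add: Hom_iff)
    next
      case False
      then have "a \<in> ?B" by (rule DB[OF that(1)])
      then show ?thesis using kB[OF _ b(1) that(3)] jB[OF _ b(1) that(3)] WB b by simp
    qed
  qed
  have kk: "k b c \<cdot> k a b = k a c"
    if abc: "a \<in> ?D" "b \<in> ?D" "c \<in> ?D" "ord_less r a b" "ord_less r b c" for a b c
  proof (cases "c \<in> ?A")
    case True
    then have "b \<in> ?A" "a \<in> ?A" using that w(4) unfolding ord_less_def by blast+
    then show ?thesis using iiA[OF _ _ True] that kA True by simp
  next
    case False
    then have c: "c \<in> ?B" "c \<noteq> m" using DB[OF that(3)] mA by blast+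
    show ?thesis
    proof (cases "b \<in> ?A")
      case b: True
      then have a: "a \<in> ?A" using that w(4) unfolding ord_less_def by blast
      have "tr C X i b m \<cdot> tr C X i a b = tr C X i a m"
        using x(8)[of a b m] a b mA abc(4) unfolding ord_less_def by blast
      moreover have "tr C X i a b = i a b" using abc(4) unfolding tr_def ord_less_def by simp
      ultimately have "k b c \<cdot> k a b = (j m c \<cdot> tr C X i b m) \<cdot> i a b" "k a c = j m c \<cdot> (tr C X i b m \<cdot> i a b)"
        using kAB[OF b c] kAB[OF a c] kA[OF b] by auto
      then show ?thesis
        using jB[OF mB c(1) lt[OF c]] trA[OF b] iA[OF a b abc(4)] XY by (simp add: Hom_iff)
    next
      case b': False
      then have b: "b \<in> ?B" "b \<noteq> m" using DB[OF that(2)] mA by blast+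
      show ?thesis
      proof (cases "a \<in> ?A")
        case a: True
        have "k b c \<cdot> k a b = j b c \<cdot> (j m b \<cdot> tr C X i a m)"
          using kB[OF b(1) c(1) abc(5)] kAB[OF a b] by simp
        also have "\<dots> = (j b c \<cdot> j m b) \<cdot> tr C X i a m"
          using jB[OF b(1) c(1) abc(5)] jB[OF mB b(1) lt[OF b]] trA[OF a] XY by (simp add: Hom_iff)
        also have "\<dots> = k a c" using jjB[OF mB b(1) c(1) lt[OF b] abc(5)] kAB[OF a c] by simp
        finally show ?thesis .
      next
        case False
        then have a: "a \<in> ?B" by (rule DB[OF that(1)])
        have "ord_less r a c" by (rule ord_less_trans[OF wo abc(4,5)])
        then show ?thesis
          using kB[OF b(1) c(1) abc(5)] kB[OF a b(1) abc(4)] kB[OF a c(1)] jjB[OF a b(1) c(1) abc(4,5)] by simp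
      qed
    qed
  qed
  have WO: "W a \<in> Obj C" if "a \<in> ?D" for a
  proof (cases "a \<in> ?A")
    case True
    then show ?thesis using XO WA by metis
  next
    case False
    then have "a \<in> ?B" by (rule DB[OF that(1)])
    then show ?thesis using YO WB by metis
  qed
  have ds: "direct_system C (Restr r ?D) W k"
    unfolding direct_system_def FD ord_less_Restr using WO kHom kk by blast
  have col: "is_colimit C (Restr r ?D) (underS (Restr r ?D) g) W k (W g) (\<lambda>a. k a g)"
    if l: "is_limit (Restr r ?D) g" for g
  proof -
    have g: "g \<in> ?D" "is_limit r g" "\<exists>a \<in> ?D. ord_less r a g"
      using l is_limit_Restr[OF wo cvD] by auto
    show ?thesis
    proof (cases "g \<in> ?A")
      case gA: True
      have cm: "(c, m) \<in> r" if "ord_less r c g" for c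
        using that gA w(4)[of c g m] unfolding ord_less_def by simp
      have cn: "(c, n) \<in> r" if "ord_less r c g" for c by (rule w(4)[OF cm[OF that] mn])
      have sub: "underS r g \<inter> ?D = underS r g \<inter> ?A"
        using cm cn by (auto simp: underS_iff)
      have "is_limit (Restr r ?A) g"
      proof -
        obtain a where a: "a \<in> ?D" "ord_less r a g" using g(3) by blast
        then have "a \<in> ?A" using cm by blast
        then show ?thesis using is_limit_Restr[OF wo cvA, of g] gA g(2) a(2) by blast
      qed
      then have "is_colimit C (Restr r ?A) (underS (Restr r ?A) g) X i (X g) (\<lambda>a. i a g)" by (rule x(3))
      then have "is_colimit C r (underS r g \<inter> ?A) X i (X g) (\<lambda>a. i a g)"
        unfolding underS_Restr[OF gA] by (subst (asm) is_colimit_Restr) auto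
      moreover have "is_colimit C r (underS r g \<inter> ?A) X i (X g) (\<lambda>a. i a g)
         \<longleftrightarrow> is_colimit C r (underS r g \<inter> ?A) W k (X g) (\<lambda>a. k a g)"
        by (rule is_colimit_cong) (use WA kA gA in auto)
      ultimately show ?thesis
        unfolding underS_Restr[OF g(1)] sub WA[OF gA]
        using AD by (subst is_colimit_Restr) (blast, simp)
    next
      case False
      then have gB: "g \<in> ?B" "g \<noteq> m" using DB[OF g(1)] mA by blast+
      have "is_limit (Restr r ?B) g"
        using is_limit_Restr[OF wo cvB] g gB mB lt by blast
      then have "is_colimit C (Restr r ?B) (underS (Restr r ?B) g) Y j (Y g) (\<lambda>a. j a g)" by (rule y(3))
      then have "is_colimit C r (underS r g \<inter> ?B) Y j (Y g) (\<lambda>a. j a g)"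
        unfolding underS_Restr[OF gB(1)] by (subst (asm) is_colimit_Restr) auto
      moreover have "is_colimit C r (underS r g \<inter> ?B) Y j (Y g) (\<lambda>a. j a g)
         \<longleftrightarrow> is_colimit C r (underS r g \<inter> ?B) W k (Y g) (\<lambda>a. k a g)"
        by (rule is_colimit_cong) (use gB in \<open>auto simp: WB kB underS_iff\<close>)
      ultimately have "is_colimit C r (underS r g \<inter> ?B) W k (Y g) (\<lambda>a. k a g)" by simp
      then have "is_colimit C (Restr r ?D) (underS r g \<inter> ?B) W k (W g) (\<lambda>a. k a g)"
        unfolding WB[OF gB(1)] using BD by (subst is_colimit_Restr) (blast, simp)
      moreover have "is_cocone C (Restr r ?D) (underS r g \<inter> ?D) W k (W g) (\<lambda>a. k a g)"
        unfolding is_cocone_def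
      proof (intro conjI ballI impI)
        show "W g \<in> Obj C" by (rule WO[OF g(1)])
        show "k a g \<in> Hom C (W a) (W g)" if "a \<in> underS r g \<inter> ?D" for a
          using that kHom[OF _ g(1), of a] by (simp add: underS_iff)
        show "k b g \<cdot> k a b = k a g"
          if "a \<in> underS r g \<inter> ?D" "b \<in> underS r g \<inter> ?D" "ord_less (Restr r ?D) a b" for a b
          using that kk[OF _ _ g(1), of a b] by (simp add: underS_iff ord_less_Restr)
      qed
      moreover have "\<exists>b \<in> underS r g \<inter> ?B. (a, b) \<in> Restr r ?D" if a: "a \<in> underS r g \<inter> ?D" for a
      proof (cases "a \<in> ?A")
        case True
        then have "(a, m) \<in> Restr r ?D" using a AD mA by blast
        then show ?thesis using mB lt[OF gB] unfolding underS_iff[symmetric] by blast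
      next
        case False
        then have "a \<in> ?B" using DB a by blast
        moreover from this have "(a, a) \<in> r" using w(3) sB by blast
        ultimately show ?thesis using a by blast
      qed
      moreover have "underS r g \<inter> ?D \<subseteq> Field (Restr r ?D)" unfolding FD by blast
      moreover have "underS r g \<inter> ?B \<subseteq> underS r g \<inter> ?D" using BD by blast
      ultimately have "is_colimit C (Restr r ?D) (underS r g \<inter> ?D) W k (W g) (\<lambda>a. k a g)"
        using colimit_cofinal[OF Well_order_Restr[OF wo] ds, of "underS r g \<inter> ?D" "W g" "\<lambda>a. k a g" "underS r g \<inter> ?B"]
        by blast
      then show ?thesis unfolding underS_Restr[OF g(1)] .
    qed
  qed
  have ch: "chain C (Restr r ?D) W k"
    unfolding chain_def using Well_order_Restr[OF wo] ds col by blast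
  have "successor_maps_in (Restr r ?D) k M"
    unfolding successor_maps_in_def is_successor_Restr[OF wo cvD]
  proof (intro allI impI, elim conjE)
    fix a b assume ab: "a \<in> ?D" "b \<in> ?D" "is_successor r a b"
    note l = is_successor_less[OF ab(3)]
    show "k a b \<in> M"
    proof (cases "b \<in> ?A")
      case True
      then have a: "a \<in> ?A" using ab l w(4) unfolding ord_less_def by blast
      then show ?thesis
        using XM True ab(3) kA[OF True] unfolding successor_maps_in_def is_successor_Restr[OF wo cvA] by auto
    next
      case False
      then have b: "b \<in> ?B" "b \<noteq> m" using DB[OF ab(2)] mA by blast+
      have "(m, a) \<in> r" using is_successor_le[OF wo ab(3) lt[OF b]] .
      then have a: "a \<in> ?B" using ab by blast
      then show ?thesis
        using YM b ab(3) kB[OF a b(1) l] unfolding successor_maps_in_def is_successor_Restr[OF wo cvB] by auto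
    qed
  qed
  moreover have "W z = X z" using zm unfolding W_def by simp
  moreover have "W n = Y n" using WB mn w(2,3) by blast
  ultimately show ?thesis using that ch by blast
qed

end

section \<open>Inflations in chains, pushouts of chains, and the recursion that builds
  chains\<close>

context sized_efficient
begin

text \<open>\<open>Ax1\<close> for the closed segment from \<open>z\<close> to \<open>m\<close>: it
  is small even if the whole chain is not, and its composition is the transition map by
  \<open>colimit_at_max\<close>.\<close>

lemma chain_inflation:
  fixes r :: "'u rel"
  assumes ch: "chain C r X i" and z: "is_least r z" and s: "successor_maps_in r i (Inflations C)"
    and m: "m \<in> Field r" and sm: "small U (underS r m)"
  shows "tr C X i z m \<in> Inflations C"
proof -
  note wo = chainD(1)[OF ch]
  note w = Well_orderD[OF wo]
  let ?A = "{c. (z, c) \<in> r \<and> (c, m) \<in> r}"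
  have cv: "convex_in r ?A" by (rule interval_convex[OF wo])
  then have A: "?A \<subseteq> Field r" unfolding convex_in_def by (rule conjunct1)
  have zm: "(z, m) \<in> r" by (rule is_leastD[OF wo z m])
  have mA: "m \<in> ?A" and zA: "z \<in> ?A" using zm w(3)[OF m] w(3)[OF w(1)[OF zm]] by simp_all
  have "?A \<subseteq> underS r m \<union> {m}" unfolding underS_def by auto
  then have "small U ?A" using small_subset small_Un[OF size sm] small_finite[OF size, of "{m}"] by blast
  then have tf: "transfinite_seq U C (Restr r ?A) X i"
    unfolding transfinite_seq_iff Field_Restr'[OF wo A] using chain_Restr[OF ch cv] by blast
  have "successor_maps_in (Restr r ?A) i (Inflations C)"
    using s unfolding successor_maps_in_def is_successor_Restr[OF wo cv] by blast
  moreover have "is_least (Restr r ?A) z" unfolding is_least_Restr[OF wo A] using zA by blast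
  moreover have "is_colimit C (Restr r ?A) (Field (Restr r ?A)) X i (X m) (\<lambda>a. tr C X i a m)"
    by (rule colimit_at_max[OF Well_order_Restr[OF wo] chainD(2)[OF chain_Restr[OF ch cv]]])
      (use mA in \<open>auto simp: Field_Restr'[OF wo A]\<close>)
  ultimately show ?thesis using Ax1[OF tf] by blast
qed

lemma inflations_with_coker_in_Inflations: "inflations_with_coker_in C \<S> \<subseteq> Inflations C"
  unfolding inflations_with_coker_in_def Inflations_def by blast

lemma pushout_inflations_with_coker_in:
  assumes "is_pushout C i f i' f'" "i \<in> inflations_with_coker_in C \<S>"
  shows "i' \<in> inflations_with_coker_in C \<S>"
proof -
  obtain p where p: "(i, p) \<in> Conflations C" "Cod C p \<in> \<S>"
    using assms(2) unfolding inflations_with_coker_in_def by blast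
  obtain p' where p': "conflation C (Cod C f) i' (Cod C i') p' (Cod C p)"
    by (rule pushout_conflation[OF assms(1) conflationI[OF p(1)]])
  then show ?thesis
    using p(2) unfolding inflations_with_coker_in_def conflation_def by (auto simp: Hom_iff)
qed

text \<open>The pushouts are chosen index by index and connected by their universal properties.
  Taking \<open>g\<close> to be a map to zero yields a filtration of the quotient; taking for
  \<open>g\<close> the inclusion of a kernel yields a chain that starts at the middle term of the
  conflation.\<close>

lemma chain_pushout:
  fixes r :: "'u rel"
  assumes ch: "chain C r X i" and z: "is_least r z"
    and s: "successor_maps_in r i (inflations_with_coker_in C \<S>)"
    and sm: "\<And>a. a \<in> Field r \<Longrightarrow> small U (underS r a)" and g: "g \<in> Hom C (X z) G"
  obtains E e b where "chain C r E e" "E z = G"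
    "successor_maps_in r e (inflations_with_coker_in C \<S>)"
    "\<And>m. m \<in> Field r \<Longrightarrow> is_pushout C (tr C X i z m) g (tr C E e z m) (b m)"
proof -
  note d = chainD[OF ch] and wo = chainD(1)[OF ch]
  note w = Well_orderD[OF wo]
  have zF: "z \<in> Field r" using z unfolding is_least_def by simp
  have zm: "(z, a) \<in> r" if "a \<in> Field r" for a by (rule is_leastD[OF wo z that])
  have G: "G \<in> Obj C" "X z \<in> Obj C" using g Hom_Obj by blast+
  let ?x = "\<lambda>m. tr C X i z m"
  have xH: "?x m \<in> Hom C (X z) (X m)" if "m \<in> Field r" for m using d(7)[OF zm[OF that]] .
  have xz: "?x z = Id C (X z)" by (simp add: tr_def)
  have ix: "i a b \<cdot> ?x a = ?x b" if "ord_less r a b" for a b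
    using d(8)[of z a b] zm ord_less_Field[OF that] that unfolding ord_less_def by (auto simp: tr_def[of _ _ _ a b])
  \<comment> \<open>At \<open>z\<close> the identity square is prescribed, so that the new chain
    begins with the object \<open>G\<close> itself and can be joined to a chain ending
    there.\<close>
  have ex: "\<exists>\<epsilon> \<beta>. is_pushout C (?x m) g \<epsilon> \<beta> \<and> (m = z \<longrightarrow> \<epsilon> = Id C G)" if m: "m \<in> Field r" for m
  proof (cases "m = z")
    case True
    then show ?thesis using pushout_Id[OF g] xz by auto
  next
    case False
    have "?x m \<in> Inflations C"
      by (rule chain_inflation[OF ch z _ m sm[OF m]])
        (use s inflations_with_coker_in_Inflations in \<open>auto simp: successor_maps_in_def\<close>)
    then show ?thesis
      using inflation_pushout[of "?x m" g] xH[OF m] g False by (auto simp: Hom_iff)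
  qed
  obtain \<epsilon> \<beta> where po: "\<And>m. m \<in> Field r \<Longrightarrow> is_pushout C (?x m) g (\<epsilon> m) (\<beta> m)"
    and \<epsilon>z: "\<epsilon> z = Id C G"
    using ex zF by metis
  define E where "E m = Cod C (\<epsilon> m)" for m
  have Ez: "E z = G" unfolding E_def \<epsilon>z using G by simp
  have \<epsilon>: "\<epsilon> m \<in> Hom C G (E m)" and \<beta>: "\<beta> m \<in> Hom C (X m) (E m)" and \<epsilon>\<beta>: "\<epsilon> m \<cdot> g = \<beta> m \<cdot> ?x m"
    if "m \<in> Field r" for m
    using pushoutD[OF po[OF that]] xH[OF that] g unfolding E_def by (auto simp: Hom_iff)
  have fac: "\<exists>h. h \<in> Hom C (E m) T \<and> h \<cdot> \<epsilon> m = u \<and> h \<cdot> \<beta> m = v"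
    if "m \<in> Field r" "u \<in> Hom C G T" "v \<in> Hom C (X m) T" "u \<cdot> g = v \<cdot> ?x m" for m T u v
    using pushout_factor[OF po[OF that(1)], of u T v] that xH[OF that(1)] g unfolding E_def
    by (metis Hom_iff)
  have uni: "h = k" if "m \<in> Field r" "h \<in> Hom C (E m) T" "k \<in> Hom C (E m) T" "h \<cdot> \<epsilon> m = k \<cdot> \<epsilon> m" "h \<cdot> \<beta> m = k \<cdot> \<beta> m"
    for m T h k
    using pushout_unique[OF po[OF that(1)], of h T k] that unfolding E_def by blast
  have "\<exists>h. h \<in> Hom C (E a) (E b) \<and> h \<cdot> \<epsilon> a = \<epsilon> b \<and> h \<cdot> \<beta> a = \<beta> b \<cdot> i a b" if ab: "ord_less r a b" for a b
  proof (rule fac)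
    have F: "a \<in> Field r" "b \<in> Field r" using ord_less_Field[OF ab] by auto
    show "a \<in> Field r" "\<epsilon> b \<in> Hom C G (E b)" "\<beta> b \<cdot> i a b \<in> Hom C (X a) (E b)"
      using F \<epsilon> \<beta>[OF F(2)] d(5)[OF ab] by (auto simp: Hom_iff)
    have "(\<beta> b \<cdot> i a b) \<cdot> ?x a = \<beta> b \<cdot> (i a b \<cdot> ?x a)"
      using \<beta>[OF F(2)] d(5)[OF ab] xH[OF F(1)] by (simp add: Hom_iff)
    then show "\<epsilon> b \<cdot> g = (\<beta> b \<cdot> i a b) \<cdot> ?x a" using \<epsilon>\<beta>[OF F(2)] ix[OF ab] by simp
  qed
  then obtain e where eH: "\<And>a b. ord_less r a b \<Longrightarrow> e a b \<in> Hom C (E a) (E b)"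
    and e\<epsilon>: "\<And>a b. ord_less r a b \<Longrightarrow> e a b \<cdot> \<epsilon> a = \<epsilon> b"
    and e\<beta>: "\<And>a b. ord_less r a b \<Longrightarrow> e a b \<cdot> \<beta> a = \<beta> b \<cdot> i a b"
    by metis
  have EO: "E a \<in> Obj C" if "a \<in> Field r" for a using \<epsilon>[OF that] Hom_Obj by blast
  have ee: "e b c \<cdot> e a b = e a c" if abc: "ord_less r a b" "ord_less r b c" for a b c
  proof -
      have ac: "ord_less r a c" by (rule ord_less_trans[OF wo abc])
      have F: "a \<in> Field r" "b \<in> Field r" "c \<in> Field r" using ord_less_Field[OF abc(1)] ord_less_Field[OF abc(2)] by auto
      show ?thesis
      proof (rule uni[OF F(1)])
        show "(e b c \<cdot> e a b) \<cdot> \<epsilon> a = e a c \<cdot> \<epsilon> a"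
          using eH[OF abc(1)] eH[OF abc(2)] \<epsilon>[OF F(1)] e\<epsilon>[OF abc(1)] e\<epsilon>[OF abc(2)] e\<epsilon>[OF ac] by (simp add: Hom_iff)
        have "(e b c \<cdot> e a b) \<cdot> \<beta> a = e b c \<cdot> (\<beta> b \<cdot> i a b)"
          using eH[OF abc(1)] eH[OF abc(2)] \<beta>[OF F(1)] e\<beta>[OF abc(1)] by (simp add: Hom_iff)
        also have "\<dots> = (e b c \<cdot> \<beta> b) \<cdot> i a b"
          using eH[OF abc(2)] \<beta>[OF F(2)] d(5)[OF abc(1)] by (simp add: Hom_iff)
        also have "\<dots> = \<beta> c \<cdot> (i b c \<cdot> i a b)"
          unfolding e\<beta>[OF abc(2)] using \<beta>[OF F(3)] d(5)[OF abc(1)] d(5)[OF abc(2)] by (simp add: Hom_iff)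
        finally show "(e b c \<cdot> e a b) \<cdot> \<beta> a = e a c \<cdot> \<beta> a" using e\<beta>[OF ac] d(6)[OF abc] by simp
      qed (use eH[OF abc(1)] eH[OF abc(2)] eH[OF ac] in \<open>simp_all add: Hom_iff\<close>)
  qed
  have ds: "direct_system C r E e"
    unfolding direct_system_def using EO eH ee by blast
  \<comment> \<open>A map out of the pushout at \<open>l\<close> amounts to a map from
    \<open>G\<close> and one from \<open>X l\<close> that agree on \<open>X z\<close>. Given a
    cocone, its member at \<open>z\<close> is the first, and the colimit property of
    \<open>X l\<close> produces the second.\<close>
  have col: "is_colimit C r (underS r l) E e (E l) (\<lambda>a. e a l)" if l: "is_limit r l" for l
  proof (rule colimitI)
    have lF: "l \<in> Field r" and zl: "ord_less r z l"
      using l z zm[of l] unfolding is_limit_def ord_less_def by blast+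
    show "is_cocone C r (underS r l) E e (E l) (\<lambda>a. e a l)"
      unfolding is_cocone_def Ball_def underS_iff using direct_systemD[OF ds] lF by blast
    fix T c assume c: "is_cocone C r (underS r l) E e T c"
    have cH: "c a \<in> Hom C (E a) T" if "ord_less r a l" for a using coconeD(2)[OF c] that underS_iff by fast
    have ce: "c b \<cdot> e a b = c a" if "ord_less r a b" "ord_less r b l" for a b
      using coconeD(3)[OF c _ _ that(1)] that ord_less_trans[OF wo that] underS_iff by fast
    have cz: "c z \<in> Hom C G T" using cH[OF zl] Ez by simp
    have c\<epsilon>: "c a \<cdot> \<epsilon> a = c z" if a: "ord_less r a l" for a
    proof (cases "a = z")
      case True
      then show ?thesis using cz \<epsilon>z by (simp add: Hom_iff)
    next
      case False
      then have za: "ord_less r z a" using zm[of a] ord_less_Field[OF a] unfolding ord_less_def by blast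
      have "c a \<cdot> \<epsilon> a = c a \<cdot> (e z a \<cdot> \<epsilon> z)" using e\<epsilon>[OF za] by simp
      also have "\<dots> = c z" using ce[OF za a] eH[OF za] \<epsilon>z Ez by (simp add: Hom_iff)
      finally show ?thesis .
    qed
    have "is_cocone C r (underS r l) X i T (\<lambda>a. c a \<cdot> \<beta> a)"
      unfolding is_cocone_def underS_iff
    proof (intro conjI ballI impI)
      show "T \<in> Obj C" by (rule coconeD(1)[OF c])
      show "c a \<cdot> \<beta> a \<in> Hom C (X a) T" if "a \<in> underS r l" for a
        using cH[of a] \<beta>[of a] that ord_less_Field[of r a l] unfolding underS_iff by (auto simp: Hom_iff)
      show "(c b \<cdot> \<beta> b) \<cdot> i a b = c a \<cdot> \<beta> a"
        if "a \<in> underS r l" "b \<in> underS r l" and ab: "ord_less r a b" for a b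
      proof -
        have bl: "ord_less r b l" using that underS_iff by fast
        have F: "a \<in> Field r" "b \<in> Field r" using ord_less_Field[OF ab] by auto
        have "(c b \<cdot> \<beta> b) \<cdot> i a b = c b \<cdot> (e a b \<cdot> \<beta> a)"
          unfolding e\<beta>[OF ab] using cH[OF bl] \<beta>[OF F(2)] d(5)[OF ab] by (simp add: Hom_iff)
        also have "\<dots> = (c b \<cdot> e a b) \<cdot> \<beta> a"
          using cH[OF bl] \<beta>[OF F(1)] eH[OF ab] by (simp add: Hom_iff)
        finally show ?thesis using ce[OF ab bl] by simp
      qed
    qed
    then obtain v where v: "v \<in> Hom C (X l) T" "\<And>a. a \<in> underS r l \<Longrightarrow> v \<cdot> i a l = c a \<cdot> \<beta> a"
      by (rule colimit_factor[OF d(3)[OF l]]) blast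
    have "c z \<cdot> g = c z \<cdot> (\<epsilon> z \<cdot> g)" using \<epsilon>z g by (simp add: Hom_iff)
    also have "\<dots> = c z \<cdot> \<beta> z" using \<epsilon>\<beta>[OF zF] xz \<beta>[OF zF] by (simp add: Hom_iff)
    also have "\<dots> = v \<cdot> i z l" using v(2)[of z] zl underS_iff by fastforce
    also have "\<dots> = v \<cdot> ?x l" using zl unfolding tr_def ord_less_def by simp
    finally obtain h where h: "h \<in> Hom C (E l) T" "h \<cdot> \<epsilon> l = c z" "h \<cdot> \<beta> l = v"
      using fac[OF lF cz v(1)] by blast
    have "h \<cdot> e a l = c a" if "a \<in> underS r l" for a
    proof -
      have al: "ord_less r a l" using that underS_iff by fast
      have aF: "a \<in> Field r" using ord_less_Field[OF al] by blast
      show ?thesis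
      proof (rule uni[OF aF])
        show "(h \<cdot> e a l) \<cdot> \<epsilon> a = c a \<cdot> \<epsilon> a"
          using h eH[OF al] \<epsilon>[OF aF] e\<epsilon>[OF al] c\<epsilon>[OF al] by (simp add: Hom_iff)
        have "(h \<cdot> e a l) \<cdot> \<beta> a = (h \<cdot> \<beta> l) \<cdot> i a l"
          using h(1) eH[OF al] \<beta>[OF aF] \<beta>[OF lF] d(5)[OF al] e\<beta>[OF al] by (simp add: Hom_iff)
        then show "(h \<cdot> e a l) \<cdot> \<beta> a = c a \<cdot> \<beta> a" using h(3) v(2)[OF that] by simp
      qed (use h eH[OF al] cH[OF al] in \<open>simp_all add: Hom_iff\<close>)
    qed
    then show "\<exists>h. h \<in> Hom C (E l) T \<and> (\<forall>a \<in> underS r l. h \<cdot> e a l = c a)" using h by blast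
  next
    fix T h k assume hk: "h \<in> Hom C (E l) T" "k \<in> Hom C (E l) T" "\<And>a. a \<in> underS r l \<Longrightarrow> h \<cdot> e a l = k \<cdot> e a l"
    have lF: "l \<in> Field r" and zl: "ord_less r z l"
      using l z zm[of l] unfolding is_limit_def ord_less_def by blast+
    have zu: "z \<in> underS r l" using zl underS_iff by fast
    show "h = k"
    proof (rule uni[OF lF hk(1,2)])
      have "x \<cdot> \<epsilon> l = (x \<cdot> e z l)" if "x \<in> Hom C (E l) T" for x
        using e\<epsilon>[OF zl] eH[OF zl] \<epsilon>z Ez that by (simp add: Hom_iff)
      then show "h \<cdot> \<epsilon> l = k \<cdot> \<epsilon> l" using hk zu by metis
      show "h \<cdot> \<beta> l = k \<cdot> \<beta> l"
      proof (rule colimit_unique[OF d(3)[OF l] d(2), of _ T])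
        fix a assume a: "a \<in> underS r l"
        then have al: "ord_less r a l" using underS_iff by fast
        have aF: "a \<in> Field r" using ord_less_Field[OF al] by blast
        have "(x \<cdot> \<beta> l) \<cdot> i a l = (x \<cdot> e a l) \<cdot> \<beta> a" if "x \<in> Hom C (E l) T" for x
          using that e\<beta>[OF al] eH[OF al] \<beta>[OF aF] \<beta>[OF lF] d(5)[OF al] by (simp add: Hom_iff)
        then show "(h \<cdot> \<beta> l) \<cdot> i a l = (k \<cdot> \<beta> l) \<cdot> i a l" using hk a by metis
      qed (use hk \<beta>[OF lF] in \<open>simp_all add: Hom_iff\<close>)
    qed
  qed
  have chE: "chain C r E e" unfolding chain_def using wo ds col by blast
  have tre: "tr C E e z m = \<epsilon> m" if m: "m \<in> Field r" for m
  proof (cases "m = z")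
    case True
    then show ?thesis using \<epsilon>z Ez by (simp add: tr_def)
  next
    case False
    then have "ord_less r z m" using zm[OF m] unfolding ord_less_def by blast
    then show ?thesis using e\<epsilon>[of z m] eH[of z m] \<epsilon>z Ez False by (simp add: tr_def Hom_iff)
  qed
  have "e a b \<in> inflations_with_coker_in C \<S>" if ab: "is_successor r a b" for a b
  proof -
    note l = is_successor_less[OF ab]
    have F: "a \<in> Field r" "b \<in> Field r" using ord_less_Field[OF l] by auto
    \<comment> \<open>The squares from \<open>z\<close> to \<open>a\<close> and from
      \<open>z\<close> to \<open>b\<close> are pushouts; cancelling the former leaves a pushout over
      \<open>i a b\<close>, so \<open>e a b\<close> has a cokernel in \<open>\<S>\<close> as
      well.\<close>
    have po2: "is_pushout C (i a b \<cdot> ?x a) g (\<epsilon> b) (\<beta> b)" using po[OF F(2)] ix[OF l] by simp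
    have "is_pushout C (i a b) (\<beta> a) (e a b) (\<beta> b)"
      by (rule pushout_cancel[OF po[OF F(1)] po2])
        (use d(5)[OF l] xH[OF F(1)] eH[OF l] e\<epsilon>[OF l] e\<beta>[OF l] in \<open>simp_all add: Hom_iff E_def\<close>)
    then show ?thesis
      by (rule pushout_inflations_with_coker_in) (use s ab in \<open>auto simp: successor_maps_in_def\<close>)
  qed
  then have "successor_maps_in r e (inflations_with_coker_in C \<S>)" unfolding successor_maps_in_def by blast
  then show ?thesis using that[OF chE Ez] po tre by metis
qed

text \<open>One recursion serves the small object argument and the filtration of coproducts;
  \<open>Q\<close> lets each of them record what its steps attach. Assumption \<open>adm\<close>
  says that \<open>Q a g\<close> looks only at stages up to \<open>a\<close>, as well-founded choice
  requires. Limit stages are dictated by \<open>Ax1\<close>.\<close>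

lemma chain_construction:
  fixes r :: "'u rel" and Q :: "'u \<Rightarrow> ('u \<Rightarrow> 'o \<times> ('u \<Rightarrow> 'm) \<times> 'm) \<Rightarrow> 'o \<Rightarrow> 'm \<Rightarrow> 'm \<Rightarrow> bool"
  assumes wo: "Well_order r" and z: "is_least r z"
    and sm: "\<And>a. a \<in> Field r \<Longrightarrow> small U (underS r a)" and f0: "f0 \<in> Hom C X0 N"
    and M: "M \<subseteq> Inflations C"
    and adm: "\<And>a g g' Y t h. a \<in> Field r \<Longrightarrow> (\<And>b. (b, a) \<in> r \<Longrightarrow> g b = g' b) \<Longrightarrow> Q a g Y t h = Q a g' Y t h"
    and step: "\<And>a g. \<lbrakk>a \<in> Field r; \<exists>b. ord_less r a b;
        \<And>b. (b, a) \<in> r \<Longrightarrow> row_arr g b \<in> Hom C (row_obj g b) N;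
        \<And>b. ord_less r b a \<Longrightarrow> row_map g b a \<in> Hom C (row_obj g b) (row_obj g a)
            \<and> row_arr g a \<cdot> row_map g b a = row_arr g b\<rbrakk>
      \<Longrightarrow> \<exists>Y t h. t \<in> M \<and> t \<in> Hom C (row_obj g a) Y \<and> h \<in> Hom C Y N \<and> h \<cdot> t = row_arr g a \<and> Q a g Y t h"
  obtains g where "chain C r (row_obj g) (row_map g)" "row_obj g z = X0" "row_arr g z = f0"
    "\<And>a. a \<in> Field r \<Longrightarrow> row_arr g a \<in> Hom C (row_obj g a) N"
    "\<And>a b. ord_less r a b \<Longrightarrow> row_arr g b \<cdot> row_map g a b = row_arr g a"
    "\<And>a b. is_successor r a b \<Longrightarrow> row_map g a b \<in> M \<and> Q a g (row_obj g b) (row_map g a b) (row_arr g b)"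
proof -
  have N: "N \<in> Obj C" "X0 \<in> Obj C" using f0 Hom_Obj by blast+
  have zF: "z \<in> Field r" using z unfolding is_least_def by simp
  \<comment> \<open>\<open>d\<close> is a candidate entry for stage \<open>a\<close>. The conditions
    on \<open>Q\<close> refer to the predecessor \<open>b\<close>, so an entry is judged when the
    step leading to it is taken.\<close>
  define P where "P g a d \<longleftrightarrow> (a \<in> Field r \<longrightarrow> fst d \<in> Obj C \<and> snd (snd d) \<in> Hom C (fst d) N \<and>
     (\<forall>b. ord_less r b a \<longrightarrow> fst (snd d) b \<in> Hom C (row_obj g b) (fst d) \<and> snd (snd d) \<cdot> fst (snd d) b = row_arr g b) \<and>
     (\<forall>b c. ord_less r c b \<and> ord_less r b a \<longrightarrow> fst (snd d) b \<cdot> row_map g c b = fst (snd d) c) \<and>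
     (a = z \<longrightarrow> fst d = X0 \<and> snd (snd d) = f0) \<and>
     (\<forall>b. is_successor r b a \<longrightarrow> fst (snd d) b \<in> M \<and> Q b g (fst d) (fst (snd d) b) (snd (snd d))) \<and>
     (is_limit r a \<longrightarrow> is_colimit C r (underS r a) (row_obj g) (row_map g) (fst d) (fst (snd d))))" for g a d
  have "\<exists>g. \<forall>a. P g a (g a)"
  proof (rule dependent_wf_choice[OF Well_order_wf[OF wo]])
    fix g g' :: "'u \<Rightarrow> 'o \<times> ('u \<Rightarrow> 'm) \<times> 'm" and a d
    assume eq: "\<And>y. (y, a) \<in> r - Relation.Id \<Longrightarrow> g y = g' y"
    have e1: "g y = g' y" if "ord_less r y a" for y using eq[of y] that unfolding ord_less_def by blast
    have e4: "Q b g Y t h = Q b g' Y t h" if "is_successor r b a" for b Y t h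
      by (rule adm[OF conjunct1[OF ord_less_Field[OF is_successor_less[OF that]]]])
        (use e1 ord_le_less_trans[OF wo _ is_successor_less[OF that]] in blast)
    have e5: "is_colimit C r (underS r a) (row_obj g) (row_map g) Y t
       \<longleftrightarrow> is_colimit C r (underS r a) (row_obj g') (row_map g') Y t" for Y t
      by (rule is_colimit_cong) (use e1 underS_iff in fastforce)+
    show "P g a d = P g' a d"
      unfolding P_def e5 using e1 by (simp add: e4 cong: conj_cong imp_cong)
  next
    fix a and g :: "'u \<Rightarrow> 'o \<times> ('u \<Rightarrow> 'm) \<times> 'm"
    assume IH: "\<And>y. (y, a) \<in> r - Relation.Id \<Longrightarrow> P g y (g y)"
    show "\<exists>d. P g a d"
    proof (cases "a \<in> Field r")
      case aF: True
      have IH': "row_obj g b \<in> Obj C" "row_arr g b \<in> Hom C (row_obj g b) N"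
        "ord_less r c b \<Longrightarrow> row_map g c b \<in> Hom C (row_obj g c) (row_obj g b)"
        "ord_less r c b \<Longrightarrow> row_arr g b \<cdot> row_map g c b = row_arr g c"
        "ord_less r c b \<Longrightarrow> ord_less r e c \<Longrightarrow> row_map g c b \<cdot> row_map g e c = row_map g e b"
        "is_successor r c b \<Longrightarrow> row_map g c b \<in> M"
        "is_limit r b \<Longrightarrow> is_colimit C r (underS r b) (row_obj g) (row_map g) (row_obj g b) (\<lambda>a. row_map g a b)"
        if "ord_less r b a" for b c e
        using IH[of b] that ord_less_Field[OF that] unfolding P_def ord_less_def by auto
      consider "is_least r a" | b where "is_successor r b a" | "is_limit r a"
        using least_successor_limit[OF aF] by blast
      then show ?thesis
      proof cases
        case 1
        have az: "a = z" by (rule is_least_unique[OF wo 1 z])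
        have nl: "\<And>b. \<not> ord_less r b a" using 1 unfolding is_least_def underS_def ord_less_def by blast
        have "\<not> is_successor r b a" "\<not> is_limit r a" for b
          using nl is_successor_less[of r b a] 1 unfolding is_limit_def by blast+
        \<comment> \<open>Nothing precedes the least index, so the family of maps into it is
          arbitrary.\<close>
        then have "P g a (X0, undefined, f0)" unfolding P_def using az nl N f0 by auto
        then show ?thesis ..
      next
        case 2
        note l = is_successor_less[OF 2]
        have az: "a \<noteq> z" using l z unfolding is_least_def underS_def ord_less_def by blast
        have nl: "\<not> is_limit r a" using 2 unfolding is_limit_def by blast
        have "\<exists>Y t h. t \<in> M \<and> t \<in> Hom C (row_obj g b) Y \<and> h \<in> Hom C Y N \<and> h \<cdot> t = row_arr g b \<and> Q b g Y t h"
        proof (rule step)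
          show "b \<in> Field r" "\<exists>c. ord_less r b c" using l ord_less_Field[OF l] by blast+
          show "row_arr g c \<in> Hom C (row_obj g c) N" if "(c, b) \<in> r" for c
            by (rule IH'(2)[OF ord_le_less_trans[OF wo that l]])
          show "row_map g c b \<in> Hom C (row_obj g c) (row_obj g b) \<and> row_arr g b \<cdot> row_map g c b = row_arr g c"
            if "ord_less r c b" for c
            using IH'(3,4)[OF l that] by blast
        qed
        then obtain Y t h where Y: "t \<in> M" "t \<in> Hom C (row_obj g b) Y" "h \<in> Hom C Y N"
          "h \<cdot> t = row_arr g b" "Q b g Y t h" by blast
        \<comment> \<open>All maps into the new stage pass through its predecessor \<open>b\<close>,
          from which \<open>t\<close> leads on.\<close>
        define s where "s c = (if c = b then t else t \<cdot> row_map g c b)" for c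
        have lb: "c = b \<or> ord_less r c b" if "ord_less r c a" for c
          using is_successor_le[OF wo 2 that] unfolding ord_less_def by blast
        have s1: "s c \<in> Hom C (row_obj g c) Y \<and> h \<cdot> s c = row_arr g c" if c: "ord_less r c a" for c
        proof (cases "c = b")
          case False
          then have cb: "ord_less r c b" using lb[OF c] by blast
          have "h \<cdot> s c = (h \<cdot> t) \<cdot> row_map g c b"
            using False Y(2,3) IH'(3)[OF l cb] unfolding s_def by (simp add: Hom_iff)
          then show ?thesis using Y(2,4) IH'(3,4)[OF l cb] False unfolding s_def by (simp add: Hom_iff)
        qed (use Y in \<open>simp add: s_def\<close>)
        have s2: "s d \<cdot> row_map g c d = s c" if cd: "ord_less r c d" "ord_less r d a" for c d
        proof -
          have cb: "ord_less r c b" using cd lb[OF cd(2)] ord_less_trans[OF wo cd(1)] by blast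
          then have nc: "c \<noteq> b" unfolding ord_less_def by blast
          show ?thesis
          proof (cases "d = b")
            case True
            then show ?thesis using nc unfolding s_def by simp
          next
            case False
            then have db: "ord_less r d b" using lb[OF cd(2)] by blast
            then show ?thesis
              using False nc Y(2) IH'(3)[OF l db] IH'(3)[OF cd(2,1)] IH'(5)[OF l db cd(1)]
              unfolding s_def by (simp add: Hom_iff)
          qed
        qed
        have "P g a (Y, s, h)"
          unfolding P_def
          using s1 s2 az nl Y Hom_Obj[OF Y(2)] is_successor_unique[OF wo 2] by (auto simp: s_def)
        then show ?thesis ..
      next
        case 3
        let ?S = "underS r a"
        have S: "?S \<subseteq> Field r" using underS_iff ord_less_Field by (metis subsetI)
        have cv: "convex_in r ?S"
          unfolding convex_in_def Ball_def underS_iff using S ord_le_less_trans[OF wo] by blast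
        have F: "Field (Restr r ?S) = ?S" by (rule Field_Restr'[OF wo S])
        have az: "a \<noteq> z" and zl: "ord_less r z a"
          using 3 z is_leastD[OF wo z aF] unfolding is_limit_def ord_less_def by blast+
        have lim: "is_colimit C (Restr r ?S) (underS (Restr r ?S) b) (row_obj g) (row_map g) (row_obj g b) (\<lambda>c. row_map g c b)"
          if "is_limit (Restr r ?S) b" for b
        proof -
          have b: "b \<in> ?S" "is_limit r b" using that is_limit_Restr[OF wo cv] by auto
          then have ba: "ord_less r b a" using underS_iff by fast
          have eq: "underS (Restr r ?S) b = underS r b"
            unfolding underS_Restr[OF b(1)] using ord_less_trans[OF wo _ ba] by (auto simp: underS_iff)
          then have "underS r b \<subseteq> ?S" unfolding underS_Restr[OF b(1)] by blast
          then show ?thesis unfolding eq using IH'(7)[OF ba b(2)] by (simp add: is_colimit_Restr)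
        qed
        have ds: "direct_system C (Restr r ?S) (row_obj g) (row_map g)"
          unfolding direct_system_def F ord_less_Restr Ball_def underS_iff using IH' by blast
        \<comment> \<open>Below a limit the stages already built form a small chain, so
          \<open>Ax1\<close> gives a colimit; their maps to \<open>N\<close> are a cocone and induce
          the map of the new stage.\<close>
        have "chain C (Restr r ?S) (row_obj g) (row_map g)"
          unfolding chain_def using Well_order_Restr[OF wo] ds lim by blast
        then have tf: "transfinite_seq U C (Restr r ?S) (row_obj g) (row_map g)"
          unfolding transfinite_seq_iff F using sm[OF aF] by blast
        have zS: "z \<in> ?S" using zl underS_iff by fast
        have "is_least (Restr r ?S) z"
          unfolding is_least_Restr[OF wo S] using zS is_leastD[OF wo z] S by blast
        moreover have "successor_maps_in (Restr r ?S) (row_map g) (Inflations C)"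
          unfolding successor_maps_in_def is_successor_Restr[OF wo cv] underS_iff using IH'(6) M by blast
        ultimately obtain L c where "is_colimit C (Restr r ?S) (Field (Restr r ?S)) (row_obj g) (row_map g) L c"
          using Ax1[OF tf] by blast
        then have L: "is_colimit C r ?S (row_obj g) (row_map g) L c" unfolding F by (simp add: is_colimit_Restr)
        note co = coconeD[OF colimit_cocone[OF L]]
        have "is_cocone C r ?S (row_obj g) (row_map g) N (row_arr g)"
          unfolding is_cocone_def Ball_def underS_iff using IH' N by blast
        then obtain h where h: "h \<in> Hom C L N" "\<And>b. b \<in> ?S \<Longrightarrow> h \<cdot> c b = row_arr g b"
          by (rule colimit_factor[OF L]) blast
        have "\<not> is_successor r b a" for b using 3 unfolding is_limit_def by blast
        then have "P g a (L, c, h)"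
          unfolding P_def using co h L az ord_less_trans[OF wo] by (auto simp: underS_iff)
        then show ?thesis ..
      qed
    qed (simp add: P_def)
  qed
  then obtain g where g: "\<And>a. P g a (g a)" by blast
  have H: "row_obj g a \<in> Obj C" "row_arr g a \<in> Hom C (row_obj g a) N"
    "ord_less r b a \<Longrightarrow> row_map g b a \<in> Hom C (row_obj g b) (row_obj g a)"
    "ord_less r b a \<Longrightarrow> row_arr g a \<cdot> row_map g b a = row_arr g b"
    "ord_less r c b \<Longrightarrow> ord_less r b a \<Longrightarrow> row_map g b a \<cdot> row_map g c b = row_map g c a"
    "is_successor r b a \<Longrightarrow> row_map g b a \<in> M \<and> Q b g (row_obj g a) (row_map g b a) (row_arr g a)"
    "is_limit r a \<Longrightarrow> is_colimit C r (underS r a) (row_obj g) (row_map g) (row_obj g a) (\<lambda>b. row_map g b a)"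
    if "a \<in> Field r" for a b c
    using g[of a] that unfolding P_def by auto
  have "chain C r (row_obj g) (row_map g)"
    unfolding chain_def direct_system_def using wo H ord_less_Field is_limit_def by metis
  moreover have "row_obj g z = X0" "row_arr g z = f0" using g[of z] zF unfolding P_def by auto
  ultimately show ?thesis using that H ord_less_Field is_successor_less by metis
qed

end

section \<open>Smallness, repetition and cofinality in \<open>|U|\<close>\<close>

lemma card_of_wo: "Well_order |A|"
  by (rule card_of_Well_order)

lemma small_underS:
  assumes "size_universe U"
  shows "small U (underS |U| a)"
proof (cases "a \<in> U")
  case True
  then show ?thesis unfolding small_def using card_of_underS[OF card_of_Card_order, of a U] by (simp add: Field_card_of)
next
  case False
  then have "underS |U| a = {}"
    using Well_orderD(2)[OF card_of_wo, of _ a U] unfolding underS_def by (auto simp: Field_card_of)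
  then show ?thesis using small_finite[OF assms, of "{}"] by simp
qed

lemma small_under:
  assumes "size_universe U"
  shows "small U {b. (b, a) \<in> |U|}"
  by (rule small_subset[OF small_Un[OF assms small_underS[OF assms, of a] small_finite[OF assms, of "{a}"]]])
    (auto simp: underS_def)

text \<open>This is regularity of \<open>|U|\<close>. It yields an \<open>a\<close> with no element
  of \<open>B\<close> strictly above it, and the strict bound is found one step further, as an
  infinite cardinal has no last element.\<close>

lemma small_not_cofinal:
  assumes "size_universe U" "small U B" "B \<subseteq> U"
  obtains a where "a \<in> U" "\<And>b. b \<in> B \<Longrightarrow> ord_less |U| b a"
proof -
  note wo = card_of_wo[of U]
  have "\<not> |B| =o |U|" using assms(2) not_ordLess_ordIso unfolding small_def by blast
  then have "\<not> cofinal B |U|"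
    using assms(1,3) unfolding size_universe_def regularCard_def by (auto simp: Field_card_of)
  then obtain a where a: "a \<in> U" "\<And>b. b \<in> B \<Longrightarrow> a = b \<or> (a, b) \<notin> |U|"
    unfolding cofinal_def by (auto simp: Field_card_of)
  obtain a' where a': "a' \<in> U" "ord_less |U| a a'"
    using infinite_Card_order_limit[OF card_of_Card_order, of U a] size_universe_infinite[OF assms(1)] a(1)
    unfolding ord_less_def by (auto simp: Field_card_of)
  have "ord_less |U| b a'" if b: "b \<in> B" for b
  proof -
    have bU: "b \<in> U" using b assms(3) by blast
    then have "(b, a) \<in> |U|"
      using a(2)[OF b] Well_orderD(6)[OF wo, of a b] Well_orderD(3)[OF wo, of a] a(1) by (auto simp: Field_card_of)
    then show ?thesis by (rule ord_le_less_trans[OF wo _ a'(2)])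
  qed
  then show ?thesis using that a'(1) by blast
qed

lemma small_stable: "size_universe U \<Longrightarrow> stable |U|"
  unfolding size_universe_def cinfinite_def
  by (rule regularCard_stable[OF card_of_Card_order]) (auto simp: Field_card_of)

lemma small_Sigma: "size_universe U \<Longrightarrow> small U A \<Longrightarrow> (\<And>a. a \<in> A \<Longrightarrow> small U (F a)) \<Longrightarrow> small U (Sigma A F)"
  unfolding small_def using stable_elim[OF small_stable] by blast

lemma small_UNION: "size_universe U \<Longrightarrow> small U A \<Longrightarrow> (\<And>a. a \<in> A \<Longrightarrow> small U (F a)) \<Longrightarrow> small U (\<Union>a\<in>A. F a)"
  unfolding small_def using stable_UNION[OF small_stable] by blast

lemma small_surj:
  assumes "small U A" "A \<noteq> {}"
  obtains f where "f ` U = A"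
  using assms card_of_ordLeq2[of A U] ordLess_imp_ordLeq unfolding small_def by blast

text \<open>A map onto the pairs that takes each value \<open>|U|\<close> many times takes each
  value beyond every index, because the indices up to \<open>b\<close> are small in number.\<close>

lemma bookkeeping:
  assumes "size_universe U"
  obtains e :: "'u \<Rightarrow> 'u \<times> 'u" where
    "\<And>p q b. \<lbrakk>p \<in> U; q \<in> U; b \<in> U\<rbrakk> \<Longrightarrow> \<exists>a \<in> U. ord_less |U| b a \<and> e a = (p, q)" "e ` U \<subseteq> U \<times> U"
proof -
  note inf = size_universe_infinite[OF assms] and wo = card_of_wo[of U]
  have "|U \<times> U| =o |U|" by (rule card_of_Times_same_infinite[OF inf])
  then obtain k where k: "bij_betw k U (U \<times> U)"
    using card_of_ordIso[of U "U \<times> U"] ordIso_symmetric by blast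
  then have kU: "k a \<in> U \<times> U" if "a \<in> U" for a using that unfolding bij_betw_def by blast
  \<comment> \<open>Pairing twice gives a map onto triples; forgetting the third entry leaves a
    fibre of size \<open>|U|\<close> over every pair.\<close>
  define \<phi> where "\<phi> a = (k (fst (k a)), snd (k a))" for a
  have sur: "\<exists>a. a \<in> U \<and> \<phi> a = ((p, q), u)" if pqu: "p \<in> U" "q \<in> U" "u \<in> U" for p q u
  proof -
    have "(p, q) \<in> k ` U" using k pqu unfolding bij_betw_def by blast
    then obtain b where b: "b \<in> U" "k b = (p, q)" by force
    have "(b, u) \<in> k ` U" using k pqu b unfolding bij_betw_def by blast
    then obtain a where "a \<in> U" "k a = (b, u)" by force
    then show ?thesis using b unfolding \<phi>_def by auto
  qed
  have "\<exists>a \<in> U. ord_less |U| b a \<and> fst (\<phi> a) = (p, q)" if pqb: "p \<in> U" "q \<in> U" "b \<in> U" for p q b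
  proof (rule ccontr)
    assume n: "\<not> ?thesis"
    obtain \<psi> where \<psi>: "\<And>u. u \<in> U \<Longrightarrow> \<psi> u \<in> U \<and> \<phi> (\<psi> u) = ((p, q), u)"
      using sur[OF pqb(1,2)] by metis
    have "\<psi> ` U \<subseteq> {a. (a, b) \<in> |U|}"
    proof
      fix a assume "a \<in> \<psi> ` U"
      then have a: "a \<in> U" "fst (\<phi> a) = (p, q)" using \<psi> by auto
      then have "\<not> ord_less |U| b a" using n by blast
      then show "a \<in> {a. (a, b) \<in> |U|}" using ord_not_le[OF wo, of a b] a pqb by (auto simp: Field_card_of)
    qed
    then have s: "small U (\<psi> ` U)" using small_subset[OF small_under[OF assms]] by blast
    have "inj_on \<psi> U" by (rule inj_onI) (metis \<psi> snd_conv)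
    then have "|\<psi> ` U| =o |U|"
      using card_of_ordIso[of U "\<psi> ` U"] inj_on_imp_bij_betw ordIso_symmetric by blast
    then show False using s not_ordLess_ordIso unfolding small_def by blast
  qed
  moreover have "fst (\<phi> a) \<in> U \<times> U" if "a \<in> U" for a
    using kU[of "fst (k a)"] kU[OF that] unfolding \<phi>_def by (auto simp: mem_Times_iff)
  then have "(\<lambda>a. fst (\<phi> a)) ` U \<subseteq> U \<times> U" by blast
  ultimately show ?thesis using that[of "\<lambda>a. fst (\<phi> a)"] by blast
qed

text \<open>\<open>d\<close> is the supremum of a strictly increasing sequence of length
  \<open>\<kappa>\<close> that at each step climbs over the values of \<open>H\<close> reached so
  far. The length \<open>\<kappa>\<close> gives the cofinality, and since \<open>\<kappa>\<close> is
  small and \<open>|U|\<close> regular, the sequence is bounded.\<close>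

lemma closed_limit_exists:
  fixes U :: "'u set" and \<kappa> :: "'u rel"
  assumes su: "size_universe U" and \<kappa>: "Cinfinite \<kappa>" "regularCard \<kappa>" "small U (Field \<kappa>)"
    and z: "z \<in> U" and H: "\<And>a. a \<in> U \<Longrightarrow> H a \<in> U"
  obtains d where "d \<in> U" "ord_less |U| z d" "is_limit |U| d"
    "\<And>a. ord_less |U| a d \<Longrightarrow> ord_less |U| (H a) d"
    "cofinality_ge (Restr |U| {c. (z, c) \<in> |U| \<and> ord_less |U| c d}) \<kappa>"
proof -
  let ?r = "|U|"
  note wo = card_of_wo[of U]
  have F: "Field ?r = U" by (rule Field_card_of)
  have ck: "Card_order \<kappa>" "infinite (Field \<kappa>)" using \<kappa>(1) unfolding cinfinite_def by auto
  then have wk: "Well_order \<kappa>" by (simp add: card_order_on_well_order_on)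
  \<comment> \<open>\<open>H\<close> may fail to be monotone, so \<open>H' a\<close> bounds its
    values at all indices up to \<open>a\<close> together.\<close>
  have "\<exists>c \<in> U. \<forall>b. (b, a) \<in> ?r \<longrightarrow> ord_less ?r (H b) c" for a
  proof -
    have "small U (H ` {b. (b, a) \<in> ?r})" by (rule small_image[OF small_under[OF su]])
    moreover have "H ` {b. (b, a) \<in> ?r} \<subseteq> U" using H Well_orderD(1)[OF wo] F by auto
    ultimately obtain c where "c \<in> U" "\<And>b. b \<in> H ` {b. (b, a) \<in> ?r} \<Longrightarrow> ord_less ?r b c"
      by (rule small_not_cofinal[OF su]) blast
    then show ?thesis by blast
  qed
  then obtain H' where H': "\<And>a. H' a \<in> U" "\<And>a b. (b, a) \<in> ?r \<Longrightarrow> ord_less ?r (H b) (H' a)" by metis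
  define P where "P g \<xi> x \<longleftrightarrow> (\<xi> \<in> Field \<kappa> \<longrightarrow> x \<in> U \<and> ord_less ?r z x \<and>
     (\<forall>\<eta>. ord_less \<kappa> \<eta> \<xi> \<longrightarrow> ord_less ?r (g \<eta>) x \<and> ord_less ?r (H' (g \<eta>)) x))" for g \<xi> x
  have "\<exists>g. \<forall>\<xi>. P g \<xi> (g \<xi>)"
  proof (rule dependent_wf_choice[OF Well_order_wf[OF wk]])
    show "P g \<xi> x = P g' \<xi> x" if "\<And>y. (y, \<xi>) \<in> \<kappa> - Relation.Id \<Longrightarrow> g y = g' y" for g g' \<xi> x
      using that unfolding P_def ord_less_def by auto
    fix \<xi> g assume IH: "\<And>y. (y, \<xi>) \<in> \<kappa> - Relation.Id \<Longrightarrow> P g y (g y)"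
    let ?u = "underS \<kappa> \<xi>"
    let ?B = "insert z (g ` ?u \<union> (\<lambda>\<eta>. H' (g \<eta>)) ` ?u)"
    have "?u \<subseteq> Field \<kappa>" unfolding underS_def by (auto simp: FieldI1)
    then have su': "small U ?u" by (rule small_subset[OF \<kappa>(3)])
    have "small U ?B"
      using small_Un[OF su small_finite[OF su, of "{z}"] small_Un[OF su small_image[OF su', of g] small_image[OF su', of "\<lambda>\<eta>. H' (g \<eta>)"]]] by simp
    moreover have "?B \<subseteq> U"
      using z H'(1) IH \<open>?u \<subseteq> Field \<kappa>\<close> unfolding P_def underS_def by auto
    ultimately obtain x where x: "x \<in> U" "\<And>b. b \<in> ?B \<Longrightarrow> ord_less ?r b x"
      by (rule small_not_cofinal[OF su]) blast
    then have "P g \<xi> x" unfolding P_def by (auto simp: underS_iff)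
    then show "\<exists>x. P g \<xi> x" ..
  qed
  then obtain g where g: "\<And>\<xi>. \<xi> \<in> Field \<kappa> \<Longrightarrow> g \<xi> \<in> U" "\<And>\<xi>. \<xi> \<in> Field \<kappa> \<Longrightarrow> ord_less ?r z (g \<xi>)"
    "\<And>\<eta> \<xi>. ord_less \<kappa> \<eta> \<xi> \<Longrightarrow> ord_less ?r (g \<eta>) (g \<xi>)"
    "\<And>\<eta> \<xi>. ord_less \<kappa> \<eta> \<xi> \<Longrightarrow> ord_less ?r (H' (g \<eta>)) (g \<xi>)"
    unfolding P_def using ord_less_Field[of \<kappa>] by metis
  let ?D = "{d \<in> U. \<forall>\<xi> \<in> Field \<kappa>. ord_less ?r (g \<xi>) d}"
  obtain d0 where "d0 \<in> U" "\<And>b. b \<in> g ` Field \<kappa> \<Longrightarrow> ord_less ?r b d0"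
    by (rule small_not_cofinal[OF su small_image[OF \<kappa>(3)], of g]) (use g(1) in auto)
  then have d0: "d0 \<in> ?D" by blast
  \<comment> \<open>The least strict upper bound: minimality is what makes the sequence cofinal
    below \<open>d\<close>.\<close>
  obtain d where d: "d \<in> ?D" "\<And>y. (y, d) \<in> ?r - Relation.Id \<Longrightarrow> y \<notin> ?D"
    by (rule wfE_min[OF Well_order_wf[OF wo] d0]) blast
  have dU: "d \<in> U" and gd: "\<And>\<xi>. \<xi> \<in> Field \<kappa> \<Longrightarrow> ord_less ?r (g \<xi>) d" using d(1) by auto
  have below: "\<exists>\<xi> \<in> Field \<kappa>. (a, g \<xi>) \<in> ?r" if a: "ord_less ?r a d" for a
  proof (rule ccontr)
    assume n: "\<not> ?thesis"
    have aU: "a \<in> U" using ord_less_Field[OF a] F by simp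
    then have "a \<in> ?D" using n ord_not_le[OF wo, of a] g(1) F by auto
    then show False using d(2)[of a] a unfolding ord_less_def by blast
  qed
  have next\<kappa>: "\<exists>\<eta>. ord_less \<kappa> \<xi> \<eta> \<and> \<eta> \<in> Field \<kappa>" if "\<xi> \<in> Field \<kappa>" for \<xi>
    using infinite_Card_order_limit[OF ck that] unfolding ord_less_def by blast
  obtain \<xi>0 where \<xi>0: "\<xi>0 \<in> Field \<kappa>" using ck(2) infinite_imp_nonempty by blast
  have zd: "ord_less ?r z d" by (rule ord_less_trans[OF wo g(2)[OF \<xi>0] gd[OF \<xi>0]])
  have between: "\<exists>\<xi> \<in> Field \<kappa>. ord_less ?r a (g \<xi>)" if a: "ord_less ?r a d" for a
  proof -
    obtain \<xi> where \<xi>: "\<xi> \<in> Field \<kappa>" "(a, g \<xi>) \<in> ?r" using below[OF a] by blast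
    obtain \<eta> where "ord_less \<kappa> \<xi> \<eta>" "\<eta> \<in> Field \<kappa>" using next\<kappa>[OF \<xi>(1)] by blast
    then show ?thesis using ord_le_less_trans[OF wo \<xi>(2) g(3)] by blast
  qed
  have lim: "is_limit ?r d"
  proof -
    have "\<not> is_least ?r d" using zd unfolding is_least_def underS_def ord_less_def by blast
    moreover have "\<not> is_successor ?r a d" for a
      using between[of a] gd unfolding is_successor_def by blast
    ultimately show ?thesis unfolding is_limit_def F using dU by blast
  qed
  have closed: "ord_less ?r (H a) d" if a: "ord_less ?r a d" for a
  proof -
    obtain \<xi> where \<xi>: "\<xi> \<in> Field \<kappa>" "(a, g \<xi>) \<in> ?r" using below[OF a] by blast
    obtain \<eta> where \<eta>: "ord_less \<kappa> \<xi> \<eta>" "\<eta> \<in> Field \<kappa>" using next\<kappa>[OF \<xi>(1)] by blast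
    show ?thesis
      using ord_less_trans[OF wo H'(2)[OF \<xi>(2)] ord_less_trans[OF wo g(4)[OF \<eta>(1)] gd[OF \<eta>(2)]]] .
  qed
  let ?A = "{c. (z, c) \<in> ?r \<and> ord_less ?r c d}"
  have A: "?A \<subseteq> Field ?r" using Well_orderD(2)[OF wo] by blast
  have "cofinality_ge (Restr ?r ?A) \<kappa>"
    unfolding cofinality_ge_def Field_Restr'[OF wo A]
  proof (intro allI impI)
    fix B assume B: "B \<subseteq> ?A" and cof: "\<forall>a \<in> ?A. \<exists>b \<in> B. (a, b) \<in> Restr ?r ?A"
    show "\<kappa> \<le>o |B|"
    proof (rule ccontr)
      assume "\<not> \<kappa> \<le>o |B|"
      then have Bk: "|B| <o \<kappa>" using ordLess_or_ordLeq[OF card_of_wo wk] by blast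
      have "\<exists>\<xi> \<in> Field \<kappa>. (b, g \<xi>) \<in> ?r" if "b \<in> B" for b using below B that by blast
      then obtain x where x: "\<And>b. b \<in> B \<Longrightarrow> x b \<in> Field \<kappa>" "\<And>b. b \<in> B \<Longrightarrow> (b, g (x b)) \<in> ?r" by metis
      have "|x ` B| <o \<kappa>" using Bk card_of_image ordLeq_ordLess_trans by blast
      then have "\<not> |x ` B| =o \<kappa>" using not_ordLess_ordIso by blast
      then have "\<not> cofinal (x ` B) \<kappa>" using \<kappa>(2) x(1) unfolding regularCard_def by blast
      then obtain \<xi> where \<xi>: "\<xi> \<in> Field \<kappa>" "\<And>b. b \<in> B \<Longrightarrow> \<not> ord_less \<kappa> \<xi> (x b)"
        unfolding cofinal_def ord_less_def by blast
      obtain \<eta> where \<eta>: "ord_less \<kappa> \<xi> \<eta>" "\<eta> \<in> Field \<kappa>" using next\<kappa>[OF \<xi>(1)] by blast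
      \<comment> \<open>A cofinal \<open>B\<close> with fewer than \<open>\<kappa>\<close> elements
        sits below sequence terms whose positions are bounded by some \<open>\<xi>\<close>, by
        regularity of \<open>\<kappa>\<close>. The term at a later position \<open>\<eta>\<close>
        then lies above all of \<open>B\<close>, against cofinality.\<close>
      have "g \<eta> \<in> ?A" using g(2)[OF \<eta>(2)] gd[OF \<eta>(2)] unfolding ord_less_def by blast
      then obtain b where b: "b \<in> B" "(g \<eta>, b) \<in> ?r" using cof by blast
      have "(x b, \<xi>) \<in> \<kappa>" using \<xi>(2)[OF b(1)] ord_not_le[OF wk x(1)[OF b(1)] \<xi>(1)] by blast
      then have "ord_less \<kappa> (x b) \<eta>" by (rule ord_le_less_trans[OF wk _ \<eta>(1)])
      then have "ord_less ?r (g (x b)) (g \<eta>)" by (rule g(3))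
      moreover have "(g \<eta>, g (x b)) \<in> ?r" by (rule Well_orderD(4)[OF wo b(2) x(2)[OF b(1)]])
      ultimately show False using Well_orderD(5)[OF wo] unfolding ord_less_def by blast
    qed
  qed
  then show ?thesis using that[OF dU zd lim closed] by blast
qed

section \<open>Lifting against pushouts, lifting problems, and smallness of objects\<close>

context category
begin

lemma lifts_pushout:
  assumes "is_pushout C i a j b" "lifts C i q" "q \<in> Arr C"
  shows "lifts C j q"
proof (rule liftsI[of j "Cod C a" "Cod C j" q "Dom C q" "Cod C q"])
  note d = pushoutD[OF assms(1)]
  show "j \<in> Hom C (Cod C a) (Cod C j)" using d by (simp add: Hom_iff)
  show qH: "q \<in> Hom C (Dom C q) (Cod C q)" by (rule Arr_in_Hom[OF assms(3)])
  fix u v assume u: "u \<in> Hom C (Cod C a) (Dom C q)" and v: "v \<in> Hom C (Cod C j) (Cod C q)" and quv: "q \<cdot> u = v \<cdot> j"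
  have ua: "u \<cdot> a \<in> Hom C (Dom C i) (Dom C q)" and vb: "v \<cdot> b \<in> Hom C (Cod C i) (Cod C q)"
    using u v d by (simp_all add: Hom_iff)
  have "q \<cdot> (u \<cdot> a) = (v \<cdot> j) \<cdot> a" using quv u d assms(3) Cmp_rewrite[OF quv, of a] by (simp add: Hom_iff)
  also have "\<dots> = v \<cdot> (j \<cdot> a)" using v d by (simp add: Hom_iff)
  also have "\<dots> = (v \<cdot> b) \<cdot> i" unfolding d(9) using v d by (simp add: Hom_iff)
  finally obtain l where l: "l \<in> Hom C (Cod C i) (Dom C q)" "l \<cdot> i = u \<cdot> a" "q \<cdot> l = v \<cdot> b"
    by (rule liftsE[OF assms(2) Arr_in_Hom[OF d(1)] qH ua vb])
  obtain h where h: "h \<in> Hom C (Cod C j) (Dom C q)" "h \<cdot> j = u" "h \<cdot> b = l"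
    by (rule pushout_factor[OF assms(1) u l(1) l(2)[symmetric]])
  have "q \<cdot> h = v"
  proof (rule pushout_unique[OF assms(1), of _ "Cod C q"])
    show "(q \<cdot> h) \<cdot> j = v \<cdot> j" using h(1,2) d assms(3) quv by (simp add: Hom_iff)
    show "(q \<cdot> h) \<cdot> b = v \<cdot> b" using h(1,3) d assms(3) l(3) by (simp add: Hom_iff)
  qed (use h v assms(3) in \<open>simp_all add: Hom_iff\<close>)
  then show "\<exists>l. l \<in> Hom C (Cod C j) (Dom C q) \<and> l \<cdot> j = u \<and> q \<cdot> l = v" using h by blast
qed

lemma push_Hom:
  assumes "a = b \<or> i a b \<in> Hom C (X a) (X b)" "f \<in> Hom C A (X a)"
  shows "push C i a b f \<in> Hom C A (X b)"
  using assms unfolding push_def by (auto simp: Hom_iff)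

text \<open>Of smallness, only the surjectivity of the comparison map is needed.\<close>

lemma colim_Hom_factor:
  assumes wo: "Well_order r" and c: "is_cocone C r (Field r) Y i L c" and ds: "direct_system C r Y i"
    and s: "colim_Hom_map C c ` colim_Hom C r X Y i = Hom C X L" and u: "u \<in> Hom C X L"
  obtains b x where "b \<in> Field r" "x \<in> Hom C X (Y b)" "c b \<cdot> x = u"
proof -
  let ?D = "SIGMA a : Field r. Hom C X (Y a)"
  let ?R = "{((a, f), (b, g)). (a, f) \<in> ?D \<and> (b, g) \<in> ?D \<and>
                  (\<exists>c. (a, c) \<in> r \<and> (b, c) \<in> r \<and> push C i a c f = push C i b c g)}"
  have cp: "c a \<cdot> f = c e \<cdot> push C i a e f" if "(a, e) \<in> r" "f \<in> Hom C X (Y a)" for a e f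
  proof (cases "a = e")
    case False
    then have l: "ord_less r a e" using that unfolding ord_less_def by simp
    have "c e \<cdot> push C i a e f = (c e \<cdot> i a e) \<cdot> f"
      using False that(2) coconeD(2)[OF c] ord_less_Field[OF l] direct_systemD(2)[OF ds l]
      unfolding push_def by (simp add: Hom_iff)
    then show ?thesis using coconeD(3)[OF c _ _ l] ord_less_Field[OF l] by simp
  qed (simp add: push_def)
  obtain K where K: "K \<in> colim_Hom C r X Y i" "colim_Hom_map C c K = u"
    using s u by (metis imageE)
  then have "K \<in> ?D // ?R" unfolding colim_Hom_def Let_def by simp
  then obtain a f where af: "(a, f) \<in> ?D" "K = ?R `` {(a, f)}" by (rule quotientE) force
  \<comment> \<open>The canonical map is defined by \<open>the_elem\<close>, so all representatives
    of the class must give the same composite before its value can be read off.\<close>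
  have same: "c b \<cdot> g = c a \<cdot> f" if bg: "(b, g) \<in> K" for b g
  proof -
    obtain e where e: "(a, e) \<in> r" "(b, e) \<in> r" "push C i a e f = push C i b e g" "(b, g) \<in> ?D"
      using bg unfolding af(2) by auto
    then show ?thesis using cp[of a e f] cp[of b e g] af(1) by auto
  qed
  have "(a, a) \<in> r" using af(1) Well_orderD(3)[OF wo] by blast
  then have afK: "(a, f) \<in> K" using af(1) unfolding af(2) by auto
  have "(\<lambda>(a, f). c a \<cdot> f) ` K = {c a \<cdot> f}"
  proof (intro equalityI subsetI)
    fix v assume "v \<in> (\<lambda>(a, f). c a \<cdot> f) ` K"
    then show "v \<in> {c a \<cdot> f}" using same by (auto simp del: Cmp_assoc')
  next
    fix v assume "v \<in> {c a \<cdot> f}"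
    then show "v \<in> (\<lambda>(a, f). c a \<cdot> f) ` K" using afK by (intro image_eqI[of _ _ "(a, f)"]) simp_all
  qed
  then have "c a \<cdot> f = u" using K(2) unfolding colim_Hom_map_def by simp
  then show ?thesis using that af(1) by blast
qed

end

context sized_efficient
begin

lemma small_Hom: "X \<in> Obj C \<Longrightarrow> Y \<in> Obj C \<Longrightarrow> small U (Hom C X Y)"
  using locally_small unfolding locally_small_def by blast

text \<open>The lifting problems of members of \<open>I\<close> against
  \<open>f : X \<rightarrow> N\<close>.\<close>

definition squares :: "'m set \<Rightarrow> 'o \<Rightarrow> 'o \<Rightarrow> 'm \<Rightarrow> ('m \<times> 'm \<times> 'm) set" where
  "squares I N X f = {(i, x, y). i \<in> I \<and> x \<in> Hom C (Dom C i) X \<and> y \<in> Hom C (Cod C i) N \<and> f \<cdot> x = y \<cdot> i}"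

lemma small_squares:
  assumes "small U I" "I \<subseteq> Arr C" "X \<in> Obj C" "N \<in> Obj C"
  shows "small U (squares I N X f)"
proof (rule small_subset)
  show "squares I N X f \<subseteq> (SIGMA i:I. SIGMA x:Hom C (Dom C i) X. Hom C (Cod C i) N)"
    unfolding squares_def by blast
  show "small U (SIGMA i:I. SIGMA x:Hom C (Dom C i) X. Hom C (Cod C i) N)"
    using assms Dom_Obj Cod_Obj by (intro small_Sigma[OF size] small_Hom) auto
qed

text \<open>The zero maps form a lifting problem. Enumerating the problems by the elements of
  \<open>U\<close> presupposes that there is one.\<close>

lemma squares_nonempty:
  assumes "i \<in> I" "I \<subseteq> Arr C" "f \<in> Hom C X N"
  shows "squares I N X f \<noteq> {}"
proof -
  have o: "X \<in> Obj C" "N \<in> Obj C" "i \<in> Arr C" using assms Hom_Obj by blast+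
  then have "(i, Zero C (Dom C i) X, Zero C (Cod C i) N) \<in> squares I N X f"
    unfolding squares_def using assms(1,3) Dom_Obj[of i] Cod_Obj[of i] by (simp add: Hom_iff)
  then show ?thesis by blast
qed

lemma isomorphic_refl: "X \<in> Obj C \<Longrightarrow> isomorphic C X X"
  unfolding isomorphic_def using is_iso_Id Id_Hom by blast

text \<open>Membership in \<open>Coker_class\<close> is up to isomorphism; composing the cokernel
  map with the isomorphism produces a cokernel in \<open>\<S>\<close> itself.\<close>

lemma Coker_class_inflations:
  assumes "I \<subseteq> Inflations C" "Coker_class C I = {X \<in> Obj C. \<exists>S \<in> \<S>. isomorphic C X S}"
  shows "I \<subseteq> inflations_with_coker_in C \<S>"
proof
  fix i assume i: "i \<in> I"
  then obtain p where p: "(i, p) \<in> Conflations C" using assms(1) unfolding Inflations_def by blast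
  note c = conflationD[OF conflationI[OF p]]
  have "Cod C p \<in> Coker_class C I"
    unfolding Coker_class_def using i p c isomorphic_refl by blast
  then obtain S h where S: "S \<in> \<S>" "h \<in> Hom C (Cod C p) S" "is_iso C h"
    unfolding assms(2) isomorphic_def by blast
  have "conflation C (Dom C i) i (Cod C i) (h \<cdot> p) S"
    by (rule conflation_iso_right[OF conflationI[OF p] S(2,3)])
  then show "i \<in> inflations_with_coker_in C \<S>"
    unfolding inflations_with_coker_in_def conflation_def using S(1) by (auto simp: Hom_iff)
qed

text \<open>Raising the cardinal leaves fewer index orders to consider, so one regular
  \<open>\<kappa>\<close> above the cardinals of all \<open>A i\<close> works for all of them. A
  small such \<open>\<kappa>\<close> exists because a small union of small sets is small.\<close>

lemma uniform_smallness:
  assumes "small U I" "\<And>i. i \<in> I \<Longrightarrow> A i \<in> Obj C"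
  obtains \<kappa> :: "'u rel" where "Cinfinite \<kappa>" "regularCard \<kappa>" "small U (Field \<kappa>)"
    "\<And>i (r :: 'u rel) Y k L c u. \<lbrakk>i \<in> I; transfinite_seq U C r Y k; cofinality_ge r \<kappa>;
        successor_maps_in r k (Inflations C); is_colimit C r (Field r) Y k L c; u \<in> Hom C (A i) L\<rbrakk>
      \<Longrightarrow> \<exists>b \<in> Field r. \<exists>x \<in> Hom C (A i) (Y b). c b \<cdot> x = u"
proof -
  have "\<exists>\<kappa> :: 'u rel. Cinfinite \<kappa> \<and> small U (Field \<kappa>) \<and>
        (\<forall>(r :: 'u rel) Y k L c.
           transfinite_seq U C r Y k \<and> cofinality_ge r \<kappa> \<and> successor_maps_in r k (Inflations C) \<and>
           is_colimit C r (Field r) Y k L c \<longrightarrow>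
           bij_betw (colim_Hom_map C c) (colim_Hom C r (A i) Y k) (Hom C (A i) L))" if "i \<in> I" for i
    using Ax2[OF assms(2)[OF that]] unfolding small_relative_to_def by blast
  then obtain K :: "_ \<Rightarrow> 'u rel" where K: "\<And>i. i \<in> I \<Longrightarrow> Cinfinite (K i)" "\<And>i. i \<in> I \<Longrightarrow> small U (Field (K i))"
    "\<And>i (r :: 'u rel) Y k L c. \<lbrakk>i \<in> I; transfinite_seq U C r Y k; cofinality_ge r (K i);
        successor_maps_in r k (Inflations C); is_colimit C r (Field r) Y k L c\<rbrakk>
      \<Longrightarrow> bij_betw (colim_Hom_map C c) (colim_Hom C r (A i) Y k) (Hom C (A i) L)"
    by metis
  have "small U (\<Union>i\<in>I. Field (K i))" by (rule small_UNION[OF size assms(1) K(2)])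
  then obtain \<kappa> :: "'u rel" where \<kappa>: "Cinfinite \<kappa>" "regularCard \<kappa>" "small U (Field \<kappa>)" "|\<Union>i\<in>I. Field (K i)| \<le>o \<kappa>"
    using size unfolding size_universe_def by blast
  have le: "K i \<le>o \<kappa>" if "i \<in> I" for i
  proof -
    have "K i =o |Field (K i)|" using K(1)[OF that] card_of_Field_ordIso ordIso_symmetric by blast
    moreover have "|Field (K i)| \<le>o |\<Union>i\<in>I. Field (K i)|" using that by (intro card_of_mono1) blast
    ultimately show ?thesis using \<kappa>(4) ordIso_ordLeq_trans ordLeq_transitive by blast
  qed
  have "\<exists>b \<in> Field r. \<exists>x \<in> Hom C (A i) (Y b). c b \<cdot> x = u"
    if *: "i \<in> I" "transfinite_seq U C r Y k" "cofinality_ge r \<kappa>"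
        "successor_maps_in r k (Inflations C)" "is_colimit C r (Field r) Y k L c" "u \<in> Hom C (A i) L"
      for i and r :: "'u rel" and Y k L c u
  proof -
    have "cofinality_ge r (K i)"
      using *(3) le[OF *(1)] ordLeq_transitive unfolding cofinality_ge_def by blast
    then have "bij_betw (colim_Hom_map C c) (colim_Hom C r (A i) Y k) (Hom C (A i) L)"
      using K(3) * by blast
    then have s: "colim_Hom_map C c ` colim_Hom C r (A i) Y k = Hom C (A i) L" unfolding bij_betw_def by blast
    have wo: "Well_order r" and ds: "direct_system C r Y k" using *(2) unfolding transfinite_seq_def by blast+
    obtain b x where "b \<in> Field r" "x \<in> Hom C (A i) (Y b)" "c b \<cdot> x = u"
      by (rule colim_Hom_factor[OF wo colimit_cocone[OF *(5)] ds s *(6)])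
    then show ?thesis by blast
  qed
  then show ?thesis by (rule that[OF \<kappa>(1-3)])
qed

end

section \<open>The small object argument\<close>

abbreviation segment :: "'u set \<Rightarrow> 'u \<Rightarrow> 'u \<Rightarrow> 'u rel" where
  "segment U a b \<equiv> Restr |U| {c. (a, c) \<in> |U| \<and> (c, b) \<in> |U|}"

context sized_efficient
begin

text \<open>
  Along the tail of \<open>|U|\<close> from \<open>z\<close> on, each step attaches a single square. The bookkeeping function \<open>e\<close>
  ensures that every square appearing at a stage \<open>b\<close> is attached at some later stage \<open>al b p\<close>. These
  stages are bounded by \<open>H b\<close>, so at a limit \<open>d\<close> closed under \<open>H\<close> and of cofinality at least \<open>\<kappa>\<close> every
  square over the colimit factors through an earlier stage and has been attached before \<open>d\<close>.
\<close>

lemma small_object_argument_nonempty: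
  assumes S: "\<S> \<subseteq> Obj C" "small U \<S>" "\<S> \<noteq> {}" and f0: "f0 \<in> Hom C X0 N" and z: "z \<in> U"
  obtains X k d f where "(z, d) \<in> |U|" "chain C (segment U z d) X k"
    "successor_maps_in (segment U z d) k (inflations_with_coker_in C \<S>)"
    "X z = X0" "f \<in> Hom C (X d) N" "f \<cdot> tr C X k z d = f0"
    "\<And>j. j \<in> inflations_with_coker_in C \<S> \<Longrightarrow> lifts C j f"
proof -
  let ?r = "|U|" and ?M = "inflations_with_coker_in C \<S>"
  have N: "N \<in> Obj C" using f0 Hom_Obj by blast
  note wo = card_of_wo[of U]
  have F: "Field ?r = U" by (rule Field_card_of)
  obtain I where I: "small U I" "strongly_homological C I"
    "Coker_class C I = {X \<in> Obj C. \<exists>S \<in> \<S>. isomorphic C X S}"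
    using Ax3[OF S(1,2)] by blast
  have II: "I \<subseteq> Inflations C" using I(2) unfolding strongly_homological_def by blast
  then have IA: "I \<subseteq> Arr C" using Inflations_Arr by blast
  have IM: "I \<subseteq> ?M" by (rule Coker_class_inflations[OF II I(3)])
  \<comment> \<open>Here \<open>\<S> \<noteq> {}\<close> enters: a member of \<open>I\<close>
    ensures that every stage has a square to attach.\<close>
  obtain S0 where "S0 \<in> \<S>" using S(3) by blast
  then have "S0 \<in> Coker_class C I" unfolding I(3) using S(1) isomorphic_refl by blast
  then obtain i0 where i0: "i0 \<in> I" unfolding Coker_class_def by blast
  obtain \<kappa> :: "'u rel" where \<kappa>: "Cinfinite \<kappa>" "regularCard \<kappa>" "small U (Field \<kappa>)"
    and fac: "\<And>i (r :: 'u rel) Y k L c u. \<lbrakk>i \<in> I; transfinite_seq U C r Y k; cofinality_ge r \<kappa>;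
        successor_maps_in r k (Inflations C); is_colimit C r (Field r) Y k L c; u \<in> Hom C (Dom C i) L\<rbrakk>
      \<Longrightarrow> \<exists>b \<in> Field r. \<exists>x \<in> Hom C (Dom C i) (Y b). c b \<cdot> x = u"
    by (rule uniform_smallness[OF I(1), of "Dom C"]) (use IA Dom_Obj in auto)
  obtain e :: "'u \<Rightarrow> 'u \<times> 'u" where e: "\<And>p q b. \<lbrakk>p \<in> U; q \<in> U; b \<in> U\<rbrakk> \<Longrightarrow> \<exists>a \<in> U. ord_less ?r b a \<and> e a = (p, q)"
    and eU: "e ` U \<subseteq> U \<times> U"
    by (rule bookkeeping[OF size]) blast

  let ?A = "{c. (z, c) \<in> ?r}"
  let ?T = "Restr ?r ?A"
  have A: "?A \<subseteq> Field ?r" and AU: "?A \<subseteq> U" using Well_orderD(2)[OF wo] F by blast+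
  have cvA: "convex_in ?r ?A" unfolding convex_in_def using A Well_orderD(4)[OF wo] by blast
  have FT: "Field ?T = ?A" by (rule Field_Restr'[OF wo A])
  have woT: "Well_order ?T" by (rule Well_order_Restr[OF wo])
  have zA: "z \<in> ?A" using Well_orderD(3)[OF wo] z F by simp
  have zT: "is_least ?T z" unfolding is_least_Restr[OF wo A] using zA by simp

  define en :: "('m \<times> 'm \<times> 'm) set \<Rightarrow> 'u \<Rightarrow> 'm \<times> 'm \<times> 'm" where "en P = (SOME s. s ` U = P)" for P
  have en: "en P ` U = P" if P: "small U P" "P \<noteq> {}" for P
  proof -
    obtain s where "s ` U = P" by (rule small_surj[OF P])
    then show ?thesis unfolding en_def by (rule someI[of "\<lambda>s. s ` U = P"])
  qed
  \<comment> \<open>The stage whose square is treated at \<open>a\<close>. The default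
    \<open>a\<close> covers the case that \<open>e a\<close> names no earlier stage of the tail, so
    that \<open>bs a\<close> never lies beyond \<open>a\<close>.\<close>
  define bs where "bs a = (if (fst (e a), a) \<in> ?T then fst (e a) else a)" for a
  define sq where "sq g b = squares I N (row_obj g b) (row_arr g b)" for g :: "'u \<Rightarrow> 'o \<times> ('u \<Rightarrow> 'm) \<times> 'm" and b
  define pr where "pr a g = en (sq g (bs a)) (snd (e a))" for a g
  \<comment> \<open>The square was found over stage \<open>bs a\<close>; \<open>push\<close> moves
    its upper edge to the current stage before the pushout is formed.\<close>
  define Q where "Q a g Y t h \<longleftrightarrow> (\<exists>w. is_pushout C (fst (pr a g)) (push C (row_map g) (bs a) a (fst (snd (pr a g)))) t w
      \<and> h \<cdot> w = snd (snd (pr a g)))" for a g and Y :: 'o and t h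
  have bsT: "(bs a, a) \<in> ?T" if "a \<in> Field ?T" for a
    unfolding bs_def using Well_orderD(3)[OF woT that] by auto
  have en_sq: "en (sq g b) ` U = sq g b" if "row_arr g b \<in> Hom C (row_obj g b) N" for g b
    unfolding sq_def using that Hom_Obj N by (intro en small_squares[OF I(1) IA] squares_nonempty[OF i0 IA]) blast+

  obtain g where ch: "chain C ?T (row_obj g) (row_map g)" and gz: "row_obj g z = X0" "row_arr g z = f0"
    and gN: "\<And>a. a \<in> Field ?T \<Longrightarrow> row_arr g a \<in> Hom C (row_obj g a) N"
    and gg: "\<And>a b. ord_less ?T a b \<Longrightarrow> row_arr g b \<cdot> row_map g a b = row_arr g a"
    and gQ: "\<And>a b. is_successor ?T a b \<Longrightarrow> row_map g a b \<in> ?M \<and> Q a g (row_obj g b) (row_map g a b) (row_arr g b)"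
  proof (rule chain_construction[OF woT zT _ f0 inflations_with_coker_in_Inflations, of Q \<S>])
    show "small U (underS ?T a)" for a
      by (rule small_subset[OF small_underS[OF size, of a]]) (auto simp: underS_def)
    show "Q a g Y t h = Q a g' Y t h" if "a \<in> Field ?T" "\<And>b. (b, a) \<in> ?T \<Longrightarrow> g b = g' b" for a g g' Y t h
    proof -
      have "g a = g' a" "g (bs a) = g' (bs a)"
        using that(2) bsT[OF that(1)] Well_orderD(3)[OF woT that(1)] by blast+
      then show ?thesis unfolding Q_def pr_def sq_def push_def by simp
    qed
    fix a and g :: "'u \<Rightarrow> 'o \<times> ('u \<Rightarrow> 'm) \<times> 'm"
    assume a: "a \<in> Field ?T" and gN: "\<And>b. (b, a) \<in> ?T \<Longrightarrow> row_arr g b \<in> Hom C (row_obj g b) N"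
      and gg: "\<And>b. ord_less ?T b a \<Longrightarrow> row_map g b a \<in> Hom C (row_obj g b) (row_obj g a)
            \<and> row_arr g a \<cdot> row_map g b a = row_arr g b"
    obtain i x y where ixy: "pr a g = (i, x, y)" by (cases "pr a g")
    have "snd (e a) \<in> U" using eU a unfolding FT using AU by (metis image_subset_iff mem_Times_iff subsetD)
    then have "pr a g \<in> sq g (bs a)" using en_sq[of g "bs a"] gN[OF bsT[OF a]] unfolding pr_def by blast
    then have i: "i \<in> I" "x \<in> Hom C (Dom C i) (row_obj g (bs a))" "y \<in> Hom C (Cod C i) N"
        "row_arr g (bs a) \<cdot> x = y \<cdot> i"
      unfolding ixy sq_def squares_def by auto
    let ?x = "push C (row_map g) (bs a) a x"
    have ga: "row_arr g a \<in> Hom C (row_obj g a) N" using gN Well_orderD(3)[OF woT a] by blast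
    have lt: "bs a = a \<or> ord_less ?T (bs a) a" using bsT[OF a] unfolding ord_less_def by blast
    then have x: "?x \<in> Hom C (Dom C i) (row_obj g a)"
      using gg i(2) push_Hom[of "bs a" a "row_map g" "row_obj g" x "Dom C i"] by blast
    have gx: "row_arr g a \<cdot> ?x = y \<cdot> i"
    proof (cases "bs a = a")
      case True
      then show ?thesis using i(4) unfolding push_def by simp
    next
      case False
      then have "row_map g (bs a) a \<in> Hom C (row_obj g (bs a)) (row_obj g a)"
        "row_arr g a \<cdot> row_map g (bs a) a = row_arr g (bs a)" using lt gg by blast+
      then have "row_arr g a \<cdot> ?x = row_arr g (bs a) \<cdot> x"
        using False i(2) ga Cmp_rewrite[of "row_arr g a" "row_map g (bs a) a" "row_arr g (bs a)" x]
        unfolding push_def by (simp add: Hom_iff)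
      then show ?thesis using i(4) by simp
    qed
    have iI: "i \<in> Inflations C" "i \<in> Arr C" using i(1) II IA by blast+
    obtain t w where po: "is_pushout C i ?x t w"
      using inflation_pushout[OF iI(1), of ?x] x by (auto simp: Hom_iff)
    note d = pushoutD[OF po]
    obtain h where h: "h \<in> Hom C (Cod C t) N" "h \<cdot> t = row_arr g a" "h \<cdot> w = y"
      using pushout_factor[OF po, of "row_arr g a" N y] ga x i(3) gx by (auto simp: Hom_iff)
    have "t \<in> ?M" by (rule pushout_inflations_with_coker_in[OF po]) (use i(1) IM in blast)
    moreover have "t \<in> Hom C (row_obj g a) (Cod C t)" using d x by (simp add: Hom_iff)
    moreover have "Q a g (Cod C t) t h" unfolding Q_def ixy using po h(3) by auto
    ultimately show "\<exists>Y t h. t \<in> ?M \<and> t \<in> Hom C (row_obj g a) Y \<and> h \<in> Hom C Y N \<and> h \<cdot> t = row_arr g a \<and> Q a g Y t h"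
      using h by blast
  qed (use that in blast)

  have small_sq: "small U (sq g b)" if "b \<in> ?A" for b
    unfolding sq_def using gN[unfolded FT, OF that] Hom_Obj N by (intro small_squares[OF I(1) IA]) blast+
  have ex: "\<exists>a. a \<in> U \<and> ord_less ?r b a \<and> bs a = b \<and> pr a g = p" if b: "b \<in> ?A" and p: "p \<in> sq g b" for b p
  proof -
    have "p \<in> en (sq g b) ` U" using en_sq[of g b] gN[unfolded FT, OF b] p by simp
    then obtain q where q: "q \<in> U" "en (sq g b) q = p" by blast
    have bU: "b \<in> U" using b AU by blast
    obtain a where a: "a \<in> U" "ord_less ?r b a" "e a = (b, q)" using e[OF bU q(1) bU] by blast
    have "(b, a) \<in> ?T" using a(2) b Well_orderD(4)[OF wo, of z b a] unfolding ord_less_def by blast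
    then have bs: "bs a = b" unfolding bs_def a(3) by simp
    then have "pr a g = p" unfolding pr_def bs using a(3) q(2) by simp
    then show ?thesis using a(1,2) bs by blast
  qed
  define al where "al b p = (SOME a. a \<in> U \<and> ord_less ?r b a \<and> bs a = b \<and> pr a g = p)" for b p
  have al: "al b p \<in> U" "ord_less ?r b (al b p)" "bs (al b p) = b" "pr (al b p) g = p"
    if "b \<in> ?A" "p \<in> sq g b" for b p
    using someI_ex[OF ex[OF that]] unfolding al_def by blast+
  have "\<forall>b. \<exists>c. c \<in> U \<and> (b \<in> ?A \<longrightarrow> (\<forall>p \<in> sq g b. ord_less ?r (al b p) c))"
  proof
    fix b
    show "\<exists>c. c \<in> U \<and> (b \<in> ?A \<longrightarrow> (\<forall>p \<in> sq g b. ord_less ?r (al b p) c))"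
    proof (cases "b \<in> ?A")
      case True
      have "small U (al b ` sq g b)" by (rule small_image[OF small_sq[OF True]])
      moreover have "al b ` sq g b \<subseteq> U" using al(1)[OF True] by (rule image_subsetI)
      ultimately obtain c where "c \<in> U" "\<And>x. x \<in> al b ` sq g b \<Longrightarrow> ord_less ?r x c"
        by (rule small_not_cofinal[OF size]) blast
      then show ?thesis by (intro exI[of _ c]) simp
    next
      case False
      then show ?thesis using z by (intro exI[of _ z]) simp
    qed
  qed
  from choice[OF this] obtain H
    where H0: "\<forall>b. H b \<in> U \<and> (b \<in> ?A \<longrightarrow> (\<forall>p \<in> sq g b. ord_less ?r (al b p) (H b)))" ..
  have H: "H b \<in> U" for b using H0 by (rule allE) (erule conjunct1)
  have Hal: "ord_less ?r (al b p) (H b)" if "b \<in> ?A" "p \<in> sq g b" for b p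
    using spec[OF H0, of b] that by simp
  obtain d where d: "d \<in> U" "ord_less ?r z d" "is_limit ?r d" "\<And>a. ord_less ?r a d \<Longrightarrow> ord_less ?r (H a) d"
    and cof: "cofinality_ge (Restr ?r {c. (z, c) \<in> ?r \<and> ord_less ?r c d}) \<kappa>"
    by (rule closed_limit_exists[OF size \<kappa> z, of H]) (use H in blast)+
  \<comment> \<open>The closed interval carries the chain to be returned, which ends at the colimit.
    Smallness is applied on the half-open one, since an order with a last element has cofinality
    1.\<close>
  let ?D = "{c. (z, c) \<in> ?r \<and> (c, d) \<in> ?r}" and ?E = "{c. (z, c) \<in> ?r \<and> ord_less ?r c d}"
  have zd: "(z, d) \<in> ?r" using d(2) unfolding ord_less_def by blast
  have dA: "d \<in> ?A" using zd by simp
  have DA: "?D \<subseteq> ?A" and EA: "?E \<subseteq> ?A" by blast+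
  have R: "Restr ?T ?D = Restr ?r ?D" "Restr ?T ?E = Restr ?r ?E" by blast+
  have cvD: "convex_in ?T ?D"
    unfolding convex_in_def FT using Well_orderD(4)[OF wo] by blast
  have cvE: "convex_in ?T ?E"
    unfolding convex_in_def FT using ord_le_less_trans[OF wo] by blast
  have chD: "chain C (Restr ?r ?D) (row_obj g) (row_map g)" using chain_Restr[OF ch cvD] unfolding R .
  have chE: "chain C (Restr ?r ?E) (row_obj g) (row_map g)" using chain_Restr[OF ch cvE] unfolding R .
  have EF: "?E \<subseteq> Field ?r" using A by blast
  have FE: "Field (Restr ?r ?E) = ?E" by (rule Field_Restr'[OF wo EF])
  have sD: "successor_maps_in (Restr ?r ?D) (row_map g) ?M"
    using gQ unfolding successor_maps_in_def R(1)[symmetric] is_successor_Restr[OF woT cvD] by blast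
  have sE: "successor_maps_in (Restr ?r ?E) (row_map g) (Inflations C)"
    using gQ inflations_with_coker_in_Inflations
    unfolding successor_maps_in_def R(2)[symmetric] is_successor_Restr[OF woT cvE] by blast
  have "?E \<subseteq> underS ?r d" unfolding underS_def ord_less_def by blast
  then have "small U ?E" by (rule small_subset[OF small_underS[OF size]])
  then have tE: "transfinite_seq U C (Restr ?r ?E) (row_obj g) (row_map g)"
    unfolding transfinite_seq_iff FE using chE by blast
  have "is_limit ?T d" unfolding is_limit_Restr[OF wo cvA] using d dA zA by blast
  then have "is_colimit C ?T (underS ?T d) (row_obj g) (row_map g) (row_obj g d) (\<lambda>a. row_map g a d)"
    by (rule chainD(3)[OF ch])
  moreover have "underS ?T d = ?E" unfolding underS_def ord_less_def using dA by blast
  ultimately have "is_colimit C ?T ?E (row_obj g) (row_map g) (row_obj g d) (\<lambda>a. row_map g a d)" by simp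
  then have colE: "is_colimit C (Restr ?r ?E) (Field (Restr ?r ?E)) (row_obj g) (row_map g) (row_obj g d) (\<lambda>a. row_map g a d)"
    unfolding FE using EA by (simp add: is_colimit_Restr)
  have dT: "d \<in> Field ?T" unfolding FT by (rule dA)
  let ?f = "row_arr g d"
  have fH: "?f \<in> Hom C (row_obj g d) N" by (rule gN[OF dT])
  have gT: "ord_less ?T a b" if "a \<in> ?A" "ord_less ?r a b" for a b
    using that Well_orderD(4)[OF wo, of z a b] unfolding ord_less_def by blast

  have liftI: "lifts C i ?f" if i: "i \<in> I" for i
  proof (rule liftsI[OF Arr_in_Hom fH])
    show iA: "i \<in> Arr C" using i IA by blast
    fix u v assume u: "u \<in> Hom C (Dom C i) (row_obj g d)" and v: "v \<in> Hom C (Cod C i) N" and fu: "?f \<cdot> u = v \<cdot> i"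
    obtain b x where b: "b \<in> ?E" and x: "x \<in> Hom C (Dom C i) (row_obj g b)" and bx: "row_map g b d \<cdot> x = u"
      using fac[OF i tE cof sE colE u] unfolding FE by blast
    have bA: "b \<in> ?A" and bd: "ord_less ?T b d" using b gT by blast+
    have md: "row_map g b d \<in> Hom C (row_obj g b) (row_obj g d)" by (rule chainD(5)[OF ch bd])
    have gb: "row_arr g b \<in> Hom C (row_obj g b) N" using gN FT bA by blast
    have "row_arr g b \<cdot> x = ?f \<cdot> (row_map g b d \<cdot> x)"
      using gg[OF bd] fH md x Cmp_rewrite[OF gg[OF bd], of x] by (simp add: Hom_iff)
    then have p: "(i, x, v) \<in> sq g b" unfolding sq_def squares_def using i x v bx fu by auto
    define a where "a = al b (i, x, v)"
    have ba: "ord_less ?r b a" and bsa: "bs a = b" and pra: "pr a g = (i, x, v)"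
      using al(2-4)[OF bA p] unfolding a_def by blast+
    have "ord_less ?r (H b) d" using d(4) b by blast
    then have ad: "ord_less ?r a d" using ord_less_trans[OF wo Hal[OF bA p]] unfolding a_def by blast
    have aA: "a \<in> ?A" using ba bA Well_orderD(4)[OF wo, of z b a] unfolding ord_less_def by blast
    obtain c where c: "is_successor ?r a c" "ord_less ?r c d"
      by (rule is_limit_successor[OF wo d(3) ad])
    have cA: "c \<in> ?A" using is_successor_less[OF c(1)] aA Well_orderD(4)[OF wo, of z a c] unfolding ord_less_def by blast
    have acT: "is_successor ?T a c" unfolding is_successor_Restr[OF wo cvA] using c(1) aA cA by blast
    have ac: "ord_less ?T a c" and cd: "ord_less ?T c d" and baT: "ord_less ?T b a" and adT: "ord_less ?T a d"
      using is_successor_less[OF acT] gT[OF cA c(2)] gT[OF bA ba] gT[OF aA ad] by blast+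
    note mac = chainD(5)[OF ch ac] and mcd = chainD(5)[OF ch cd] and mba = chainD(5)[OF ch baT] and mad = chainD(5)[OF ch adT]
    have pu: "push C (row_map g) b a x = row_map g b a \<cdot> x" using ba unfolding push_def ord_less_def by auto
    obtain w where po: "is_pushout C i (row_map g b a \<cdot> x) (row_map g a c) w" and gw: "row_arr g c \<cdot> w = v"
      using gQ[OF acT] unfolding Q_def bsa pra fst_conv snd_conv pu by blast
    note pd = pushoutD[OF po]
    have w: "w \<in> Hom C (Cod C i) (row_obj g c)" using pd mac by (simp add: Hom_iff)
    let ?l = "row_map g c d \<cdot> w"
    have l: "?l \<in> Hom C (Cod C i) (row_obj g d)" by (rule Cmp_Hom[OF w mcd])
    have gc: "row_arr g c \<in> Hom C (row_obj g c) N" using gN FT cA by blast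
    have "?l \<cdot> i = row_map g c d \<cdot> (w \<cdot> i)" using w mcd iA by (simp add: Hom_iff)
    also have "\<dots> = (row_map g c d \<cdot> row_map g a c) \<cdot> (row_map g b a \<cdot> x)"
      unfolding pd(9)[symmetric] using mcd mac mba x by (simp add: Hom_iff)
    also have "\<dots> = (row_map g a d \<cdot> row_map g b a) \<cdot> x"
      unfolding chainD(6)[OF ch ac cd] using mad mba x by (simp add: Hom_iff)
    also have "\<dots> = u" unfolding chainD(6)[OF ch baT adT] by (rule bx)
    finally have li: "?l \<cdot> i = u" .
    have "?f \<cdot> ?l = row_arr g c \<cdot> w"
      using fH mcd w Cmp_rewrite[OF gg[OF cd], of w] by (simp add: Hom_iff)
    then show "\<exists>l. l \<in> Hom C (Cod C i) (row_obj g d) \<and> l \<cdot> i = u \<and> ?f \<cdot> l = v"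
      using l li gw by auto
  qed
  have lift: "lifts C j ?f" if j: "j \<in> ?M" for j
  proof -
    obtain q where q: "(j, q) \<in> Conflations C" "Cod C q \<in> \<S>"
      using j unfolding inflations_with_coker_in_def by blast
    note cq = conflationD[OF conflationI[OF q(1)]]
    have "Cod C q \<in> Coker_class C I" unfolding I(3) using q(2) cq isomorphic_refl by blast
    then obtain i A' B' p a b where i: "i \<in> I" "conflation C A' i B' p (Cod C q)"
      "a \<in> Hom C A' (Dom C j)" "b \<in> Hom C B' (Cod C j)" "b \<cdot> i = j \<cdot> a" "q \<cdot> b = p"
      using I(2) conflationI[OF q(1)] unfolding strongly_homological_def by blast
    have "is_pushout C i a j b"
      by (rule conflation_map_pushout[OF i(2) conflationI[OF q(1)] i(3-6)])
    then show ?thesis using lifts_pushout liftI[OF i(1)] fH by (metis Hom_iff)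
  qed
  have "ord_less ?T z d" using gT[OF zA d(2)] .
  then have "?f \<cdot> tr C (row_obj g) (row_map g) z d = f0"
    using gg gz(2) d(2) unfolding tr_def ord_less_def by auto
  then show ?thesis using that[OF zd chD sD gz(1) fH _ lift] by blast
qed

lemma chain_singleton:
  assumes "z \<in> U" "X0 \<in> Obj C"
  shows "chain C (segment U z z) (\<lambda>_. X0) k" "successor_maps_in (segment U z z) k M"
proof -
  note wo = card_of_wo[of U]
  have F: "Field |U| = U" by (rule Field_card_of)
  have zz: "{c. (z, c) \<in> |U| \<and> (c, z) \<in> |U| } = {z}"
    using Well_orderD(3,5)[OF wo] assms(1) F by blast
  have zF: "{z} \<subseteq> Field |U|" using assms(1) F by simp
  have nl: "\<not> ord_less (segment U z z) a b" for a b unfolding zz ord_less_def by blast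
  have "\<not> is_limit (segment U z z) g" for g
  proof -
    have "is_least (segment U z z) g" if "g \<in> Field (segment U z z)"
      using that nl unfolding is_least_def underS_def ord_less_def by blast
    then show ?thesis unfolding is_limit_def by blast
  qed
  then show "chain C (segment U z z) (\<lambda>_. X0) k"
    unfolding chain_def direct_system_def using nl assms(2) Well_order_Restr[OF wo] by blast
  show "successor_maps_in (segment U z z) k M"
    unfolding successor_maps_in_def is_successor_def using nl by blast
qed

text \<open>For empty \<open>\<S>\<close> there is nothing to lift against, and the one-term chain
  with \<open>f0\<close> itself is a solution.\<close>

lemma small_object_argument:
  assumes S: "\<S> \<subseteq> Obj C" "small U \<S>" and f0: "f0 \<in> Hom C X0 N" and z: "z \<in> U"
  obtains X k d f where "(z, d) \<in> |U|" "chain C (segment U z d) X k"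
    "successor_maps_in (segment U z d) k (inflations_with_coker_in C \<S>)"
    "X z = X0" "f \<in> Hom C (X d) N" "f \<cdot> tr C X k z d = f0"
    "\<And>j. j \<in> inflations_with_coker_in C \<S> \<Longrightarrow> lifts C j f"
proof (cases "\<S> = {}")
  case True
  have zz: "(z, z) \<in> |U|" using Well_orderD(3)[OF card_of_wo] z by (metis Field_card_of)
  have X0: "X0 \<in> Obj C" using f0 Hom_Obj by blast
  show ?thesis
    by (rule that[OF zz chain_singleton[OF z X0, of undefined]])
      (use True f0 in \<open>auto simp: inflations_with_coker_in_def tr_def Hom_iff\<close>)
next
  case False
  show ?thesis by (rule small_object_argument_nonempty[OF S False f0 z]) (rule that)
qed

end

section \<open>Filtrations and cotorsion pairs\<close>

context sized_efficient
begin

lemma inflations_with_coker_inI: "conflation C A j B c S \<Longrightarrow> S \<in> \<S> \<Longrightarrow> j \<in> inflations_with_coker_in C \<S>"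
  unfolding inflations_with_coker_in_def conflation_def by (auto simp: Hom_iff)

section \<open>Perpendicular classes and lifting properties\<close>

lemma right_perp_Obj: "right_perp C \<S> \<subseteq> Obj C"
  and left_perp_Obj: "left_perp C \<S> \<subseteq> Obj C"
  unfolding right_perp_def left_perp_def by auto

lemma right_perp_antimono: "A \<subseteq> B \<Longrightarrow> right_perp C B \<subseteq> right_perp C A"
  unfolding right_perp_def by blast

lemma right_left_perp: "A \<subseteq> Obj C \<Longrightarrow> A \<subseteq> right_perp C (left_perp C A)"
  unfolding right_perp_def left_perp_def by blast

lemma right_perp_lifts:
  assumes "T \<in> right_perp C \<S>" "conflation C T t Z q X" "j \<in> inflations_with_coker_in C \<S>"
  shows "lifts C j q"
proof -
  obtain c where c: "(j, c) \<in> Conflations C" "Cod C c \<in> \<S>"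
    using assms(3) unfolding inflations_with_coker_in_def by blast
  then have "Ext1_vanishes C (Cod C c) T" using assms(1) unfolding right_perp_def by blast
  then show ?thesis by (rule conflation_lifts[OF conflationI[OF c(1)] assms(2)])
qed

text \<open>Lifting the identity of \<open>B\<close> along the inflation of an extension of
  \<open>S\<close> by \<open>B\<close> gives a retraction, so the extension splits. With a zero
  object as target every such square commutes.\<close>

lemma right_perpI_lifts:
  assumes S: "\<S> \<subseteq> Obj C" and N: "is_zero_object C N" and f: "f \<in> Hom C B N"
    and l: "\<And>j. j \<in> inflations_with_coker_in C \<S> \<Longrightarrow> lifts C j f"
  shows "B \<in> right_perp C \<S>"
proof -
  have B: "B \<in> Obj C" "N \<in> Obj C" using f Hom_Obj by blast+
  have "Ext1_vanishes C S B" if SS: "S \<in> \<S>" for S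
  proof (subst Ext1_vanishes_iff)
    show "S \<in> Obj C" "B \<in> Obj C" using SS S B by auto
    show "\<forall>i Z p. conflation C B i Z p S \<longrightarrow> (\<exists>s \<in> Hom C S Z. p \<cdot> s = Id C S)"
    proof (intro allI impI)
      fix i Z p assume c: "conflation C B i Z p S"
      note d = conflationD[OF c]
      have Z0: "Zero C Z N \<in> Hom C Z N" using d(8) B by (simp add: Hom_iff)
      have "f \<cdot> Id C B = Zero C Z N \<cdot> i"
        by (rule zero_object_to[OF N, of _ B]) (use f B Z0 d(2) in \<open>simp_all add: Hom_iff\<close>)
      then obtain r where r: "r \<in> Hom C Z B" "r \<cdot> i = Id C B"
        by (rule liftsE[OF l[OF inflations_with_coker_inI[OF c SS]] d(2) f Id_Hom[OF B(1)] Z0]) blast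
      obtain s where "s \<in> Hom C S Z" "p \<cdot> s = Id C S" by (rule retraction_section[OF c r]) blast
      then show "\<exists>s \<in> Hom C S Z. p \<cdot> s = Id C S" by blast
    qed
  qed
  then show ?thesis unfolding right_perp_def using B by blast
qed

section \<open>Filtered objects, segments and special preenvelopes\<close>

lemma Filt_Obj: "Filt U C \<S> \<subseteq> Obj C"
  unfolding Filt_def using colimit_cocone coconeD(1) by blast

text \<open>The composition from the zero object has the lifting property by
  \<open>chain_lifts\<close>, and squares starting at a zero object commute automatically; so
  \<open>v\<close> is lifted without a condition on the upper edge.\<close>

lemma Filt_lift:
  assumes X: "X \<in> Filt U C \<S>" and q: "q \<in> Hom C Z W" and v: "v \<in> Hom C X W"
    and l: "\<And>j. j \<in> inflations_with_coker_in C \<S> \<Longrightarrow> lifts C j q"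
  obtains s where "s \<in> Hom C X Z" "q \<cdot> s = v"
proof -
  obtain r :: "'u rel" and F i c z where r: "transfinite_seq U C r F i" "is_least r z" "is_zero_object C (F z)"
     "successor_maps_in r i (inflations_with_coker_in C \<S>)" "is_colimit C r (Field r) F i X c"
    using X unfolding Filt_def by blast
  have ch: "chain C r F i" using r(1) unfolding transfinite_seq_iff by blast
  have lz: "lifts C (c z) q"
    by (rule chain_lifts[OF ch r(2) r(5) _ q]) (use r(4) l in \<open>auto simp: successor_maps_in_def\<close>)
  have "z \<in> Field r" using r(2) unfolding is_least_def by blast
  then have cz: "c z \<in> Hom C (F z) X" by (rule coconeD(2)[OF colimit_cocone[OF r(5)]])
  have Fz: "F z \<in> Obj C" "Z \<in> Obj C" "W \<in> Obj C" using cz q Hom_Obj by blast+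
  have 0: "Zero C (F z) Z \<in> Hom C (F z) Z" using Fz by (simp add: Hom_iff)
  have "q \<cdot> Zero C (F z) Z = v \<cdot> c z"
    by (rule zero_object_from[OF r(3), of _ W]) (use q v cz Fz in \<open>simp_all add: Hom_iff\<close>)
  then show ?thesis by (rule liftsE[OF lz cz q 0 v]) (rule that)
qed

lemma segment_facts:
  assumes "(z, d) \<in> |U|"
  shows "Field (segment U z d) = {c. (z, c) \<in> |U| \<and> (c, d) \<in> |U| }"
    "is_least (segment U z d) z" "d \<in> Field (segment U z d)"
    "small U (Field (segment U z d))" "small U (underS (segment U z d) a)"
    "c \<in> Field (segment U z d) \<Longrightarrow> (c, d) \<in> segment U z d" "z \<in> U" "d \<in> U"
proof -
  note wo = card_of_wo[of U]
  let ?A = "{c. (z, c) \<in> |U| \<and> (c, d) \<in> |U| }"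
  show F: "Field (segment U z d) = ?A"
    by (rule Field_Restr'[OF wo]) (use Well_orderD(2)[OF wo] in blast)
  have zd: "(z, z) \<in> |U|" "(d, d) \<in> |U|"
    using Well_orderD(1,2)[OF wo assms] Well_orderD(3)[OF wo] by blast+
  show "is_least (segment U z d) z"
    by (subst is_least_Restr[OF wo]) (use Well_orderD(2)[OF wo] assms zd in blast)+
  show "d \<in> Field (segment U z d)" unfolding F using assms zd by blast
  show "small U (Field (segment U z d))"
    unfolding F by (rule small_subset[OF small_under[OF size, of d]]) blast
  show "small U (underS (segment U z d) a)"
    by (rule small_subset[OF small_underS[OF size, of a]]) (auto simp: underS_def)
  show "(c, d) \<in> segment U z d" if "c \<in> Field (segment U z d)"
    using that assms zd unfolding F by blast
  show "z \<in> U" "d \<in> U" using Well_orderD(1,2)[OF wo assms] by (simp_all add: Field_card_of)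
qed

lemma segment_Filt:
  assumes zd: "(z, d) \<in> |U|" and ch: "chain C (segment U z d) X k"
    and s: "successor_maps_in (segment U z d) k (inflations_with_coker_in C \<S>)" and z: "is_zero_object C (X z)"
  shows "X d \<in> Filt U C \<S>"
proof -
  note f = segment_facts[OF zd]
  have "transfinite_seq U C (segment U z d) X k" unfolding transfinite_seq_iff using ch f(4) by blast
  moreover have "is_colimit C (segment U z d) (Field (segment U z d)) X k (X d) (\<lambda>a. tr C X k a d)"
    by (rule colimit_at_max[OF chainD(1,2)[OF ch] subset_refl f(3,6)])
  ultimately show ?thesis unfolding Filt_def using f(2) z s by blast
qed

lemma segment_inflation:
  assumes zd: "(z, d) \<in> |U|" and ch: "chain C (segment U z d) X k"
    and s: "successor_maps_in (segment U z d) k (inflations_with_coker_in C \<S>)"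
  shows "tr C X k z d \<in> Inflations C" "tr C X k z d \<in> Hom C (X z) (X d)"
proof -
  note f = segment_facts[OF zd]
  show "tr C X k z d \<in> Inflations C"
    by (rule chain_inflation[OF ch f(2) _ f(3,5)])
      (use s inflations_with_coker_in_Inflations in \<open>auto simp: successor_maps_in_def\<close>)
  show "tr C X k z d \<in> Hom C (X z) (X d)"
    by (rule chainD(7)[OF ch is_leastD[OF chainD(1)[OF ch] f(2,3)]])
qed

text \<open>Identifies the last term of a chain pushed out to zero as the quotient of the original
  composition, which is thereby filtered.\<close>

lemma pushout_zero_cokernel:
  assumes po: "is_pushout C i g i' b" and g: "g \<in> Hom C A N" and N: "is_zero_object C N" and i: "i \<in> Hom C A B"
  shows "is_cokernel C b i"
proof (rule cokernelI[OF _ i])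
  note d = pushoutD[OF po]
  have No: "N \<in> Obj C" "A \<in> Obj C" using g Hom_Obj by blast+
  show b: "b \<in> Hom C B (Cod C i')" using d i by (simp add: Hom_iff)
  have i'H: "i' \<in> Hom C N (Cod C i')" using d g by (simp add: Hom_iff)
  have eo: "Cod C i' \<in> Obj C" using d Cod_Obj by blast
  have g0: "g = Zero C A N" by (rule zero_object_to[OF N g]) (use No in \<open>simp add: Hom_iff\<close>)
  show "b \<cdot> i = Zero C A (Cod C i')"
    unfolding d(9)[symmetric] g0 using i'H No by (simp add: Hom_iff)
  fix T f assume f: "f \<in> Hom C B T" "f \<cdot> i = Zero C A T"
  have T: "T \<in> Obj C" using f Hom_Obj by blast
  have "Zero C N T \<cdot> g = f \<cdot> i" using f No T g by (simp add: Hom_iff)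
  moreover have "Zero C N T \<in> Hom C (Cod C g) T" "f \<in> Hom C (Cod C i) T" using f(1) No T g i by (simp_all add: Hom_iff)
  ultimately obtain h where "h \<in> Hom C (Cod C i') T" "h \<cdot> b = f"
    using pushout_factor[OF po] by metis
  then show "\<exists>g. g \<in> Hom C (Cod C i') T \<and> g \<cdot> b = f" by blast
next
  note d = pushoutD[OF po]
  have i'H: "i' \<in> Hom C N (Cod C i')" using d g by (simp add: Hom_iff)
  fix T h k assume *: "h \<in> Hom C (Cod C i') T" "k \<in> Hom C (Cod C i') T" "h \<cdot> b = k \<cdot> b"
  have "h \<cdot> i' = k \<cdot> i'" by (rule zero_object_from[OF N, of _ T]) (use * i'H in \<open>simp_all add: Hom_iff\<close>)
  then show "h = k" by (rule pushout_unique[OF po *(1,2) _ *(3)])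
qed

text \<open>The starting index \<open>z\<close> is left free and the chain is returned together with
  the conflation, so that it can later be attached behind a chain ending at
  \<open>z\<close>.\<close>

lemma special_preenvelope:
  assumes S: "\<S> \<subseteq> Obj C" "small U \<S>" and M: "M \<in> Obj C" and z: "z \<in> U"
  obtains X k d p Q where "(z, d) \<in> |U|" "chain C (segment U z d) X k"
    "successor_maps_in (segment U z d) k (inflations_with_coker_in C \<S>)" "X z = M"
    "X d \<in> right_perp C \<S>" "conflation C M (tr C X k z d) (X d) p Q" "Q \<in> Filt U C \<S>"
proof -
  obtain N where N: "is_zero_object C N" using zero_object_exists by blast
  have No: "N \<in> Obj C" by (rule zero_object_Obj[OF N])
  have f0: "Zero C M N \<in> Hom C M N" using M No by (simp add: Hom_iff)
  obtain X k d f where X: "(z, d) \<in> |U|" "chain C (segment U z d) X k"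
    "successor_maps_in (segment U z d) k (inflations_with_coker_in C \<S>)" "X z = M"
    and f: "f \<in> Hom C (X d) N" "\<And>j. j \<in> inflations_with_coker_in C \<S> \<Longrightarrow> lifts C j f"
    by (rule small_object_argument[OF S f0 z]) blast
  note sf = segment_facts[OF X(1)] and si = segment_inflation[OF X(1-3)]
  have B: "X d \<in> right_perp C \<S>" by (rule right_perpI_lifts[OF S(1) N f])
  have g: "Zero C M N \<in> Hom C (X z) N" using f0 X(4) by simp
  obtain E e b where E: "chain C (segment U z d) E e" "E z = N"
    "successor_maps_in (segment U z d) e (inflations_with_coker_in C \<S>)"
    and po: "\<And>m. m \<in> Field (segment U z d) \<Longrightarrow> is_pushout C (tr C X k z m) (Zero C M N) (tr C E e z m) (b m)"
    by (rule chain_pushout[OF X(2) sf(2) X(3) sf(5) g]) blast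
  have "E d \<in> Filt U C \<S>" by (rule segment_Filt[OF X(1) E(1,3)]) (use E(2) N in simp)
  moreover obtain p S' where "conflation C (X z) (tr C X k z d) (X d) p S'"
    by (rule inflation_conflation[OF si])
  then have "conflation C (X z) (tr C X k z d) (X d) (b d) (Cod C (b d))"
    by (rule conflation_change_cokernel) (rule pushout_zero_cokernel[OF po[OF sf(3)] g N si(2)])
  moreover have "Cod C (b d) = E d"
    using pushoutD(8)[OF po[OF sf(3)]] segment_inflation(2)[OF X(1) E(1,3)] by (simp add: Hom_iff)
  ultimately show ?thesis using that[OF X B] X(4) by simp
qed

section \<open>Closure properties of left perpendicular classes\<close>

lemma left_perpI:
  assumes "X \<in> Obj C" "\<T> \<subseteq> Obj C"
    "\<And>T t Z q. T \<in> \<T> \<Longrightarrow> conflation C T t Z q X \<Longrightarrow> \<exists>s \<in> Hom C X Z. q \<cdot> s = Id C X"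
  shows "X \<in> left_perp C \<T>"
  unfolding left_perp_def using assms Ext1_vanishes_iff[OF assms(1)] by blast

text \<open>Pulling the conflation back along \<open>v\<close> gives an extension of
  \<open>X\<close> by \<open>T\<close>; its section, followed by the map to \<open>Z\<close>, is the
  lift.\<close>

lemma left_perp_lift:
  assumes X: "X \<in> left_perp C \<T>" and T: "T \<in> \<T>" and q: "conflation C T t Z q W" and v: "v \<in> Hom C X W"
  obtains l where "l \<in> Hom C X Z" "q \<cdot> l = v"
proof -
  obtain Z' t' q' v' where Z': "conflation C T t' Z' q' X" "v' \<in> Hom C Z' Z" "q \<cdot> v' = v \<cdot> q'"
    by (rule pullback_conflation[OF q v]) blast
  note d = conflationD[OF Z'(1)] and dq = conflationD[OF q]
  have "Ext1_vanishes C X T" using X T unfolding left_perp_def by blast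
  then obtain s where s: "s \<in> Hom C X Z'" "q' \<cdot> s = Id C X"
    using Z'(1) unfolding Ext1_vanishes_iff[OF d(9,7)] by blast
  have "q \<cdot> (v' \<cdot> s) = v"
    using Cmp_rewrite[OF Z'(3), of s] s Z'(2) d(3) dq(3) v by (simp add: Hom_iff)
  then show ?thesis using that Cmp_Hom[OF s(1) Z'(2)] by blast
qed

text \<open>Lift the projection from \<open>E\<close> and restrict the lift to
  \<open>M\<close>.\<close>

lemma left_perp_summand:
  assumes "direct_summand C M E" "E \<in> left_perp C \<T>" "\<T> \<subseteq> Obj C"
  shows "M \<in> left_perp C \<T>"
proof (rule left_perpI[OF _ assms(3)])
  show "M \<in> Obj C" using assms(1) unfolding direct_summand_def by blast
  obtain \<iota> \<pi> where i: "\<iota> \<in> Hom C M E" "\<pi> \<in> Hom C E M" "\<pi> \<cdot> \<iota> = Id C M"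
    using assms(1) unfolding direct_summand_def is_biproduct_def by blast
  fix T t Z q assume T: "T \<in> \<T>" and q: "conflation C T t Z q M"
  obtain l where l: "l \<in> Hom C E Z" "q \<cdot> l = \<pi>" by (rule left_perp_lift[OF assms(2) T q i(2)])
  have "q \<cdot> (l \<cdot> \<iota>) = Id C M"
    using Cmp_rewrite[OF l(2), of \<iota>] i l(1) conflationD(3)[OF q] by (simp add: Hom_iff)
  then show "\<exists>s \<in> Hom C M Z. q \<cdot> s = Id C M" using Cmp_Hom[OF i(1) l(1)] by blast
qed

text \<open>A section over \<open>E\<close> is built in two steps: over \<open>P\<close> by lifting
  \<open>i\<close>, then from \<open>P\<close> to \<open>E\<close> because \<open>q\<close> lifts
  against inflations with cokernel \<open>X\<close>.\<close>

lemma left_perp_extension: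
  assumes c: "conflation C P i E p X" and P: "P \<in> left_perp C \<T>" and X: "X \<in> left_perp C \<T>" and T: "\<T> \<subseteq> Obj C"
  shows "E \<in> left_perp C \<T>"
proof (rule left_perpI[OF _ T])
  note d = conflationD[OF c]
  show "E \<in> Obj C" by (rule d(8))
  fix T t Z q assume T: "T \<in> \<T>" and q: "conflation C T t Z q E"
  have v: "Ext1_vanishes C X T" using X T unfolding left_perp_def by blast
  obtain u where u: "u \<in> Hom C P Z" "q \<cdot> u = i" by (rule left_perp_lift[OF P T q d(2)])
  have "q \<cdot> u = Id C E \<cdot> i" using u d(2) by (simp add: Hom_iff)
  then obtain l where "l \<in> Hom C E Z" "q \<cdot> l = Id C E"
    by (rule liftsE[OF conflation_lifts[OF c q v] d(2) conflationD(3)[OF q] u(1) Id_Hom[OF d(8)]])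
  then show "\<exists>s \<in> Hom C E Z. q \<cdot> s = Id C E" by blast
qed

lemma projective_left_perp:
  assumes "projective C P" "\<T> \<subseteq> Obj C"
  shows "P \<in> left_perp C \<T>"
proof (rule left_perpI[OF _ assms(2)])
  show "P \<in> Obj C" using assms(1) unfolding projective_def by blast
  fix T t Z q assume q: "conflation C T t Z q P"
  then have "q \<in> Deflations C" "Cod C q = P" "Dom C q = Z"
    using conflation_deflation conflationD(3)[OF q] by (auto simp: Hom_iff)
  then show "\<exists>s \<in> Hom C P Z. q \<cdot> s = Id C P" using assms(1) unfolding projective_def by blast
qed

text \<open>Eklof's lemma, obtained by lifting the identity of a filtered object through the
  deflation of an extension.\<close>

lemma Filt_left_perp: "Filt U C \<S> \<subseteq> left_perp C (right_perp C \<S>)"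
proof
  fix X assume X: "X \<in> Filt U C \<S>"
  then have Xo: "X \<in> Obj C" using Filt_Obj by blast
  show "X \<in> left_perp C (right_perp C \<S>)"
  proof (rule left_perpI[OF Xo right_perp_Obj])
    fix T t Z q assume T: "T \<in> right_perp C \<S>" and q: "conflation C T t Z q X"
    obtain s where "s \<in> Hom C X Z" "q \<cdot> s = Id C X"
      by (rule Filt_lift[OF X conflationD(3)[OF q] Id_Hom[OF Xo] right_perp_lifts[OF T q]])
    then show "\<exists>s \<in> Hom C X Z. q \<cdot> s = Id C X" by blast
  qed
qed

section \<open>Approximations and completeness of the cotorsion pair\<close>

lemma precovering_Filt:
  assumes S: "\<S> \<subseteq> Obj C" "small U \<S>"
  shows "precovering C (Filt U C \<S>)"
  unfolding precovering_def
proof (intro conjI ballI)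
  show "Filt U C \<S> \<subseteq> Obj C" by (rule Filt_Obj)
  fix X assume X: "X \<in> Obj C"
  obtain N where N: "is_zero_object C N" using zero_object_exists by blast
  have f0: "Zero C N X \<in> Hom C N X" using X zero_object_Obj[OF N] by (simp add: Hom_iff)
  obtain z where z: "z \<in> U" using size_universe_infinite[OF size] infinite_imp_nonempty by blast
  obtain F k d f where F: "(z, d) \<in> |U|" "chain C (segment U z d) F k"
    "successor_maps_in (segment U z d) k (inflations_with_coker_in C \<S>)" "F z = N"
    and f: "f \<in> Hom C (F d) X" "\<And>j. j \<in> inflations_with_coker_in C \<S> \<Longrightarrow> lifts C j f"
    by (rule small_object_argument[OF S f0 z]) blast
  have Fd: "F d \<in> Filt U C \<S>" by (rule segment_Filt[OF F(1-3)]) (use F(4) N in simp)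
  have "\<exists>g \<in> Hom C F' (F d). f \<cdot> g = f'" if F': "F' \<in> Filt U C \<S>" and f': "f' \<in> Hom C F' X" for F' f'
  proof -
    obtain g where "g \<in> Hom C F' (F d)" "f \<cdot> g = f'" by (rule Filt_lift[OF F' f(1) f' f(2)])
    then show ?thesis by blast
  qed
  moreover have "f \<in> Arr C" "Dom C f = F d" "Cod C f = X" using f(1) by (simp_all add: Hom_iff)
  ultimately have "is_precover C (Filt U C \<S>) X f" unfolding is_precover_def using Fd by simp
  then show "\<exists>f. is_precover C (Filt U C \<S>) X f" ..
qed

lemma preenveloping_right_perp:
  assumes S: "\<S> \<subseteq> Obj C" "small U \<S>"
  shows "preenveloping C (right_perp C \<S>)"
  unfolding preenveloping_def
proof (intro conjI ballI)
  show "right_perp C \<S> \<subseteq> Obj C" by (rule right_perp_Obj)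
  fix M assume M: "M \<in> Obj C"
  obtain z where z: "z \<in> U" using size_universe_infinite[OF size] infinite_imp_nonempty by blast
  obtain X k d p Q where B: "X d \<in> right_perp C \<S>" and c: "conflation C M (tr C X k z d) (X d) p Q"
    and Q: "Q \<in> Filt U C \<S>"
    by (rule special_preenvelope[OF S M z])
  let ?f = "tr C X k z d"
  have f: "?f \<in> Arr C" "Dom C ?f = M" "Cod C ?f = X d" using conflationD(2)[OF c] by (simp_all add: Hom_iff)
  have "\<exists>g \<in> Hom C (X d) T. g \<cdot> ?f = f'" if T: "T \<in> right_perp C \<S>" and f': "f' \<in> Hom C M T" for T f'
  proof -
    \<comment> \<open>The quotient of the preenvelope is filtered, so nothing obstructs the
      extension of \<open>f'\<close>.\<close>
    have "Ext1_vanishes C Q T" using Q Filt_left_perp T unfolding left_perp_def by blast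
    then obtain g where "g \<in> Hom C (X d) T" "g \<cdot> ?f = f'" by (rule Ext1_vanishes_extend[OF c _ f'])
    then show ?thesis by blast
  qed
  then have "is_preenvelope C (right_perp C \<S>) M ?f" unfolding is_preenvelope_def using f B by simp
  then show "\<exists>f. is_preenvelope C (right_perp C \<S>) M f" ..
qed

text \<open>That the two classes determine each other is the usual Galois connection argument, and
  special preenvelopes give the conflations starting at \<open>M\<close>. Only the conflations
  ending at \<open>M\<close> depend on having enough objects that map onto \<open>M\<close>; they
  remain as assumption \<open>app\<close>.\<close>

lemma complete_cotorsion_pairI:
  assumes S: "\<S> \<subseteq> Obj C" "small U \<S>"
    and app: "\<And>M. M \<in> Obj C \<Longrightarrow> \<exists>E \<in> left_perp C (right_perp C \<S>). \<exists>B \<in> right_perp C \<S>. ex_conflation C B E M"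
  shows "complete_cotorsion_pair C (left_perp C (right_perp C \<S>)) (right_perp C \<S>)"
proof -
  have SS: "\<S> \<subseteq> left_perp C (right_perp C \<S>)" using S(1) unfolding left_perp_def right_perp_def by blast
  have "right_perp C (left_perp C (right_perp C \<S>)) = right_perp C \<S>"
  proof
    show "right_perp C (left_perp C (right_perp C \<S>)) \<subseteq> right_perp C \<S>" by (rule right_perp_antimono[OF SS])
    show "right_perp C \<S> \<subseteq> right_perp C (left_perp C (right_perp C \<S>))" by (rule right_left_perp[OF right_perp_Obj])
  qed
  then have "cotorsion_pair C (left_perp C (right_perp C \<S>)) (right_perp C \<S>)"
    unfolding cotorsion_pair_def using right_perp_Obj left_perp_Obj by blast
  moreover have "\<exists>X' \<in> left_perp C (right_perp C \<S>). \<exists>Y' \<in> right_perp C \<S>. ex_conflation C M Y' X'"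
    if M: "M \<in> Obj C" for M
  proof -
    obtain z where z: "z \<in> U" using size_universe_infinite[OF size] infinite_imp_nonempty by blast
    obtain X k d p Q where B: "X d \<in> right_perp C \<S>" and c: "conflation C M (tr C X k z d) (X d) p Q"
      and Q: "Q \<in> Filt U C \<S>"
      by (rule special_preenvelope[OF S M z])
    have "Q \<in> left_perp C (right_perp C \<S>)" using Q Filt_left_perp by blast
    then show ?thesis using B c unfolding ex_conflation_def by blast
  qed
  ultimately show ?thesis unfolding complete_cotorsion_pair_def using app by blast
qed

lemma left_perp_splits:
  assumes "conflation C B b E p M" "M \<in> left_perp C \<T>" "B \<in> \<T>"
  shows "direct_summand C M E"
proof -
  note d = conflationD[OF assms(1)]
  obtain s where "s \<in> Hom C M E" "p \<cdot> s = Id C M"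
    by (rule left_perp_lift[OF assms(2,3,1) Id_Hom[OF d(9)]])
  then show ?thesis by (rule section_direct_summand[OF assms(1)])
qed

lemma enough_projectives_approximation:
  assumes S: "\<S> \<subseteq> Obj C" "small U \<S>" and ep: "enough_projectives C" and M: "M \<in> Obj C"
  obtains B E P Q b p where "B \<in> right_perp C \<S>" "conflation C B b E p M" "projective C P" "Q \<in> Filt U C \<S>"
    "ex_conflation C P E Q"
proof -
  obtain q where q: "q \<in> Deflations C" "projective C (Dom C q)" "Cod C q = M"
    using ep M unfolding enough_projectives_def by blast
  let ?P = "Dom C q"
  have qH: "q \<in> Hom C ?P M" using Deflations_Arr[OF q(1)] q(3) by (simp add: Hom_iff)
  obtain k K where k: "conflation C K k ?P q M" by (rule deflation_conflation[OF q(1) qH])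
  note dk = conflationD[OF k]
  obtain z where z: "z \<in> U" using size_universe_infinite[OF size] infinite_imp_nonempty by blast
  obtain X l d p Q where B: "X d \<in> right_perp C \<S>" and c: "conflation C K (tr C X l z d) (X d) p Q"
    and Q: "Q \<in> Filt U C \<S>"
    by (rule special_preenvelope[OF S dk(7) z])
  let ?i = "tr C X l z d"
  have iH: "?i \<in> Hom C K (X d)" by (rule conflationD(2)[OF c])
  obtain i' k' where po: "is_pushout C ?i k i' k'"
    using inflation_pushout[OF conflation_inflation[OF c], of k] iH dk(2) by (auto simp: Hom_iff)
  note e = pushoutD[OF po]
  obtain p1 where p1: "conflation C (Cod C k) i' (Cod C i') p1 Q" by (rule pushout_conflation[OF po c])
  obtain p2 where p2: "conflation C (Cod C ?i) k' (Cod C k') p2 M" by (rule pushout_conflation[OF pushout_sym[OF po] k])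
  have eq: "Cod C k = ?P" "Cod C ?i = X d" using dk(2) iH by (simp_all add: Hom_iff)
  have "ex_conflation C ?P (Cod C k') Q" unfolding ex_conflation_def using p1 eq(1) e(8) by auto
  then show ?thesis using that[OF B _ q(2) Q] p2 eq(2) by simp
qed

section \<open>Coproducts of members of \<open>\<S>\<close> as filtered objects\<close>

lemma coproduct_factor:
  assumes "is_coproduct C J F Q \<iota>" "T \<in> Obj C" "\<And>j. j \<in> J \<Longrightarrow> d j \<in> Hom C (F j) T"
  obtains h where "h \<in> Hom C Q T" "\<And>j. j \<in> J \<Longrightarrow> h \<cdot> \<iota> j = d j"
  using assms unfolding is_coproduct_def by metis

lemma coproduct_unique:
  assumes c: "is_coproduct C J F Q \<iota>" and h: "h \<in> Hom C Q T" "k \<in> Hom C Q T"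
    and eq: "\<And>j. j \<in> J \<Longrightarrow> h \<cdot> \<iota> j = k \<cdot> \<iota> j"
  shows "h = k"
proof -
  have T: "T \<in> Obj C" using h Hom_Obj by blast
  have h\<iota>: "\<forall>j \<in> J. h \<cdot> \<iota> j \<in> Hom C (F j) T" using c h(1) unfolding is_coproduct_def by (simp add: Hom_iff)
  have "\<forall>d. (\<forall>j \<in> J. d j \<in> Hom C (F j) T) \<longrightarrow> (\<exists>!x. x \<in> Hom C Q T \<and> (\<forall>j \<in> J. x \<cdot> \<iota> j = d j))"
    using c T unfolding is_coproduct_def by blast
  from this[THEN spec, of "\<lambda>j. h \<cdot> \<iota> j"] have "\<exists>!x. x \<in> Hom C Q T \<and> (\<forall>j \<in> J. x \<cdot> \<iota> j = h \<cdot> \<iota> j)"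
    using h\<iota> by simp
  then show ?thesis using h eq by metis
qed

text \<open>
  The index set is well-ordered as an initial segment of \<open>|U|\<close>, and one summand is adjoined at each
  successor. Existence of the partial coproducts is not given in advance; therefore the chain is
  built over the coproduct and compared with it only at the end.
\<close>

lemma coproduct_chain:
  fixes J :: "'u set"
  assumes S: "\<S> \<subseteq> Obj C" and J: "small U J" and FJ: "F ` J \<subseteq> \<S>" and cop: "is_coproduct C J F G \<iota>"
  obtains z d X k f s where "(z, d) \<in> |U|" "chain C (segment U z d) X k"
    "successor_maps_in (segment U z d) k (inflations_with_coker_in C \<S>)" "is_zero_object C (X z)"
    "f \<in> Hom C (X d) G" "s \<in> Hom C G (X d)" "s \<cdot> f = Id C (X d)" "f \<cdot> s = Id C G"
proof -
  let ?r = "|U|"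
  note wo = card_of_wo[of U]
  have FU: "Field ?r = U" by (rule Field_card_of)
  have GO: "G \<in> Obj C" using cop unfolding is_coproduct_def by blast
  have \<iota>: "\<iota> j \<in> Hom C (F j) G" if "j \<in> J" for j using cop that unfolding is_coproduct_def by blast
  obtain N where N: "is_zero_object C N" using zero_object_exists by blast
  have f0: "Zero C N G \<in> Hom C N G" using GO zero_object_Obj[OF N] by (simp add: Hom_iff)
  obtain u where "u \<in> U" using size_universe_infinite[OF size] infinite_imp_nonempty by blast
  \<comment> \<open>With \<open>z\<close> least in \<open>U\<close>, the segment from
    \<open>z\<close> to \<open>d\<close> contains every index below \<open>d\<close>, so no summand
    is missed.\<close>
  then obtain z where z: "z \<in> U" "\<And>y. (y, z) \<in> ?r - Relation.Id \<Longrightarrow> y \<notin> U"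
    by (rule wfE_min[OF Well_order_wf[OF wo]]) blast
  have zle: "(z, a) \<in> ?r" if "a \<in> U" for a
    using ord_not_le[OF wo, of z a] z(2)[of a] that z(1) FU unfolding ord_less_def by auto
  \<comment> \<open>The step leaving index \<open>a\<close> adjoins the summand \<open>e a\<close>,
    where \<open>e\<close> matches the indices below \<open>d\<close> with \<open>J\<close>. Each
    such step is completed by \<open>d\<close>, so stage \<open>d\<close> carries all
    summands.\<close>
  obtain d where d: "d \<in> Field ?r" "|J| =o Restr ?r (underS ?r d)"
    using J ordLess_iff_ordIso_Restr[OF wo card_of_wo, of J] unfolding small_def by blast
  have dU: "d \<in> U" using d(1) FU by simp
  have sub: "underS ?r d \<subseteq> Field ?r" unfolding underS_def by (auto simp: FieldI1)
  obtain e0 where e0: "bij_betw e0 J (underS ?r d)"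
    using d(2) Field_Restr'[OF wo sub] unfolding ordIso_def BNF_Wellorder_Embedding.iso_def by (auto simp: Field_card_of)
  define e where "e = inv_into J e0"
  have e: "bij_betw e (underS ?r d) J" unfolding e_def by (rule bij_betw_inv_into[OF e0])
  have eJ: "e a \<in> J" if "ord_less ?r a d" for a using e that unfolding bij_betw_def underS_def ord_less_def by auto
  have zd: "(z, d) \<in> ?r" by (rule zle[OF dU])
  let ?T = "segment U z d"
  note sf = segment_facts[OF zd]
  have cv: "convex_in ?r {c. (z, c) \<in> ?r \<and> (c, d) \<in> ?r}" by (rule interval_convex[OF wo])
  have woT: "Well_order ?T" by (rule Well_order_Restr[OF wo])
  \<comment> \<open>Since \<open>Z\<close> is a zero object, the pushout is a direct sum of the old
    stage and the summand \<open>F (e a)\<close>, with injections \<open>t\<close> and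
    \<open>c\<close>.\<close>
  define Q where "Q a g Y t h \<longleftrightarrow> (\<exists>Z o' w c. is_zero_object C Z \<and> o' \<in> Hom C Z (F (e a)) \<and> is_pushout C o' w t c \<and>
     c \<in> Hom C (F (e a)) Y \<and> h \<cdot> c = \<iota> (e a))" for a and g :: "'u \<Rightarrow> 'o \<times> ('u \<Rightarrow> 'm) \<times> 'm" and Y t h
  obtain g where ch: "chain C ?T (row_obj g) (row_map g)" and gz: "row_obj g z = N"
    and gN: "\<And>a. a \<in> Field ?T \<Longrightarrow> row_arr g a \<in> Hom C (row_obj g a) G"
    and gg: "\<And>a b. ord_less ?T a b \<Longrightarrow> row_arr g b \<cdot> row_map g a b = row_arr g a"
    and gQ: "\<And>a b. is_successor ?T a b \<Longrightarrow> row_map g a b \<in> inflations_with_coker_in C \<S>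
        \<and> Q a g (row_obj g b) (row_map g a b) (row_arr g b)"
  proof (rule chain_construction[OF woT sf(2) sf(5) f0 inflations_with_coker_in_Inflations, of Q \<S>])
    show "Q a g Y t h = Q a g' Y t h" for a g g' Y t h unfolding Q_def ..
    fix a and g :: "'u \<Rightarrow> 'o \<times> ('u \<Rightarrow> 'm) \<times> 'm"
    assume a: "a \<in> Field ?T" "\<exists>b. ord_less ?T a b" and gN: "\<And>b. (b, a) \<in> ?T \<Longrightarrow> row_arr g b \<in> Hom C (row_obj g b) G"
    have ga: "row_arr g a \<in> Hom C (row_obj g a) G" by (rule gN[OF Well_orderD(3)[OF woT a(1)]])
    then have Xo: "row_obj g a \<in> Obj C" using Hom_Obj by blast
    obtain b where "ord_less ?T a b" using a(2) by blast
    then have "ord_less ?r a d" unfolding ord_less_Restr using ord_less_le_trans[OF wo] by blast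
    then have j: "e a \<in> J" by (rule eJ)
    have Fo: "F (e a) \<in> \<S>" "F (e a) \<in> Obj C" using j FJ S by blast+
    obtain Z o' where Z: "is_zero_object C Z" "conflation C Z o' (F (e a)) (Id C (F (e a))) (F (e a))"
      by (rule zero_conflation[OF Fo(2)])
    note dz = conflationD[OF Z(2)]
    have w: "Zero C Z (row_obj g a) \<in> Hom C Z (row_obj g a)" using dz(7) Xo by (simp add: Hom_iff)
    obtain t c where po: "is_pushout C o' (Zero C Z (row_obj g a)) t c"
      using inflation_pushout[OF conflation_inflation[OF Z(2)], of "Zero C Z (row_obj g a)"] w dz(2) by (auto simp: Hom_iff)
    note pd = pushoutD[OF po]
    have t: "t \<in> Hom C (row_obj g a) (Cod C t)" "c \<in> Hom C (F (e a)) (Cod C t)"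
      using pd w dz(2) by (simp_all add: Hom_iff)
    have "row_arr g a \<cdot> Zero C Z (row_obj g a) = \<iota> (e a) \<cdot> o'"
      by (rule zero_object_from[OF Z(1), of _ G]) (use ga w \<iota>[OF j] dz(2) GO dz(7) in \<open>simp_all add: Hom_iff\<close>)
    then obtain h where h: "h \<in> Hom C (Cod C t) G" "h \<cdot> t = row_arr g a" "h \<cdot> c = \<iota> (e a)"
      using pushout_factor[OF po, of "row_arr g a" G "\<iota> (e a)"] ga w \<iota>[OF j] dz(2,7) Xo by (auto simp: Hom_iff)
    have "t \<in> inflations_with_coker_in C \<S>"
      by (rule pushout_inflations_with_coker_in[OF po inflations_with_coker_inI[OF Z(2) Fo(1)]])
    moreover have "Q a g (Cod C t) t h" unfolding Q_def using Z(1) dz(2) po t(2) h(3) by blast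
    ultimately show "\<exists>Y t h. t \<in> inflations_with_coker_in C \<S> \<and> t \<in> Hom C (row_obj g a) Y \<and> h \<in> Hom C Y G \<and>
       h \<cdot> t = row_arr g a \<and> Q a g Y t h"
      using t(1) h by blast
  qed (use that in blast)
  let ?X = "row_obj g" and ?k = "row_map g" and ?f = "row_arr g d"
  have fH: "?f \<in> Hom C (?X d) G" by (rule gN[OF sf(3)])
  have inT: "a \<in> Field ?T" if "ord_less ?r a d" for a
    unfolding sf(1) using zle ord_less_Field[OF that] FU that unfolding ord_less_def by auto
  have ltT: "ord_less ?T a d" if "ord_less ?r a d" for a
    using inT[OF that] sf(6)[OF inT[OF that]] that unfolding ord_less_def by blast
  \<comment> \<open>The last clause keeps of the pushout that the old stage and the new summand are
    jointly epimorphic. Collecting the conditions in one predicate lets the successor and the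
    injection be chosen one after the other.\<close>
  define good where "good a b c \<longleftrightarrow> is_successor ?T a b \<and> c \<in> Hom C (F (e a)) (?X b) \<and> row_arr g b \<cdot> c = \<iota> (e a) \<and>
      (\<forall>T x y. x \<in> Hom C (?X b) T \<and> y \<in> Hom C (?X b) T \<and> x \<cdot> ?k a b = y \<cdot> ?k a b \<and> x \<cdot> c = y \<cdot> c \<longrightarrow> x = y)" for a b c
  have ex: "\<exists>b. \<exists>c. good a b c" if a: "ord_less ?r a d" for a
  proof -
    obtain b where b: "is_successor ?T a b" by (rule successor_exists[OF woT ltT[OF a]])
    obtain Z o' w c where Q: "o' \<in> Hom C Z (F (e a))" "is_pushout C o' w (?k a b) c"
      "c \<in> Hom C (F (e a)) (?X b)" "row_arr g b \<cdot> c = \<iota> (e a)"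
      using gQ[OF b] unfolding Q_def by blast
    have "Cod C (?k a b) = ?X b" using chainD(5)[OF ch is_successor_less[OF b]] by (simp add: Hom_iff)
    then have "x = y" if "x \<in> Hom C (?X b) T" "y \<in> Hom C (?X b) T" "x \<cdot> ?k a b = y \<cdot> ?k a b" "x \<cdot> c = y \<cdot> c" for x y T
      using pushout_unique[OF Q(2), of x T y] that by simp
    then have "good a b c" unfolding good_def using b Q(3,4) by blast
    then show ?thesis by blast
  qed
  define sc where "sc a = (SOME b. \<exists>c. good a b c)" for a
  define cc where "cc a = (SOME c. good a (sc a) c)" for a
  have "good a (sc a) (cc a)" if "ord_less ?r a d" for a
    using someI_ex[OF someI_ex[OF ex[OF that], folded sc_def]] unfolding cc_def .
  then have sc: "\<And>a. ord_less ?r a d \<Longrightarrow> is_successor ?T a (sc a)"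
    and cc: "\<And>a. ord_less ?r a d \<Longrightarrow> cc a \<in> Hom C (F (e a)) (?X (sc a))"
      "\<And>a. ord_less ?r a d \<Longrightarrow> row_arr g (sc a) \<cdot> cc a = \<iota> (e a)"
    and epi: "\<And>a T x y. \<lbrakk>ord_less ?r a d; x \<in> Hom C (?X (sc a)) T; y \<in> Hom C (?X (sc a)) T;
        x \<cdot> ?k a (sc a) = y \<cdot> ?k a (sc a); x \<cdot> cc a = y \<cdot> cc a\<rbrakk> \<Longrightarrow> x = y"
    unfolding good_def by blast+
  have trH: "tr C ?X ?k a d \<in> Hom C (?X a) (?X d)" if "a \<in> Field ?T" for a
    by (rule chainD(7)[OF ch sf(6)[OF that]])
  have ftr: "?f \<cdot> tr C ?X ?k a d = row_arr g a" if a: "a \<in> Field ?T" for a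
  proof (cases "a = d")
    case True
    then show ?thesis using fH by (simp add: tr_def Hom_iff)
  next
    case False
    then show ?thesis using gg[of a d] sf(6)[OF a] unfolding tr_def ord_less_def by simp
  qed
  have scF: "sc a \<in> Field ?T" if "ord_less ?r a d" for a
    using is_successor_less[OF sc[OF that]] ord_less_Field[of ?T a "sc a"] by blast
  \<comment> \<open>The injection of the summand \<open>j\<close>: it enters at the successor of the
    index \<open>e0 j\<close> and is carried on to stage \<open>d\<close>.\<close>
  define \<sigma> where "\<sigma> j = (let a = e0 j in tr C ?X ?k (sc a) d \<cdot> cc a)" for j
  have e0d: "ord_less ?r (e0 j) d" "e (e0 j) = j" if "j \<in> J" for j
    using e0 that unfolding e_def bij_betw_def underS_def ord_less_def by (auto simp: inv_into_f_f)
  have \<sigma>: "\<sigma> j \<in> Hom C (F j) (?X d)" "?f \<cdot> \<sigma> j = \<iota> j" if "j \<in> J" for j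
  proof -
    note a = e0d[OF that]
    show "\<sigma> j \<in> Hom C (F j) (?X d)"
      using Cmp_Hom[OF cc(1)[OF a(1)] trH[OF scF[OF a(1)]]] a(2) unfolding \<sigma>_def Let_def by simp
    have "?f \<cdot> \<sigma> j = row_arr g (sc (e0 j)) \<cdot> cc (e0 j)"
      using Cmp_rewrite[OF ftr[OF scF[OF a(1)]], of "cc (e0 j)"] fH trH[OF scF[OF a(1)]] cc(1)[OF a(1)]
      unfolding \<sigma>_def Let_def by (simp add: Hom_iff)
    then show "?f \<cdot> \<sigma> j = \<iota> j" using cc(2)[OF a(1)] a(2) by simp
  qed
  have Xd: "?X d \<in> Obj C" using fH Hom_Obj by blast
  obtain s where s: "s \<in> Hom C G (?X d)" "\<And>j. j \<in> J \<Longrightarrow> s \<cdot> \<iota> j = \<sigma> j"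
    using coproduct_factor[OF cop Xd \<sigma>(1)] by metis
  have fs: "?f \<cdot> s = Id C G"
  proof (rule coproduct_unique[OF cop Cmp_Hom[OF s(1) fH] Id_Hom[OF GO]])
    fix j assume j: "j \<in> J"
    have "(?f \<cdot> s) \<cdot> \<iota> j = ?f \<cdot> (s \<cdot> \<iota> j)" using s(1) fH \<iota>[OF j] by (simp add: Hom_iff)
    then show "(?f \<cdot> s) \<cdot> \<iota> j = Id C G \<cdot> \<iota> j" using s(2)[OF j] \<sigma>(2)[OF j] \<iota>[OF j] by (simp add: Hom_iff)
  qed
  \<comment> \<open>The identity on \<open>G\<close> could be tested on the injections. The one on
    the last stage needs induction along the chain: a map out of a stage is determined by the
    earlier stages and, at a successor, by the summand just adjoined. The case \<open>b = d\<close>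
    is the claim.\<close>
  have "b \<in> Field ?T \<longrightarrow> s \<cdot> row_arr g b = tr C ?X ?k b d" for b
  proof (induction b rule: wf_induct_rule[OF Well_order_wf[OF woT]])
    case (1 b)
    show ?case
    proof
      assume b: "b \<in> Field ?T"
      have sb: "s \<cdot> row_arr g b \<in> Hom C (?X b) (?X d)" by (rule Cmp_Hom[OF gN[OF b] s(1)])
      have IH: "(s \<cdot> row_arr g b) \<cdot> ?k a b = tr C ?X ?k b d \<cdot> ?k a b" if a: "ord_less ?T a b" for a
      proof -
        note ka = chainD(5)[OF ch a] and aF = conjunct1[OF ord_less_Field[OF a]]
        have "(s \<cdot> row_arr g b) \<cdot> ?k a b = s \<cdot> (row_arr g b \<cdot> ?k a b)"
          using s(1) gN[OF b] ka by (simp add: Hom_iff)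
        also have "\<dots> = s \<cdot> row_arr g a" unfolding gg[OF a] ..
        also have "\<dots> = tr C ?X ?k a d" using 1[of a] a aF unfolding ord_less_def by blast
        also have "\<dots> = tr C ?X ?k b d \<cdot> tr C ?X ?k a b"
          by (rule chainD(8)[OF ch _ sf(6)[OF b], symmetric]) (use a in \<open>auto simp: ord_less_def\<close>)
        also have "tr C ?X ?k a b = ?k a b" using a unfolding tr_def ord_less_def by simp
        finally show ?thesis .
      qed
      consider "is_least ?T b" | a where "is_successor ?T a b" | "is_limit ?T b"
        using least_successor_limit[OF b] by blast
      then show "s \<cdot> row_arr g b = tr C ?X ?k b d"
      proof cases
        case 1
        then have "b = z" by (rule is_least_unique[OF woT _ sf(2)])
        then show ?thesis
          using zero_object_from[OF N, of _ "?X d"] sb trH[OF b] gz by simp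
      next
        case 2
        have "ord_less ?r a d"
          using is_successor_less[OF 2] b ord_less_le_trans[OF wo] unfolding sf(1) ord_less_Restr by blast
        note ad = this
        have bs: "b = sc a"
        proof -
          note l1 = is_successor_less[OF 2] and l2 = is_successor_less[OF sc[OF ad]]
          have "(b, sc a) \<in> ?T \<or> (sc a, b) \<in> ?T" using Well_orderD(6)[OF woT b scF[OF ad]] .
          then show ?thesis using 2 sc[OF ad] l1 l2 unfolding is_successor_def ord_less_def by blast
        qed
        have eJa: "e a \<in> J" by (rule eJ[OF ad])
        have "a \<in> underS ?r d" using ad unfolding underS_def ord_less_def by blast
        then have e0e: "e0 (e a) = a" using e0 unfolding e_def bij_betw_def by (simp add: f_inv_into_f)
        show ?thesis
        proof (rule epi[OF ad])
          show "s \<cdot> row_arr g b \<in> Hom C (?X (sc a)) (?X d)" "tr C ?X ?k b d \<in> Hom C (?X (sc a)) (?X d)"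
            using sb trH[OF b] bs by simp_all
          show "(s \<cdot> row_arr g b) \<cdot> ?k a (sc a) = tr C ?X ?k b d \<cdot> ?k a (sc a)"
            using IH[OF is_successor_less[OF 2]] bs by simp
          have "(s \<cdot> row_arr g b) \<cdot> cc a = s \<cdot> (row_arr g (sc a) \<cdot> cc a)"
            using s(1) gN[OF b] cc(1)[OF ad] bs by (simp add: Hom_iff)
          also have "\<dots> = \<sigma> (e a)" using cc(2)[OF ad] s(2)[OF eJa] by simp
          also have "\<dots> = tr C ?X ?k b d \<cdot> cc a" unfolding \<sigma>_def e0e Let_def bs ..
          finally show "(s \<cdot> row_arr g b) \<cdot> cc a = tr C ?X ?k b d \<cdot> cc a" .
        qed
      next
        case 3
        show ?thesis
          by (rule colimit_unique[OF chainD(3)[OF ch 3] chainD(2)[OF ch] sb trH[OF b] IH])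
            (simp add: underS_iff)
      qed
    qed
  qed
  then have "s \<cdot> ?f = Id C (?X d)" using sf(3) by (simp add: tr_def)
  moreover have "successor_maps_in ?T ?k (inflations_with_coker_in C \<S>)"
    unfolding successor_maps_in_def using gQ by blast
  ultimately show ?thesis using that[OF zd ch _ _ fH s(1) _ fs] gz N by simp
qed

text \<open>The coproduct is first replaced by the isomorphic \<open>W d\<close>, the actual end of
  a chain. The preenvelope of the kernel is then pushed out along its inclusion into
  \<open>W d\<close>, which gives a chain from \<open>W d\<close> to the middle term; joined
  together, the two chains filter that term starting from zero.\<close>

lemma generating_approximation:
  assumes S: "\<S> \<subseteq> Obj C" "small U \<S>" and gen: "generating U C \<S>" and M: "M \<in> Obj C"
  obtains B E b p where "B \<in> right_perp C \<S>" "E \<in> Filt U C \<S>" "conflation C B b E p M"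
proof -
  obtain q and J :: "'u set" and F \<iota> where q: "q \<in> Deflations C" "Cod C q = M"
    and J: "small U J" "F ` J \<subseteq> \<S>" "is_coproduct C J F (Dom C q) \<iota>"
    using gen M unfolding generating_def by blast
  let ?G = "Dom C q"
  have qH: "q \<in> Hom C ?G M" using Deflations_Arr[OF q(1)] q(2) by (simp add: Hom_iff)
  obtain z d W l f s where zd: "(z, d) \<in> |U|" and W: "chain C (segment U z d) W l"
    "successor_maps_in (segment U z d) l (inflations_with_coker_in C \<S>)" "is_zero_object C (W z)"
    and f: "f \<in> Hom C (W d) ?G" "s \<in> Hom C ?G (W d)" "s \<cdot> f = Id C (W d)" "f \<cdot> s = Id C ?G"
    by (rule coproduct_chain[OF S(1) J])
  obtain k0 K where k0: "conflation C K k0 ?G q M" by (rule deflation_conflation[OF q(1) qH])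
  have k: "conflation C K (s \<cdot> k0) (W d) (q \<cdot> f) M"
    by (rule conflation_iso_middle[OF k0 f(2,1) f(4,3)])
  note dk = conflationD[OF k]
  note sf = segment_facts[OF zd]
  \<comment> \<open>The index at which the chain of \<open>W\<close> stops is the start of the new
    one, so the segments are adjacent and no shift of ordinals is required.\<close>
  obtain X m d' p Q where dd: "(d, d') \<in> |U|" and X: "chain C (segment U d d') X m"
    "successor_maps_in (segment U d d') m (inflations_with_coker_in C \<S>)" "X d = K"
    and B: "X d' \<in> right_perp C \<S>" and c: "conflation C K (tr C X m d d') (X d') p Q"
    by (rule special_preenvelope[OF S dk(7) sf(8)])
  note sf' = segment_facts[OF dd]
  have g: "s \<cdot> k0 \<in> Hom C (X d) (W d)" using dk(2) X(3) by simp
  obtain E e b where E: "chain C (segment U d d') E e" "E d = W d"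
    "successor_maps_in (segment U d d') e (inflations_with_coker_in C \<S>)"
    and po: "\<And>a. a \<in> Field (segment U d d') \<Longrightarrow> is_pushout C (tr C X m d a) (s \<cdot> k0) (tr C E e d a) (b a)"
    by (rule chain_pushout[OF X(1) sf'(2) X(2) sf'(5) g]) blast
  obtain V v where V: "chain C (segment U z d') V v" "V z = W z" "V d' = E d'"
    "successor_maps_in (segment U z d') v (inflations_with_coker_in C \<S>)"
    by (rule chain_glue[OF card_of_wo zd dd W(1) E(1) E(2)[symmetric] W(2) E(3)])
  have "(z, d') \<in> |U|" by (rule Well_orderD(4)[OF card_of_wo zd dd])
  then have EF: "E d' \<in> Filt U C \<S>" using segment_Filt[OF _ V(1,4)] V(2,3) W(3) by simp
  note po' = po[OF sf'(3)]
  obtain p' where p': "conflation C (Cod C (tr C X m d d')) (b d') (Cod C (b d')) p' M"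
    by (rule pushout_conflation[OF pushout_sym[OF po'] k])
  have "Cod C (tr C X m d d') = X d'" using conflationD(2)[OF c] by (simp add: Hom_iff)
  moreover have "Cod C (b d') = E d'"
    using pushoutD(8)[OF po'] segment_inflation(2)[OF dd E(1,3)] by (simp add: Hom_iff)
  ultimately show ?thesis using that[OF B EF] p' by simp
qed

end

section \<open>Assembly of the three statements\<close>

theorem corollary2p15:
  fixes U :: "'u set" and C :: "('o, 'm) exact_data" and \<S> \<T> :: "'o set"
  assumes "size_universe U"
    and "efficient_exact_category U C"
    and "locally_small U C"
    and "\<S> \<subseteq> Obj C" and "small U \<S>"
    and "\<T> = right_perp C \<S>"
  shows
    "(precovering C (Filt U C \<S>) \<and> preenveloping C \<T>) \<and>
     (generating U C \<S> \<longrightarrow>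
        complete_cotorsion_pair C (left_perp C \<T>) \<T> \<and>
        left_perp C \<T> = {M. \<exists>E \<in> Filt U C \<S>. direct_summand C M E}) \<and>
     (enough_projectives C \<longrightarrow>
        complete_cotorsion_pair C (left_perp C \<T>) \<T> \<and>
        (\<forall>M \<in> Obj C. M \<in> left_perp C \<T> \<longleftrightarrow>
           (\<exists>P E X. projective C P \<and> X \<in> Filt U C \<S> \<and> ex_conflation C P E X \<and>
                    direct_summand C M E)))"
proof -
  interpret sized_efficient U C
    using assms(1-3) by (simp add: sized_efficient_def sized_efficient_axioms_def)
  note S = assms(4,5)
  note T = assms(6)
  have lp: "E \<in> left_perp C \<T>" if "E \<in> Filt U C \<S>" for E using that Filt_left_perp unfolding T by blast
  have summand: "M \<in> left_perp C \<T>" if "direct_summand C M E" "E \<in> left_perp C \<T>" for M E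
    using left_perp_summand[OF that] right_perp_Obj unfolding T by blast
  \<comment> \<open>Used twice in the case of enough projectives: it places the middle term of the
    approximation in \<open>left_perp C \<T>\<close>, and with \<open>summand\<close> it gives the
    backward implication of the description.\<close>
  have extension: "E \<in> left_perp C \<T>" if h: "projective C P" "X \<in> Filt U C \<S>" "ex_conflation C P E X" for P E X
  proof -
    obtain i p where "conflation C P i E p X" using h(3) unfolding ex_conflation_def by blast
    then show ?thesis
      using left_perp_extension projective_left_perp[OF h(1)] lp[OF h(2)] right_perp_Obj unfolding T by blast
  qed
  have 2: "complete_cotorsion_pair C (left_perp C \<T>) \<T> \<and>
      left_perp C \<T> = {M. \<exists>E \<in> Filt U C \<S>. direct_summand C M E}" if gen: "generating U C \<S>"
  proof
    show "complete_cotorsion_pair C (left_perp C \<T>) \<T>"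
      unfolding T
    proof (rule complete_cotorsion_pairI[OF S])
      fix M assume "M \<in> Obj C"
      then obtain B E b p where "B \<in> right_perp C \<S>" "E \<in> Filt U C \<S>" "conflation C B b E p M"
        by (rule generating_approximation[OF S gen])
      then show "\<exists>E \<in> left_perp C (right_perp C \<S>). \<exists>B \<in> right_perp C \<S>. ex_conflation C B E M"
        using lp unfolding T ex_conflation_def by blast
    qed
    have "\<exists>E \<in> Filt U C \<S>. direct_summand C M E" if M: "M \<in> left_perp C \<T>" for M
    proof -
      have "M \<in> Obj C" using M left_perp_Obj by blast
      then obtain B E b p where "B \<in> right_perp C \<S>" "E \<in> Filt U C \<S>" "conflation C B b E p M"
        by (rule generating_approximation[OF S gen])
      then show ?thesis using left_perp_splits[OF _ M] unfolding T by blast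
    qed
    then show "left_perp C \<T> = {M. \<exists>E \<in> Filt U C \<S>. direct_summand C M E}"
      using summand lp by blast
  qed
  have 3: "complete_cotorsion_pair C (left_perp C \<T>) \<T> \<and>
      (\<forall>M \<in> Obj C. M \<in> left_perp C \<T> \<longleftrightarrow>
         (\<exists>P E X. projective C P \<and> X \<in> Filt U C \<S> \<and> ex_conflation C P E X \<and> direct_summand C M E))"
    if ep: "enough_projectives C"
  proof (intro conjI ballI iffI)
    show "complete_cotorsion_pair C (left_perp C \<T>) \<T>"
      unfolding T
    proof (rule complete_cotorsion_pairI[OF S])
      fix M assume "M \<in> Obj C"
      then obtain B E P Q b p where B: "B \<in> right_perp C \<S>" "conflation C B b E p M" "projective C P"
        "Q \<in> Filt U C \<S>" "ex_conflation C P E Q"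
        by (rule enough_projectives_approximation[OF S ep])
      have "ex_conflation C B E M" using B(2) unfolding ex_conflation_def by blast
      then show "\<exists>E \<in> left_perp C (right_perp C \<S>). \<exists>B \<in> right_perp C \<S>. ex_conflation C B E M"
        using extension[OF B(3-5)] B(1) unfolding T by blast
    qed
    fix M
    {
      assume "M \<in> Obj C" and M: "M \<in> left_perp C \<T>"
      then obtain B E P Q b p where B: "B \<in> right_perp C \<S>" "conflation C B b E p M" "projective C P"
        "Q \<in> Filt U C \<S>" "ex_conflation C P E Q"
        by (elim enough_projectives_approximation[OF S ep])
      have "direct_summand C M E" by (rule left_perp_splits[OF B(2) M]) (use B(1) T in simp)
      then show "\<exists>P E X. projective C P \<and> X \<in> Filt U C \<S> \<and> ex_conflation C P E X \<and> direct_summand C M E"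
        using B(3-5) by blast
    }
    assume "\<exists>P E X. projective C P \<and> X \<in> Filt U C \<S> \<and> ex_conflation C P E X \<and> direct_summand C M E"
    then show "M \<in> left_perp C \<T>" using extension summand by blast
  qed
  show ?thesis
    using precovering_Filt[OF S] preenveloping_right_perp[OF S] 2 3 unfolding T by blast
qed

end
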